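(* Let $0<\alpha<2$, $0<\beta\le 1$, and let $B_{\alpha,\beta}$ be grey Brownian motion with convolution regularization $B^{\varepsilon}_{\alpha,\beta}=\psi_\varepsilon*B_{\alpha,\beta}$. For any continuous bounded real function $f$ and any bounded interval $I\subset[0,\infty)$, almost surely, $$\varepsilon^{1-\alpha/2}\sqrt{\frac{\pi}{2}}\,C_\psi^{-1}\int_{\mathbb{R}}f(x)\,C^{B^{\varepsilon}_{\alpha,\beta}}(x,I)\,dx\ \longrightarrow\ \sqrt{Y_\beta}\int_{\mathbb{R}}f(x)\,L^{B_{\alpha,\beta}}(x,I)\,dx\qquad(\varepsilon\to0),$$ where $C^{B^{\varepsilon}_{\alpha,\beta}}(x,I)=\#\{t\in I:\ B^{\varepsilon}_{\alpha,\beta}(t)=x\}$ is the number of crossings of level $x$ in $I$, and $L^{B_{\alpha,\beta}}(\cdot,I)$ is the local time of $B_{\alpha,\beta}$ over $I$.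
   Context: $E_\beta(x)=\sum_{n\ge0}x^n/\Gamma(\beta n+1)$ is the Mittag-Leffler function. Let $Y_\beta\ge 0$ be a random variable whose law (with density $M_\beta$, the M-Wright function; for $\beta=1$ the law is the point mass at $1$) is determined by $\mathbb{E}(e^{-sY_\beta})=E_\beta(-s)$, $s\ge0$. Let $B_H$ be a standard fractional Brownian motion with Hurst parameter $H=\alpha/2$ and continuous paths, i.e. the centered Gaussian process with covariance $\frac12(t^{\alpha}+s^{\alpha}-|t-s|^{\alpha})$, independent of $Y_\beta$. Grey Brownian motion is taken in the representation $B_{\alpha,\beta}(t)=\sqrt{Y_\beta}\,B_H(t)$, $t\ge0$. The function $\psi$ has bounded variation, support included in $[-1,1]$, and $\int_{\mathbb{R}}\psi(t)\,dt=1$; $\psi_\varepsilon(t)=\frac1\varepsilon\psi(\frac t\varepsilon)$ for $\varepsilon>0$, and $B^\varepsilon_{\alpha,\beta}=\psi_\varepsilon*B_{\alpha,\beta}$ is the convolution of $\psi_\varepsilon$ with $B_{\alpha,\beta}$ in the time variable. The constant $C_\psi$ is $$C_\psi=\left(-\frac12\int_{-1}^1\int_{-1}^1|u-v|^\alpha\,d\psi(u)\,d\psi(v)\right)^{1/2},$$ where $d\psi$ is the signed Stieltjes measure of $\psi$. The local time $L^{B_{\alpha,\beta}}(\cdot,I)$ is the density with respect to Lebesgue measure of the occupation measure $B\mapsto\int_I 1_B(B_{\alpha,\beta}(s))\,ds$, $B\in\mathcal{B}(\mathbb{R})$; it exists almost surely. *)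

theory Defs
  imports "HOL-Probability.Probability"
begin

definition mittag_leffler :: "real \<Rightarrow> real \<Rightarrow> real" where
  "mittag_leffler \<beta> x = (\<Sum>n. x ^ n / Gamma (\<beta> * real n + 1))"


subsection \<open>Fractional and grey Brownian motion\<close>

text \<open>Normal laws may be degenerate: a constant is Gaussian with variance zero.\<close>

definition gaussian_rv :: "'a measure \<Rightarrow> ('a \<Rightarrow> real) \<Rightarrow> bool" where
  "gaussian_rv M X \<longleftrightarrow> X \<in> borel_measurable M \<and>
     ((\<exists>\<mu> \<sigma>. \<sigma> > 0 \<and> distributed M lborel X (\<lambda>x. ennreal (normal_density \<mu> \<sigma> x))) \<or>
      (\<exists>\<mu>. AE \<omega> in M. X \<omega> = \<mu>))"

definition gaussian_process :: "'a measure \<Rightarrow> real set \<Rightarrow> (real \<Rightarrow> 'a \<Rightarrow> real) \<Rightarrow> bool" where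
  "gaussian_process M T X \<longleftrightarrow>
     (\<forall>J c. finite J \<and> J \<subseteq> T \<longrightarrow> gaussian_rv M (\<lambda>\<omega>. \<Sum>t\<in>J. c t * X t \<omega>))"

text \<open>The index set is the half-line \<open>{0..}\<close>; values of \<open>X\<close> at negative times are irrelevant.\<close>

definition fractional_brownian_motion ::
    "'a measure \<Rightarrow> real \<Rightarrow> (real \<Rightarrow> 'a \<Rightarrow> real) \<Rightarrow> bool" where
  "fractional_brownian_motion M H X \<longleftrightarrow>
     gaussian_process M {0..} X \<and>
     (\<forall>t\<ge>0. (\<integral>\<omega>. X t \<omega> \<partial>M) = 0) \<and>
     (\<forall>s\<ge>0. \<forall>t\<ge>0. (\<integral>\<omega>. X s \<omega> * X t \<omega> \<partial>M) =
        (t powr (2 * H) + s powr (2 * H) - \<bar>t - s\<bar> powr (2 * H)) / 2) \<and>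
     (\<forall>\<omega>\<in>space M. continuous_on {0..} (\<lambda>t. X t \<omega>))"

definition grey_brownian_motion ::
    "('a \<Rightarrow> real) \<Rightarrow> (real \<Rightarrow> 'a \<Rightarrow> real) \<Rightarrow> real \<Rightarrow> 'a \<Rightarrow> real" where
  "grey_brownian_motion Y X t \<omega> = sqrt (Y \<omega>) * X t \<omega>"


subsection \<open>Convolution regularization\<close>

definition rescaled :: "(real \<Rightarrow> real) \<Rightarrow> real \<Rightarrow> real \<Rightarrow> real" where
  "rescaled \<psi> \<epsilon> t = \<psi> (t / \<epsilon>) / \<epsilon>"

text \<open>A path \<open>x\<close> is given on \<open>{0..}\<close> only; in the convolution it is continued by zero to negative
  times. Grey Brownian motion starts at \<open>0\<close> almost surely, so this continuation is continuous.\<close>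

definition regularized_path :: "(real \<Rightarrow> real) \<Rightarrow> real \<Rightarrow> (real \<Rightarrow> real) \<Rightarrow> real \<Rightarrow> real" where
  "regularized_path \<psi> \<epsilon> x t = (LINT s:{0..}|lborel. rescaled \<psi> \<epsilon> (t - s) * x s)"


subsection \<open>Bounded variation and the signed Stieltjes measure\<close>

definition variation_sums :: "(real \<Rightarrow> real) \<Rightarrow> real set \<Rightarrow> real set" where
  "variation_sums g S =
     {(\<Sum>i<n. \<bar>g (t (Suc i)) - g (t i)\<bar>) | (n::nat) (t::nat \<Rightarrow> real). mono t \<and> range t \<subseteq> S}"

definition bounded_variation_on :: "(real \<Rightarrow> real) \<Rightarrow> real set \<Rightarrow> bool" where
  "bounded_variation_on g S \<longleftrightarrow> bdd_above (variation_sums g S)"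

definition variation_function :: "(real \<Rightarrow> real) \<Rightarrow> real \<Rightarrow> real" where
  "variation_function g x = Sup (variation_sums g {..x})"

definition right_limit :: "(real \<Rightarrow> real) \<Rightarrow> real \<Rightarrow> real" where
  "right_limit F x = Lim (at_right x) F"

text \<open>For \<open>g\<close> of bounded variation and variation function \<open>V\<close>, both \<open>(V + g) / 2\<close> and
  \<open>(V - g) / 2\<close> are nondecreasing and their difference is \<open>g\<close>. The signed measure \<open>dg\<close>, which
  assigns \<open>g(b+) - g(a+)\<close> to \<open>{a<..b}\<close>, is the difference of the Stieltjes measures of the
  right-continuous versions of these two functions. Atoms at the boundary of the domain of
  integration \<open>A\<close> are counted if they lie in \<open>A\<close>.\<close>

definition stieltjes_integral :: "(real \<Rightarrow> real) \<Rightarrow> real set \<Rightarrow> (real \<Rightarrow> real) \<Rightarrow> real" where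
  "stieltjes_integral g A h =
     (LINT u:A|interval_measure (right_limit (\<lambda>x. (variation_function g x + g x) / 2)). h u) -
     (LINT u:A|interval_measure (right_limit (\<lambda>x. (variation_function g x - g x) / 2)). h u)"

definition C_psi :: "real \<Rightarrow> (real \<Rightarrow> real) \<Rightarrow> real" where
  "C_psi \<alpha> \<psi> = sqrt (- (1 / 2) *
     stieltjes_integral \<psi> {-1..1} (\<lambda>v.
       stieltjes_integral \<psi> {-1..1} (\<lambda>u. \<bar>u - v\<bar> powr \<alpha>)))"


subsection \<open>Crossings and local time\<close>

text \<open>Extended-valued, since a path may visit a level infinitely often.\<close>

definition crossings :: "(real \<Rightarrow> real) \<Rightarrow> real \<Rightarrow> real set \<Rightarrow> ennreal" where
  "crossings x a I = emeasure (count_space UNIV) {t \<in> I. x t = a}"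

definition occupation_measure :: "(real \<Rightarrow> real) \<Rightarrow> real set \<Rightarrow> real measure" where
  "occupation_measure x I = distr (restrict_space lborel I) borel x"

definition local_time :: "(real \<Rightarrow> real) \<Rightarrow> real set \<Rightarrow> real \<Rightarrow> ennreal" where
  "local_time x I = RN_deriv lborel (occupation_measure x I)"

end

theory Submission
  imports Defs
begin

text \<open>Everything is reduced to the path of \<open>B\<^sub>H\<close>; the factor \<open>sqrt (Y \<omega>)\<close> only rescales it. The
  regularized path is continuously differentiable, so that Banach's indicatrix formula turns the
  integral of \<open>f\<close> against the number of crossings into the integral of \<open>f\<close> along the regularized
  path against the absolute value of its derivative. After multiplication by
  \<open>\<epsilon> powr (1 - \<alpha> / 2)\<close> this derivative is a stationary Gaussian process with variance \<open>(C_psi \<alpha> \<psi>)\<^sup>2\<close>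
  whose covariance at distance \<open>t\<close> decays like \<open>(t / \<epsilon>) powr (\<alpha> - 2)\<close>, so the variance of the
  integral of its absolute value over an interval is at most a power of \<open>\<epsilon>\<close>. By Borel-Cantelli
  these integrals converge almost surely along a sequence \<open>(1 / n) ^ k\<close> to \<open>sqrt (2 / pi)\<close> times
  \<open>C_psi \<alpha> \<psi>\<close> times the length, and the Hoelder continuity of the path extends this to all \<open>\<epsilon>\<close>.
  Together with the uniform convergence of the regularized path, this gives the integral of \<open>f\<close>
  along the path, which is expressed through the local time once the occupation measure is known to
  be absolutely continuous.\<close>

subsection \<open>Functions of bounded variation\<close>

text \<open>The obstacle is that neither \<open>\<psi>\<close> nor the path is differentiable.
  Integration by parts against a primitive of the path moves the derivative onto the Stieltjes
  measure of \<open>\<psi>\<close>, whose total mass is zero because \<open>\<psi>\<close> vanishes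
  on both sides of \<open>{-1..1}\<close>. Mass zero acts once in each of the two variables of the
  covariance: it removes every term that depends on a single variable, which leaves a stationary
  covariance, and it lets \<open>\<bar>\<tau> + u - v\<bar> powr \<alpha>\<close> be replaced by a
  mixed second difference, which is the origin of the exponent \<open>\<alpha> - 2\<close>. Gaussian
  laws are handled through cosine transforms instead of densities, since these survive the passage
  from Riemann sums to integrals and cover degenerate variables. The normalization divides by
  \<open>\<epsilon> powr (\<alpha> / 2)\<close>, while the path is Hoelder continuous only with
  exponents below \<open>\<alpha> / 2\<close>; neighbours on the mesh have relative distance of
  order \<open>1 / n\<close>, and this makes up for the missing part of the exponent.\<close>

lemma variation_sums_mono: "S \<subseteq> T \<Longrightarrow> variation_sums g S \<subseteq> variation_sums g T"
  unfolding variation_sums_def by blast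

lemma zero_in_variation_sums: "x \<in> S \<Longrightarrow> 0 \<in> variation_sums g S"
  unfolding variation_sums_def
  by (intro CollectI exI[of _ 0] exI[of _ "\<lambda>_. x"]) (auto simp: mono_def)

lemma variation_sums_extend:
  assumes "s \<in> variation_sums g {..x}" "x \<le> y"
  shows "\<exists>s'\<in>variation_sums g {..y}. s + \<bar>g y - g x\<bar> \<le> s'"
proof -
  from assms(1) obtain n t where t: "mono t" "range t \<subseteq> {..x}"
    and s: "s = (\<Sum>i<n. \<bar>g (t (Suc i)) - g (t i)\<bar>)"
    unfolding variation_sums_def by blast
  \<comment> \<open>Only the first \<open>n\<close> steps of \<open>t\<close> are summed, so the
    chain may be redirected after \<open>t n\<close>; the inserted step from \<open>t n\<close> to
    \<open>x\<close> contributes a nonnegative term.\<close>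
  define t' where "t' i = (if i \<le> n then t i else if i = Suc n then x else y)" for i
  have "mono t'"
    unfolding mono_def t'_def using t assms(2) by (auto simp: mono_def image_subset_iff intro: order_trans)
  moreover have "range t' \<subseteq> {..y}"
    using t(2) assms(2) by (auto simp: t'_def image_subset_iff intro: order_trans)
  ultimately have "(\<Sum>i<Suc (Suc n). \<bar>g (t' (Suc i)) - g (t' i)\<bar>) \<in> variation_sums g {..y}"
    unfolding variation_sums_def by blast
  moreover have "(\<Sum>i<n. \<bar>g (t' (Suc i)) - g (t' i)\<bar>) = s"
    unfolding s by (intro sum.cong) (auto simp: t'_def)
  then have "(\<Sum>i<Suc (Suc n). \<bar>g (t' (Suc i)) - g (t' i)\<bar>) = s + \<bar>g x - g (t n)\<bar> + \<bar>g y - g x\<bar>"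
    by (simp add: t'_def)
  ultimately show ?thesis
    by (intro bexI) auto
qed

lemma bounded_variation_on_subset:
  "bounded_variation_on g T \<Longrightarrow> S \<subseteq> T \<Longrightarrow> bounded_variation_on g S"
  unfolding bounded_variation_on_def by (meson bdd_above_mono variation_sums_mono)

text \<open>With the absolute value on the left, this one inequality makes both the sum and the
  difference of the variation function and \<open>g\<close> nondecreasing.\<close>

lemma variation_function_diff:
  assumes "bounded_variation_on g UNIV" "x \<le> y"
  shows "variation_function g x + \<bar>g y - g x\<bar> \<le> variation_function g y"
proof -
  have bdd: "bdd_above (variation_sums g {..y})"
    using bounded_variation_on_subset[OF assms(1)] by (simp add: bounded_variation_on_def)
  have "variation_function g x \<le> variation_function g y - \<bar>g y - g x\<bar>"
    unfolding variation_function_def[of g x]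
  proof (rule cSup_least)
    show "variation_sums g {..x} \<noteq> {}"
      using zero_in_variation_sums[of x "{..x}" g] by auto
    fix s assume "s \<in> variation_sums g {..x}"
    from variation_sums_extend[OF this assms(2)] obtain s'
      where "s' \<in> variation_sums g {..y}" "s + \<bar>g y - g x\<bar> \<le> s'" by blast
    moreover from this have "s' \<le> variation_function g y"
      unfolding variation_function_def by (intro cSup_upper bdd)
    ultimately show "s \<le> variation_function g y - \<bar>g y - g x\<bar>" by linarith
  qed
  then show ?thesis by simp
qed

lemma variation_function_eq_0:
  assumes "\<And>t. t \<le> x \<Longrightarrow> g t = 0"
  shows "variation_function g x = 0"
proof -
  have "variation_sums g {..x} \<subseteq> {0}"
    by (auto simp: variation_sums_def assms image_subset_iff)
  with zero_in_variation_sums[of x "{..x}" g] have "variation_sums g {..x} = {0}" by auto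
  then show ?thesis by (simp add: variation_function_def)
qed

lemma variation_function_eq_right:
  assumes "\<And>t. c < t \<Longrightarrow> g t = 0" "c < x" "x \<le> y"
  shows "variation_function g y = variation_function g x"
proof -
  have "variation_sums g {..y} \<subseteq> variation_sums g {..x}"
  proof
    fix s assume "s \<in> variation_sums g {..y}"
    then obtain n t where t: "mono t" and s: "s = (\<Sum>i<n. \<bar>g (t (Suc i)) - g (t i)\<bar>)"
      unfolding variation_sums_def by blast
    \<comment> \<open>Capping a chain at \<open>x\<close> changes no value of \<open>g\<close>,
      because \<open>g\<close> vanishes at \<open>x\<close> and beyond.\<close>
    define t' where "t' i = min (t i) x" for i :: nat
    have "g (t' i) = g (t i)" for i
      using assms(1)[of "t i"] assms(1)[of x] assms(2) by (auto simp: t'_def min_def)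
    then have "s = (\<Sum>i<n. \<bar>g (t' (Suc i)) - g (t' i)\<bar>)" by (simp add: s)
    moreover have "mono t'" "range t' \<subseteq> {..x}"
      using t by (auto simp: t'_def mono_def min_le_iff_disj)
    ultimately show "s \<in> variation_sums g {..x}"
      unfolding variation_sums_def by blast
  qed
  moreover have "variation_sums g {..x} \<subseteq> variation_sums g {..y}"
    using assms(3) by (intro variation_sums_mono) auto
  ultimately show ?thesis by (simp add: variation_function_def)
qed

subsection \<open>The Stieltjes measures\<close>

lemma right_limit_mono:
  fixes F :: "real \<Rightarrow> real"
  assumes "mono F"
  shows "(F \<longlongrightarrow> right_limit F x) (at_right x)" "right_limit F x = Inf (F ` {x<..})"
proof -
  have "(F \<longlongrightarrow> Inf (F ` ({x<..} \<inter> UNIV))) (at x within ({x<..} \<inter> UNIV))"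
    using assms by (intro Lim_right_bound[where K = "F x"]) (auto simp: mono_def)
  then have *: "(F \<longlongrightarrow> Inf (F ` {x<..})) (at_right x)" by simp
  then show eq: "right_limit F x = Inf (F ` {x<..})"
    unfolding right_limit_def by (intro tendsto_Lim) auto
  show "(F \<longlongrightarrow> right_limit F x) (at_right x)"
    using * by (simp add: eq)
qed

lemma right_limit_bounds:
  fixes F :: "real \<Rightarrow> real"
  assumes "mono F"
  shows "F x \<le> right_limit F x" "x < y \<Longrightarrow> right_limit F x \<le> F y"
proof -
  show "F x \<le> right_limit F x"
    unfolding right_limit_mono(2)[OF assms] using assms
    by (intro cINF_greatest) (auto simp: mono_def)
  have "bdd_below (F ` {x<..})"
    using assms by (intro bdd_belowI2[of _ "F x"]) (auto simp: mono_def)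
  then show "x < y \<Longrightarrow> right_limit F x \<le> F y"
    unfolding right_limit_mono(2)[OF assms] by (intro cINF_lower) auto
qed

lemma mono_right_limit: "mono (F :: real \<Rightarrow> real) \<Longrightarrow> mono (right_limit F)"
  by (rule monoI) (metis order_le_less order_trans right_limit_bounds)

lemma continuous_right_limit:
  fixes F :: "real \<Rightarrow> real"
  assumes "mono F"
  shows "continuous (at_right a) (right_limit F)"
  unfolding continuous_within
proof (rule order_tendstoI)
  fix c assume "c < right_limit F a"
  then show "\<forall>\<^sub>F x in at_right a. c < right_limit F x"
    using mono_right_limit[OF assms] eventually_at_right_less[of a]
    by (elim eventually_mono) (meson less_imp_le monoD order_less_le_trans)
next
  fix c assume "right_limit F a < c"
  with right_limit_mono(1)[OF assms, of a] have "\<forall>\<^sub>F x in at_right a. F x < c"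
    by (rule order_tendstoD)
  then obtain b where b: "a < b" "\<And>x. a < x \<Longrightarrow> x < b \<Longrightarrow> F x < c"
    by (auto simp: eventually_at_right_field)
  have "\<forall>\<^sub>F x in at_right a. x \<in> {a<..<(a + b) / 2}"
    using b by (intro eventually_at_right_real) auto
  then show "\<forall>\<^sub>F x in at_right a. right_limit F x < c"
  proof eventually_elim
    case (elim x)
    have "right_limit F x \<le> F ((a + b) / 2)"
      using elim by (intro right_limit_bounds assms) auto
    also have "\<dots> < c" using b(1) by (intro b(2)) auto
    finally show ?case .
  qed
qed

lemma AE_right_limit_eq:
  fixes F :: "real \<Rightarrow> real"
  assumes "mono F"
  shows "AE x in lborel. right_limit F x = F x"
proof -
  have "right_limit F x = F x" if "isCont F x" for x
  proof -
    have "(F \<longlongrightarrow> F x) (at_right x)"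
      using that by (metis continuous_within filterlim_at_within_not_equal filterlim_at_split isCont_def)
    then show ?thesis
      using right_limit_mono(1)[OF assms, of x] tendsto_unique trivial_limit_at_right_real by blast
  qed
  then have "{x. \<not> right_limit F x = F x} \<subseteq> {x. \<not> isCont F x}" by auto
  then show ?thesis
    using countable_imp_null_set_lborel[OF mono_ctble_discont[OF assms]]
    by (intro AE_I') auto
qed

text \<open>Applied to both monotone parts of \<open>\<psi>\<close> with the same final value
  \<open>m\<close>; this is how the two Stieltjes measures acquire equal mass.\<close>

lemma interval_measure_right_limit:
  fixes F :: "real \<Rightarrow> real"
  assumes F: "mono F" "\<forall>x. x < -1 \<longrightarrow> F x = 0" "\<forall>x. 1 < x \<longrightarrow> F x = m"
  defines "P \<equiv> interval_measure (right_limit F)"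
  shows "finite_measure P" "AE u in P. u \<in> {-1..1}" "measure P UNIV = m"
    "measure P {..x} = right_limit F x"
proof -
  let ?R = "right_limit F"
  have R0: "?R x = 0" if "x < -1" for x
    using right_limit_bounds[OF F(1), of x] right_limit_bounds(2)[OF F(1), of x "(x - 1) / 2"] F(2) that
    by (simp add: field_simps)
  \<comment> \<open>The right limit at \<open>1\<close> sees only points beyond \<open>1\<close>, so
    the final value is reached at \<open>1\<close> itself and a jump there becomes an atom inside
    \<open>{-1..1}\<close>.\<close>
  have R1: "?R x = m" if "1 \<le> x" for x
  proof -
    have "F ` {x<..} = {m}" using F(3) that by (auto simp: image_iff intro: gt_ex)
    then show ?thesis using right_limit_mono(2)[OF F(1)] by simp
  qed
  have mono: "?R x \<le> ?R y" if "x \<le> y" for x y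
    using mono_right_limit[OF F(1)] that by (auto simp: mono_def)
  have bot: "(?R \<longlongrightarrow> 0) at_bot"
    by (rule tendsto_eventually) (auto simp: eventually_at_bot_linorder intro!: exI[of _ "-2"] R0)
  have top: "(?R \<longlongrightarrow> m) at_top"
    by (rule tendsto_eventually) (auto simp: eventually_at_top_linorder intro!: exI[of _ "1"] R1)
  have m: "0 \<le> m" using mono[of "-2" 1] R0[of "-2"] R1[of 1] by simp
  note * = mono continuous_right_limit[OF F(1)] bot
  interpret finite_borel_measure P
    unfolding P_def by (rule finite_borel_measure_interval_measure[OF * top m])
  show "finite_measure P" by (fact finite_measure_axioms)
  show PU: "measure P UNIV = m"
    using interval_measure_UNIV[OF * top m] m by (simp add: P_def measure_def)
  show Pi: "measure P {..x} = right_limit F x" for x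
    unfolding P_def by (rule measure_interval_measure_Iic[OF *])
  have sP: "sets P = sets borel" "space P = UNIV" by (auto simp: P_def)
  have "measure P {1<..} = measure P (UNIV - {..1})"
    by (rule arg_cong[where f = "measure P"]) auto
  also have "\<dots> = 0"
    using finite_measure_compl[of "{..1}"] PU Pi[of 1] R1[of 1] by (simp add: sP)
  finally have "{1<..} \<in> null_sets P" by (auto simp: null_sets_def emeasure_eq_measure sP)
  moreover have "{..<-1} \<in> null_sets P"
  proof -
    \<comment> \<open>The distribution function controls closed half-lines, so the open one is
      exhausted by them; an atom at \<open>-1\<close> is left out.\<close>
    have "{..<-1} = (\<Union>n::nat. {..-1 - 1 / real (Suc n)})"
    proof (intro equalityI subsetI)
      fix x :: real assume "x \<in> {..<-1}"
      then obtain n where "inverse (real (Suc n)) < -1 - x"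
        using reals_Archimedean[of "-1 - x"] by auto
      then show "x \<in> (\<Union>n::nat. {..-1 - 1 / real (Suc n)})"
        by (auto simp: inverse_eq_divide intro!: exI[of _ n])
    next
      fix x :: real assume "x \<in> (\<Union>n::nat. {..-1 - 1 / real (Suc n)})"
      then obtain n where "x \<le> -1 - 1 / real (Suc n)" by auto
      moreover have "0 < 1 / real (Suc n)" by simp
      ultimately show "x \<in> {..<-1}" unfolding lessThan_iff by linarith
    qed
    moreover have "{..-1 - 1 / real (Suc n)} \<in> null_sets P" for n
      using R0[of "-1 - 1 / real (Suc n)"] Pi[of "-1 - 1 / real (Suc n)"]
      by (auto simp: null_sets_def emeasure_eq_measure sP)
    ultimately show ?thesis by (metis (no_types) null_sets_UN)
  qed
  ultimately have "AE u in P. u \<notin> {1<..} \<and> u \<notin> {..<-1}"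
    by (intro AE_conjI AE_not_in)
  then show "AE u in P. u \<in> {-1..1}" by eventually_elim auto
qed

text \<open>The signed measure of \<open>\<psi>\<close> is \<open>P - N\<close>. Equal masses
  express that \<open>\<psi>\<close> is zero on both sides of its support, and they make constants
  integrate to zero.\<close>

locale stieltjes_pair =
  P: finite_measure P + N: finite_measure N for P N :: "real measure" +
  assumes sets_P [simp, measurable_cong]: "sets P = sets borel"
    and sets_N [simp, measurable_cong]: "sets N = sets borel"
    and AE_P: "AE u in P. u \<in> {-1..1}" and AE_N: "AE u in N. u \<in> {-1..1}"
    and equal_mass: "measure P UNIV = measure N UNIV"

text \<open>The representation of \<open>\<psi>\<close> by distribution functions holds only almost
  everywhere, since \<open>\<psi>\<close> may take any value at its countably many jumps. It is
  applied under Lebesgue integrals only.\<close>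

lemma bounded_variation_stieltjes_pair:
  assumes bv: "bounded_variation_on \<psi> UNIV" and supp: "\<forall>t. t \<notin> {-1..1} \<longrightarrow> \<psi> t = 0"
  obtains P N where "stieltjes_pair P N"
    "AE u in lborel. \<psi> u = measure P {..u} - measure N {..u}"
    "\<And>h. h \<in> borel_measurable borel \<Longrightarrow>
       stieltjes_integral \<psi> {-1..1} h = (\<integral>u. h u \<partial>P) - (\<integral>u. h u \<partial>N)"
    "\<psi> \<in> borel_measurable borel"
proof -
  define V where "V = variation_function \<psi>"
  define F where "F x = (V x + \<psi> x) / 2" for x
  define G where "G x = (V x - \<psi> x) / 2" for x
  have diff: "V x + \<bar>\<psi> y - \<psi> x\<bar> \<le> V y" if "x \<le> y" for x y
    unfolding V_def by (rule variation_function_diff[OF bv that])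
  have mono: "mono F" "mono G"
  proof -
    have "F x \<le> F y \<and> G x \<le> G y" if "x \<le> y" for x y
      using diff[OF that] abs_ge_self[of "\<psi> y - \<psi> x"] abs_ge_minus_self[of "\<psi> y - \<psi> x"]
      by (simp add: F_def G_def)
    then show "mono F" "mono G" by (auto intro: monoI)
  qed
  have V0: "V x = 0" if "x < -1" for x
    unfolding V_def using that supp by (intro variation_function_eq_0) auto
  \<comment> \<open>The variation function may still jump at \<open>1\<close>, so its final value is
    read off at a point beyond, here \<open>2\<close>.\<close>
  have V1: "V x = V 2" if "1 < x" for x
  proof -
    have s: "\<And>t. 1 < t \<Longrightarrow> \<psi> t = 0" using supp by auto
    show ?thesis
      using variation_function_eq_right[of 1 \<psi> x 2, OF s]
        variation_function_eq_right[of 1 \<psi> 2 x, OF s] that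
      unfolding V_def by (cases "x \<le> 2") linarith+
  qed
  have psi0: "\<psi> x = 0" if "x < -1 \<or> 1 < x" for x using supp that by auto
  have F: "\<forall>x. x < -1 \<longrightarrow> F x = 0" "\<forall>x. 1 < x \<longrightarrow> F x = V 2 / 2"
    and G: "\<forall>x. x < -1 \<longrightarrow> G x = 0" "\<forall>x. 1 < x \<longrightarrow> G x = V 2 / 2"
    unfolding F_def G_def using V0 psi0 by (auto dest!: V1)
  let ?P = "interval_measure (right_limit F)"
  let ?N = "interval_measure (right_limit G)"
  note PF = interval_measure_right_limit[OF mono(1) F] and NG = interval_measure_right_limit[OF mono(2) G]
  have pair: "stieltjes_pair ?P ?N"
    using PF(1-3) NG(1-3) by (simp add: stieltjes_pair_def stieltjes_pair_axioms_def)
  show ?thesis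
  proof (rule that[OF pair])
    have "AE u in lborel. right_limit F u = F u \<and> right_limit G u = G u"
      using AE_right_limit_eq mono by (intro AE_conjI)
    then show "AE u in lborel. \<psi> u = measure ?P {..u} - measure ?N {..u}"
    proof eventually_elim
      case (elim u)
      moreover have "\<psi> u = F u - G u" by (simp add: F_def G_def field_simps)
      ultimately show ?case by (simp add: PF(4) NG(4))
    qed
  next
    fix h :: "real \<Rightarrow> real" assume [measurable]: "h \<in> borel_measurable borel"
    have "(LINT u:{-1..1}|?P. h u) = (\<integral>u. h u \<partial>?P)"
      unfolding set_lebesgue_integral_def
      by (intro integral_cong_AE) (measurable, use PF(2) in eventually_elim, simp add: indicator_def)
    moreover have "(LINT u:{-1..1}|?N. h u) = (\<integral>u. h u \<partial>?N)"
      unfolding set_lebesgue_integral_def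
      by (intro integral_cong_AE) (measurable, use NG(2) in eventually_elim, simp add: indicator_def)
    ultimately show "stieltjes_integral \<psi> {-1..1} h = (\<integral>u. h u \<partial>?P) - (\<integral>u. h u \<partial>?N)"
      unfolding stieltjes_integral_def F_def[abs_def] G_def[abs_def] V_def by simp
  next
    have "\<psi> = (\<lambda>x. F x - G x)" by (auto simp: F_def G_def field_simps)
    then show "\<psi> \<in> borel_measurable borel"
      using borel_measurable_mono[OF mono(1)] borel_measurable_mono[OF mono(2)] by simp
  qed
qed

subsection \<open>Integration against a signed measure of total mass zero\<close>

lemma floor_div_le: "0 < c \<Longrightarrow> real_of_int \<lfloor>c * u\<rfloor> / c \<le> u"
  and floor_div_ge: "0 < c \<Longrightarrow> u - 1 / c \<le> real_of_int \<lfloor>c * u\<rfloor> / c"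
proof -
  assume c: "0 < c"
  have "real_of_int \<lfloor>c * u\<rfloor> \<le> u * c" using of_int_floor_le[of "c * u"] by (simp add: mult.commute)
  then show "real_of_int \<lfloor>c * u\<rfloor> / c \<le> u" using c by (simp add: pos_divide_le_eq)
  have "(u - 1 / c) * c \<le> real_of_int \<lfloor>c * u\<rfloor>"
    using c real_of_int_floor_gt_diff_one[of "c * u"] by (simp add: algebra_simps)
  then show "u - 1 / c \<le> real_of_int \<lfloor>c * u\<rfloor> / c" using c by (simp add: pos_le_divide_eq)
qed

lemma floor_div_tendsto: "(\<lambda>n. real_of_int \<lfloor>real (Suc n) * u\<rfloor> / real (Suc n)) \<longlonglongrightarrow> u"
proof (rule tendsto_sandwich)
  show "\<forall>\<^sub>F n in sequentially. u - 1 / real (Suc n) \<le> real_of_int \<lfloor>real (Suc n) * u\<rfloor> / real (Suc n)"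
    by (intro always_eventually allI floor_div_ge) simp
  show "\<forall>\<^sub>F n in sequentially. real_of_int \<lfloor>real (Suc n) * u\<rfloor> / real (Suc n) \<le> u"
    by (intro always_eventually allI floor_div_le) simp
  have "(\<lambda>n. u - 1 / real (Suc n)) \<longlonglongrightarrow> u - 0"
    by (intro tendsto_diff tendsto_const LIMSEQ_Suc[OF lim_1_over_n])
  then show "(\<lambda>n. u - 1 / real (Suc n)) \<longlonglongrightarrow> u" by simp
qed (rule tendsto_const)

text \<open>The left endpoint \<open>-1\<close> is itself a grid point, so rounding down does not
  leave the interval.\<close>

lemma floor_div_bounds:
  assumes "u \<in> {-1..1}" shows "real_of_int \<lfloor>real (Suc n) * u\<rfloor> / real (Suc n) \<in> {-1..1}"
proof -
  have "real (Suc n) * -1 \<le> real (Suc n) * u"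
    using assms by (intro mult_left_mono) auto
  then have "of_int (- int (Suc n)) \<le> real (Suc n) * u" by simp
  then have "- int (Suc n) \<le> \<lfloor>real (Suc n) * u\<rfloor>" by (simp only: le_floor_iff)
  then have "real_of_int (- int (Suc n)) \<le> real_of_int \<lfloor>real (Suc n) * u\<rfloor>" by (simp only: of_int_le_iff)
  then have "-1 \<le> real_of_int \<lfloor>real (Suc n) * u\<rfloor> / real (Suc n)"
    by (subst pos_le_divide_eq) auto
  moreover have "real_of_int \<lfloor>real (Suc n) * u\<rfloor> / real (Suc n) \<le> u"
    by (rule floor_div_le) simp
  then have "real_of_int \<lfloor>real (Suc n) * u\<rfloor> / real (Suc n) \<le> 1"
    by (rule order_trans) (use assms in simp)
  ultimately show ?thesis by (simp only: atLeastAtMost_iff conj_commute)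
qed

context stieltjes_pair
begin

definition S :: "(real \<Rightarrow> real) \<Rightarrow> real" where
  "S h = (\<integral>u. h u \<partial>P) - (\<integral>u. h u \<partial>N)"

definition mass :: real where "mass = measure P UNIV + measure N UNIV"

text \<open>Boundedness is asked only on \<open>{-1..1}\<close>, where both measures are
  concentrated, so that continuous functions that are unbounded on the line qualify without a
  cut-off.\<close>

definition adm :: "(real \<Rightarrow> real) \<Rightarrow> bool" where
  "adm h \<longleftrightarrow> h \<in> borel_measurable borel \<and> (\<exists>K. \<forall>u\<in>{-1..1}. \<bar>h u\<bar> \<le> K)"

lemma space_P [simp]: "space P = UNIV" and space_N [simp]: "space N = UNIV"
  using sets_eq_imp_space_eq[OF sets_P] sets_eq_imp_space_eq[OF sets_N] by auto

lemma mass_nonneg [simp]: "0 \<le> mass" by (simp add: mass_def)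

lemma adm_measurable [measurable_dest]: "adm h \<Longrightarrow> h \<in> borel_measurable borel"
  by (simp add: adm_def)

lemma admI: "h \<in> borel_measurable borel \<Longrightarrow> (\<And>u. u \<in> {-1..1} \<Longrightarrow> \<bar>h u\<bar> \<le> K) \<Longrightarrow> adm h"
  unfolding adm_def by blast

lemma adm_continuous:
  assumes "continuous_on UNIV h" shows "adm h"
proof -
  have "compact (h ` {-1..1})"
    using assms by (intro compact_continuous_image continuous_on_subset[OF assms]) auto
  then obtain K where "\<forall>y\<in>h ` {-1..1}. norm y \<le> K"
    using compact_imp_bounded bounded_iff by blast
  then show ?thesis
    using borel_measurable_continuous_onI[OF assms] by (intro admI[where K = K]) auto
qed

lemma adm_integrable:
  assumes "adm h" shows "integrable P h" "integrable N h"
proof -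
  from assms obtain K where K: "\<forall>u\<in>{-1..1}. \<bar>h u\<bar> \<le> K" and [measurable]: "h \<in> borel_measurable borel"
    unfolding adm_def by blast
  show "integrable P h"
    using AE_P by (intro P.integrable_const_bound[where B = K]) (auto simp: K)
  show "integrable N h"
    using AE_N by (intro N.integrable_const_bound[where B = K]) (auto simp: K)
qed

lemma AE_PI: "(\<And>u. u \<in> {-1..1} \<Longrightarrow> Q u) \<Longrightarrow> AE u in P. Q u"
  and AE_NI: "(\<And>u. u \<in> {-1..1} \<Longrightarrow> Q u) \<Longrightarrow> AE u in N. Q u"
  using AE_P AE_N by (auto elim!: eventually_mono simp del: atLeastAtMost_iff)

lemma adm_const [simp]: "adm (\<lambda>_. c)" by (intro adm_continuous continuous_intros)

lemma adm_cmult: "adm h \<Longrightarrow> adm (\<lambda>u. c * h u)"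
proof -
  assume h: "adm h"
  then obtain K where "\<forall>u\<in>{-1..1}. \<bar>h u\<bar> \<le> K" unfolding adm_def by blast
  then show ?thesis using h
    by (intro admI[where K = "\<bar>c\<bar> * K"]) (auto simp: adm_def abs_mult intro!: mult_left_mono)
qed

lemma adm_add: "adm h \<Longrightarrow> adm g \<Longrightarrow> adm (\<lambda>u. h u + g u)"
proof -
  assume h: "adm h" and g: "adm g"
  then obtain K L where "\<forall>u\<in>{-1..1}. \<bar>h u\<bar> \<le> K" "\<forall>u\<in>{-1..1}. \<bar>g u\<bar> \<le> L"
    unfolding adm_def by blast
  then show ?thesis using h g
    by (intro admI[where K = "K + L"]) (auto simp: adm_def intro!: order_trans[OF abs_triangle_ineq] add_mono)
qed

lemma adm_diff: "adm h \<Longrightarrow> adm g \<Longrightarrow> adm (\<lambda>u. h u - g u)"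
  using adm_add[of h "\<lambda>u. (-1) * g u"] adm_cmult[of g "-1"] by simp

lemma S_const [simp]: "S (\<lambda>_. c) = 0"
  using equal_mass by (simp add: S_def)

lemma S_cmult: "S (\<lambda>u. c * h u) = c * S h"
  by (simp add: S_def right_diff_distrib)

lemma S_add: "adm h \<Longrightarrow> adm g \<Longrightarrow> S (\<lambda>u. h u + g u) = S h + S g"
  by (simp add: S_def adm_integrable)

lemma S_diff: "adm h \<Longrightarrow> adm g \<Longrightarrow> S (\<lambda>u. h u - g u) = S h - S g"
  by (simp add: S_def adm_integrable)

lemma S_sum: "(\<And>i. i \<in> A \<Longrightarrow> adm (h i)) \<Longrightarrow> S (\<lambda>u. \<Sum>i\<in>A. h i u) = (\<Sum>i\<in>A. S (h i))"
  by (simp add: S_def adm_integrable sum_subtractf)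

lemma S_cong:
  assumes "\<And>u. u \<in> {-1..1} \<Longrightarrow> h u = g u" "h \<in> borel_measurable borel" "g \<in> borel_measurable borel"
  shows "S h = S g"
proof -
  note [measurable] = assms(2,3)
  have "(\<integral>u. h u \<partial>P) = (\<integral>u. g u \<partial>P)" "(\<integral>u. h u \<partial>N) = (\<integral>u. g u \<partial>N)"
    by (auto intro!: integral_cong_AE AE_PI AE_NI simp: assms(1))
  then show ?thesis by (simp add: S_def)
qed

lemma S_bound:
  assumes "h \<in> borel_measurable borel" "\<And>u. u \<in> {-1..1} \<Longrightarrow> \<bar>h u\<bar> \<le> K"
  shows "\<bar>S h\<bar> \<le> K * mass"
proof -
  have h: "integrable P h" "integrable N h"
    using adm_integrable[OF admI[OF assms]] by auto
  have "\<bar>\<integral>u. h u \<partial>P\<bar> \<le> (\<integral>u. \<bar>h u\<bar> \<partial>P)" by (rule integral_abs_bound)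
  also have "\<dots> \<le> (\<integral>u. K \<partial>P)"
    using h by (intro integral_mono_AE AE_PI) (auto intro: assms(2))
  finally have 1: "\<bar>\<integral>u. h u \<partial>P\<bar> \<le> K * measure P UNIV" by (simp add: mult.commute)
  have "\<bar>\<integral>u. h u \<partial>N\<bar> \<le> (\<integral>u. \<bar>h u\<bar> \<partial>N)" by (rule integral_abs_bound)
  also have "\<dots> \<le> (\<integral>u. K \<partial>N)"
    using h by (intro integral_mono_AE AE_NI) (auto intro: assms(2))
  finally have 2: "\<bar>\<integral>u. h u \<partial>N\<bar> \<le> K * measure N UNIV" by (simp add: mult.commute)
  show ?thesis using 1 2 unfolding S_def mass_def by (simp add: distrib_left)
qed

lemma S_tendsto:
  assumes m: "\<And>n. h n \<in> borel_measurable borel" "g \<in> borel_measurable borel"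
    and b: "\<And>n u. u \<in> {-1..1} \<Longrightarrow> \<bar>h n u\<bar> \<le> K"
    and l: "\<And>u. u \<in> {-1..1} \<Longrightarrow> (\<lambda>n. h n u) \<longlonglongrightarrow> g u"
  shows "(\<lambda>n::nat. S (h n)) \<longlonglongrightarrow> S g"
proof -
  note [measurable] = m
  have "(\<lambda>n. \<integral>u. h n u \<partial>P) \<longlonglongrightarrow> (\<integral>u. g u \<partial>P)"
    by (intro integral_dominated_convergence[where w = "\<lambda>_. K"] AE_PI)
      (auto simp: b l)
  moreover have "(\<lambda>n. \<integral>u. h n u \<partial>N) \<longlonglongrightarrow> (\<integral>u. g u \<partial>N)"
    by (intro integral_dominated_convergence[where w = "\<lambda>_. K"] AE_NI)
      (auto simp: b l)
  ultimately show ?thesis unfolding S_def by (rule tendsto_diff)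
qed

lemma S_tendsto_at:
  fixes h :: "real \<Rightarrow> real \<Rightarrow> real"
  assumes m: "\<And>t. h t \<in> borel_measurable borel" "g \<in> borel_measurable borel"
    and b: "\<And>t u. u \<in> {-1..1} \<Longrightarrow> \<bar>t - a\<bar> \<le> 1 \<Longrightarrow> \<bar>h t u\<bar> \<le> K"
    and l: "\<And>u. u \<in> {-1..1} \<Longrightarrow> ((\<lambda>t. h t u) \<longlongrightarrow> g u) (at a)"
  shows "((\<lambda>t. S (h t)) \<longlongrightarrow> S g) (at a)"
  unfolding tendsto_at_iff_sequentially comp_def
proof (intro allI impI)
  fix X assume X: "\<forall>i. X i \<in> UNIV - {a}" "X \<longlonglongrightarrow> a"
  have "\<forall>\<^sub>F n in sequentially. dist (X n) a < 1" using X(2) by (rule tendstoD) simp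
  \<comment> \<open>The bound \<open>b\<close> is available only within distance \<open>1\<close> of
    \<open>a\<close>, so an initial segment of the sequence is dropped.\<close>
  then obtain M where M: "\<And>n. n \<ge> M \<Longrightarrow> \<bar>X n - a\<bar> \<le> 1"
    unfolding eventually_sequentially dist_real_def by (meson less_imp_le)
  have "(\<lambda>n. S (h (X (n + M)))) \<longlonglongrightarrow> S g"
  proof (rule S_tendsto[where K = K])
    fix u :: real assume "u \<in> {-1..1}"
    from l[OF this] X have "(\<lambda>n. h (X n) u) \<longlonglongrightarrow> g u"
      unfolding tendsto_at_iff_sequentially comp_def by blast
    then show "(\<lambda>n. h (X (n + M)) u) \<longlonglongrightarrow> g u" by (rule LIMSEQ_ignore_initial_segment)
  qed (use m b M in auto)
  then show "(\<lambda>n. S (h (X n))) \<longlonglongrightarrow> S g" by (rule LIMSEQ_offset)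
qed

text \<open>Rounding the argument turns the signed integral into a finite sum whose weights are the
  signed masses of the grid cells. In this way an integral along a Gaussian path becomes a limit of
  finite Gaussian sums.\<close>

lemma S_floor:
  assumes n: "0 < (n::nat)"
  shows "S (\<lambda>u. h (real_of_int \<lfloor>real n * u\<rfloor> / real n)) =
    (\<Sum>k\<in>{- int n..int n}. S (indicator {u. \<lfloor>real n * u\<rfloor> = k}) * h (real_of_int k / real n))"
proof -
  let ?I = "{- int n..int n}" and ?J = "\<lambda>k. indicator {u::real. \<lfloor>real n * u\<rfloor> = k} :: real \<Rightarrow> real"
  have [measurable]: "?J k \<in> borel_measurable borel" for k by measurable
  have J: "adm (?J k)" for k
    by (intro admI[where K = 1]) (auto simp: indicator_def)
  have [measurable]: "(\<lambda>u. h (real_of_int \<lfloor>real n * u\<rfloor> / real n)) \<in> borel_measurable borel"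
    by (rule measurable_compose_countable'[where I = UNIV and g = "\<lambda>u. \<lfloor>real n * u\<rfloor>"
        and f = "\<lambda>k u. h (real_of_int k / real n)"]) auto
  have "S (\<lambda>u. h (real_of_int \<lfloor>real n * u\<rfloor> / real n)) = S (\<lambda>u. \<Sum>k\<in>?I. h (real_of_int k / real n) * ?J k u)"
  proof (rule S_cong)
    fix u :: real assume u: "u \<in> {-1..1}"
    have "- real n \<le> real n * u" "real n * u \<le> real n"
      using mult_left_mono[of "-1" u "real n"] mult_left_mono[of u 1 "real n"] u by auto
    then have "\<lfloor>real n * u\<rfloor> \<in> ?I" by (simp add: le_floor_iff floor_le_iff)
    then show "h (real_of_int \<lfloor>real n * u\<rfloor> / real n) = (\<Sum>k\<in>?I. h (real_of_int k / real n) * ?J k u)"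
      by (subst sum.remove[of _ "\<lfloor>real n * u\<rfloor>"]) (auto simp: indicator_def intro!: sum.neutral)
  qed measurable
  also have "\<dots> = (\<Sum>k\<in>?I. S (?J k) * h (real_of_int k / real n))"
    by (subst S_sum) (intro adm_cmult J, simp only: S_cmult mult.commute)
  finally show ?thesis .
qed

definition wt :: "nat \<Rightarrow> int \<Rightarrow> real" where
  "wt n k = S (indicator {u. \<lfloor>real (Suc n) * u\<rfloor> = k})"

definition pt :: "nat \<Rightarrow> int \<Rightarrow> real" where "pt n k = real_of_int k / real (Suc n)"

abbreviation idx :: "nat \<Rightarrow> int set" where "idx n \<equiv> {- int (Suc n)..int (Suc n)}"

text \<open>Nothing is assumed of \<open>h\<close>: the rounded argument takes countably many
  values.\<close>

lemma floor_measurable: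
  "(\<lambda>u. h (real_of_int \<lfloor>real (Suc n) * u\<rfloor> / real (Suc n))) \<in> borel_measurable borel"
  by (rule measurable_compose_countable'[where I = UNIV and g = "\<lambda>u. \<lfloor>real (Suc n) * u\<rfloor>"
        and f = "\<lambda>k u. h (real_of_int k / real (Suc n))"]) auto

lemma riemann_tendsto:
  assumes h: "continuous_on UNIV h"
  shows "(\<lambda>n. \<Sum>k\<in>idx n. wt n k * h (pt n k)) \<longlonglongrightarrow> S h"
proof -
  from adm_continuous[OF h] obtain K where K: "\<forall>u\<in>{-1..1}. \<bar>h u\<bar> \<le> K" unfolding adm_def by blast
  have "(\<lambda>n. S (\<lambda>u. h (real_of_int \<lfloor>real (Suc n) * u\<rfloor> / real (Suc n)))) \<longlonglongrightarrow> S h"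
  proof (rule S_tendsto[where K = K])
    show "(\<lambda>n. h (real_of_int \<lfloor>real (Suc n) * u\<rfloor> / real (Suc n))) \<longlonglongrightarrow> h u" for u
      using h floor_div_tendsto by (rule continuous_on_tendsto_compose) auto
  qed (use K floor_div_bounds floor_measurable adm_continuous[OF h] in \<open>auto simp: adm_def simp del: of_nat_Suc\<close>)
  then show ?thesis by (simp only: S_floor[OF zero_less_Suc] wt_def pt_def)
qed

text \<open>The weights and nodes are those of \<open>riemann_tendsto\<close>, refined in both
  variables at once. Thus the variances of the Riemann sums of a Gaussian path converge to the
  variance computed from its covariance kernel.\<close>

lemma riemann_tendsto2:
  assumes R: "continuous_on UNIV (\<lambda>(u, v). R u v)"
  shows "(\<lambda>n. \<Sum>j\<in>idx n. \<Sum>k\<in>idx n. wt n j * wt n k * R (pt n j) (pt n k)) \<longlonglongrightarrow> S (\<lambda>u. S (\<lambda>v. R u v))"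
    and "continuous_on UNIV (\<lambda>u. S (\<lambda>v. R u v))"
proof -
  let ?f = "\<lambda>n u. real_of_int \<lfloor>real (Suc n) * u\<rfloor> / real (Suc n)"
  have "compact ((\<lambda>(u, v). R u v) ` ({-1..1} \<times> {-1..1}))"
    by (intro compact_continuous_image continuous_on_subset[OF R] compact_Times) auto
  then obtain K where "\<forall>y\<in>(\<lambda>(u, v). R u v) ` ({-1..1} \<times> {-1..1}). norm y \<le> K"
    using compact_imp_bounded bounded_iff by blast
  then have K: "\<bar>R u v\<bar> \<le> K" if "u \<in> {-1..1}" "v \<in> {-1..1}" for u v
    using that by force
  have cR: "continuous_on UNIV (R u)" for u
    by (rule continuous_on_compose2[OF R, of UNIV "\<lambda>v. (u, v)", simplified]) (intro continuous_intros)
  have limR: "(\<lambda>n. R (x n) (y n)) \<longlonglongrightarrow> R u v" if "x \<longlonglongrightarrow> u" "y \<longlonglongrightarrow> v" for x y u v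
    using continuous_on_tendsto_compose[OF R tendsto_Pair[OF that]] by simp
  have in_lim: "(\<lambda>n. S (\<lambda>v. R (?f n u) (?f n v))) \<longlonglongrightarrow> S (R u)" if "u \<in> {-1..1}" for u
  proof (rule S_tendsto[where K = K])
    show "R u \<in> borel_measurable borel" using adm_continuous[OF cR] by (simp add: adm_def)
  qed (use that in \<open>auto intro!: limR floor_div_tendsto floor_measurable K floor_div_bounds simp del: of_nat_Suc atLeastAtMost_iff\<close>)
  have cont: "continuous_on UNIV (\<lambda>u. S (R u))"
    unfolding continuous_on_def
  proof (intro ballI)
    fix a :: real
    have "compact ((\<lambda>(u, v). R u v) ` ({a-1..a+1} \<times> {-1..1}))"
      by (intro compact_continuous_image continuous_on_subset[OF R] compact_Times) auto
    then obtain K where "\<forall>y\<in>(\<lambda>(u, v). R u v) ` ({a-1..a+1} \<times> {-1..1}). norm y \<le> K"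
      using compact_imp_bounded bounded_iff by blast
    then have K': "\<bar>R u v\<bar> \<le> K" if "\<bar>u - a\<bar> \<le> 1" "v \<in> {-1..1}" for u v
      using that by (force simp: abs_le_iff)
    show "((\<lambda>u. S (R u)) \<longlongrightarrow> S (R a)) (at a within UNIV)"
    proof (rule S_tendsto_at[where K = K])
      show "((\<lambda>t. R t u) \<longlongrightarrow> R a u) (at a)" for u
        unfolding tendsto_at_iff_sequentially comp_def by (auto intro!: limR)
    qed (use adm_continuous[OF cR] K' in \<open>auto simp: adm_def\<close>)
  qed
  then show "continuous_on UNIV (\<lambda>u. S (\<lambda>v. R u v))" by simp
  have mR: "R u \<in> borel_measurable borel" for u using adm_continuous[OF cR] by (simp add: adm_def)
  have "(\<lambda>n. S (\<lambda>u. S (\<lambda>v. R (?f n u) (?f n v)))) \<longlonglongrightarrow> S (\<lambda>u. S (R u))"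
  proof (rule S_tendsto[where K = "K * mass"])
    show "(\<lambda>u. S (R u)) \<in> borel_measurable borel"
      using adm_continuous[OF cont] by (simp add: adm_def)
    show "(\<lambda>u. S (\<lambda>v. R (?f n u) (?f n v))) \<in> borel_measurable borel" for n
      by (rule floor_measurable[where h = "\<lambda>u. S (\<lambda>v. R u (?f n v))"])
    show "\<bar>S (\<lambda>v. R (?f n u) (?f n v))\<bar> \<le> K * mass" if "u \<in> {-1..1}" for u n
      using that by (intro S_bound floor_measurable K floor_div_bounds)
  qed (rule in_lim)
  moreover have "S (\<lambda>u. S (\<lambda>v. R (?f n u) (?f n v))) = (\<Sum>j\<in>idx n. \<Sum>k\<in>idx n. wt n j * wt n k * R (pt n j) (pt n k))" for n
    using S_floor[of "Suc n" "\<lambda>u. S (\<lambda>v. R u (?f n v))", OF zero_less_Suc]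
    unfolding S_floor[OF zero_less_Suc] wt_def pt_def by (simp add: sum_distrib_left mult.assoc del: of_nat_Suc)
  ultimately show "(\<lambda>n. \<Sum>j\<in>idx n. \<Sum>k\<in>idx n. wt n j * wt n k * R (pt n j) (pt n k)) \<longlonglongrightarrow> S (\<lambda>u. S (\<lambda>v. R u v))"
    by simp
qed

end

subsection \<open>Derivative of the regularized path\<close>

text \<open>Integration by parts in the form of Fubini: the distribution function is the integral of
  the indicator of \<open>v \<le> u\<close>, and after the exchange the integral in \<open>u\<close>
  is evaluated with the primitive \<open>\<Phi>\<close>.\<close>

lemma integral_cdf_convolution:
  fixes Q :: "real measure" and x \<Phi> :: "real \<Rightarrow> real"
  assumes "finite_measure Q" and sQ [measurable_cong]: "sets Q = sets borel"
    and AQ: "AE v in Q. v \<in> {-1..1}"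
    and x: "continuous_on UNIV x" and \<Phi>: "\<And>r. (\<Phi> has_real_derivative x r) (at r)" and \<epsilon>: "0 < \<epsilon>"
  shows "integrable lborel (\<lambda>u. indicator {-1..1} u * measure Q {..u} * x (t - \<epsilon> * u))"
    and "(\<integral>u. indicator {-1..1} u * measure Q {..u} * x (t - \<epsilon> * u) \<partial>lborel) =
      (\<integral>v. (\<Phi> (t - \<epsilon> * v) - \<Phi> (t - \<epsilon>)) / \<epsilon> \<partial>Q)"
proof -
  interpret Q: finite_measure Q by fact
  interpret pair_sigma_finite lborel Q ..
  have spQ: "space Q = UNIV" using sets_eq_imp_space_eq[OF sQ] by simp
  have [measurable]: "x \<in> borel_measurable borel"
    using borel_measurable_continuous_onI[OF x] .
  define f where "f u v = indicator {-1..1} u * (if v \<le> u then 1 else 0) * x (t - \<epsilon> * u)" for u v :: real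
  have cx: "continuous_on UNIV (\<lambda>u. x (t - \<epsilon> * u))"
    by (rule continuous_on_compose2[OF x]) (auto intro!: continuous_intros)
  have "compact ((\<lambda>u. x (t - \<epsilon> * u)) ` {-1..1})"
    by (intro compact_continuous_image continuous_on_subset[OF cx]) auto
  then obtain K where "\<forall>y\<in>(\<lambda>u. x (t - \<epsilon> * u)) ` {-1..1}. norm y \<le> K"
    using compact_imp_bounded bounded_iff by blast
  then have K: "\<bar>x (t - \<epsilon> * u)\<bar> \<le> K" if "u \<in> {-1..1}" for u using that by auto
  then have K0: "0 \<le> K" using K[of 0] by auto
  have "integrable (lborel \<Otimes>\<^sub>M Q) (\<lambda>(u, v). f u v)"
  proof (rule integrableI_bounded_set[where A = "{-1..1} \<times> UNIV" and B = K])
    show "{-1..1::real} \<times> (UNIV :: real set) \<in> sets (lborel \<Otimes>\<^sub>M Q)"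
      by (intro pair_measureI) (auto simp: sQ)
    show "(\<lambda>(u, v). f u v) \<in> borel_measurable (lborel \<Otimes>\<^sub>M Q)"
      unfolding f_def by measurable
    show "emeasure (lborel \<Otimes>\<^sub>M Q) ({-1..1::real} \<times> (UNIV :: real set)) < \<infinity>"
      using Q.emeasure_finite[of UNIV]
      by (subst Q.emeasure_pair_measure_Times) (auto simp: sQ less_top[symmetric] ennreal_mult_eq_top_iff)
    show "AE z in lborel \<Otimes>\<^sub>M Q. z \<in> {-1..1} \<times> UNIV \<longrightarrow> norm (case z of (u, v) \<Rightarrow> f u v) \<le> K"
      by (intro AE_I2) (auto simp: f_def abs_mult K K0)
    show "AE z in lborel \<Otimes>\<^sub>M Q. z \<notin> {-1..1} \<times> UNIV \<longrightarrow> (case z of (u, v) \<Rightarrow> f u v) = 0"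
      by (intro AE_I2) (auto simp: f_def indicator_def)
  qed
  note int = this
  have 1: "(\<integral>v. f u v \<partial>Q) = indicator {-1..1} u * measure Q {..u} * x (t - \<epsilon> * u)" for u
  proof -
    have "(\<integral>v. f u v \<partial>Q) = (\<integral>v. (indicator {-1..1} u * x (t - \<epsilon> * u)) * indicator {..u} v \<partial>Q)"
      by (intro Bochner_Integration.integral_cong) (auto simp: f_def indicator_def)
    then show ?thesis by (simp add: spQ sQ)
  qed
  \<comment> \<open>For \<open>v\<close> in the support the indicators cut the range of
    \<open>u\<close> down to \<open>{v..1}\<close>; the upper end \<open>1\<close> produces the term
    at \<open>t - \<epsilon>\<close>.\<close>
  have 2: "(\<integral>u. f u v \<partial>lborel) = (\<Phi> (t - \<epsilon> * v) - \<Phi> (t - \<epsilon>)) / \<epsilon>" if v: "v \<in> {-1..1}" for v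
  proof -
    have "(\<integral>u. f u v \<partial>lborel) = (\<integral>u. indicator {v..1} u *\<^sub>R x (t - \<epsilon> * u) \<partial>lborel)"
      using v by (intro Bochner_Integration.integral_cong) (auto simp: f_def indicator_def)
    also have "\<dots> = - \<Phi> (t - \<epsilon> * 1) / \<epsilon> - - \<Phi> (t - \<epsilon> * v) / \<epsilon>"
    proof (rule integral_FTC_atLeastAtMost)
      show "((\<lambda>u. - \<Phi> (t - \<epsilon> * u) / \<epsilon>) has_vector_derivative x (t - \<epsilon> * u)) (at u within {v..1})" for u
        unfolding has_real_derivative_iff_has_vector_derivative[symmetric]
        using \<epsilon> by (auto intro!: derivative_eq_intros DERIV_chain2[OF \<Phi>])
    qed (use v cx continuous_on_subset in auto)
    also have "\<dots> = (\<Phi> (t - \<epsilon> * v) - \<Phi> (t - \<epsilon>)) / \<epsilon>"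
      by (simp add: diff_divide_distrib)
    finally show ?thesis .
  qed
  show "integrable lborel (\<lambda>u. indicator {-1..1} u * measure Q {..u} * x (t - \<epsilon> * u))"
    using integrable_fst'[OF int] by (simp add: 1)
  have \<Phi>c: "continuous_on UNIV \<Phi>"
    using \<Phi> by (meson DERIV_isCont continuous_at_imp_continuous_on)
  have [measurable]: "\<Phi> \<in> borel_measurable borel"
    using borel_measurable_continuous_onI[OF \<Phi>c] .
  have fm: "(\<lambda>v. \<integral>u. f u v \<partial>lborel) \<in> borel_measurable Q"
    unfolding f_def by measurable
  have "(\<integral>u. (\<integral>v. f u v \<partial>Q) \<partial>lborel) = (\<integral>v. (\<integral>u. f u v \<partial>lborel) \<partial>Q)"
    using Fubini_integral[OF int] by simp
  also have "\<dots> = (\<integral>v. (\<Phi> (t - \<epsilon> * v) - \<Phi> (t - \<epsilon>)) / \<epsilon> \<partial>Q)"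
    using AQ by (intro integral_cong_AE fm) (measurable, auto elim!: eventually_mono simp: 2 simp del: atLeastAtMost_iff)
  finally show "(\<integral>u. indicator {-1..1} u * measure Q {..u} * x (t - \<epsilon> * u) \<partial>lborel) =
      (\<integral>v. (\<Phi> (t - \<epsilon> * v) - \<Phi> (t - \<epsilon>)) / \<epsilon> \<partial>Q)"
    by (simp add: 1)
qed

definition zero_ext :: "(real \<Rightarrow> real) \<Rightarrow> real \<Rightarrow> real" where
  "zero_ext x s = (if 0 \<le> s then x s else 0)"

lemma regularized_path_eq:
  assumes "0 < \<epsilon>"
  shows "regularized_path \<psi> \<epsilon> x t = (\<integral>u. \<psi> u * zero_ext x (t - \<epsilon> * u) \<partial>lborel)"
proof -
  have "regularized_path \<psi> \<epsilon> x t = (\<integral>s. \<psi> ((t - s) / \<epsilon>) / \<epsilon> * zero_ext x s \<partial>lborel)"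
    unfolding regularized_path_def set_lebesgue_integral_def rescaled_def
    by (intro Bochner_Integration.integral_cong) (auto simp: zero_ext_def)
  also have "\<dots> = \<bar>- \<epsilon>\<bar> *\<^sub>R (\<integral>u. \<psi> ((t - (t + - \<epsilon> * u)) / \<epsilon>) / \<epsilon> * zero_ext x (t + - \<epsilon> * u) \<partial>lborel)"
    using assms by (intro lborel_integral_real_affine) auto
  also have "\<dots> = (\<integral>u. \<epsilon> * (\<psi> ((t - (t + - \<epsilon> * u)) / \<epsilon>) / \<epsilon> * zero_ext x (t + - \<epsilon> * u)) \<partial>lborel)"
    using assms by simp
  also have "\<dots> = (\<integral>u. \<psi> u * zero_ext x (t - \<epsilon> * u) \<partial>lborel)"
    using assms by (intro Bochner_Integration.integral_cong) auto
  finally show ?thesis .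
qed

lemma regularized_close:
  fixes \<psi> x :: "real \<Rightarrow> real"
  assumes \<psi>: "integrable lborel \<psi>" "(\<integral>u. \<psi> u \<partial>lborel) = 1" "\<And>u. u \<notin> {-1..1} \<Longrightarrow> \<psi> u = 0"
    and x: "continuous_on UNIV x" and \<eta>: "\<And>u. u \<in> {-1..1} \<Longrightarrow> \<bar>x (t - \<epsilon> * u) - x t\<bar> \<le> \<eta>"
  shows "\<bar>(\<integral>u. \<psi> u * x (t - \<epsilon> * u) \<partial>lborel) - x t\<bar> \<le> \<eta> * (\<integral>u. \<bar>\<psi> u\<bar> \<partial>lborel)"
proof -
  have [measurable]: "x \<in> borel_measurable borel" "\<psi> \<in> borel_measurable borel"
    using borel_measurable_continuous_onI[OF x] \<psi>(1) by auto
  have le: "\<bar>\<psi> u * (x (t - \<epsilon> * u) - x t)\<bar> \<le> \<eta> * \<bar>\<psi> u\<bar>" for u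
    using mult_right_mono[OF \<eta>[of u], of "\<bar>\<psi> u\<bar>"] \<psi>(3)[of u]
    by (cases "u \<in> {-1..1}") (auto simp: abs_mult mult.commute)
  have i: "integrable lborel (\<lambda>u. \<psi> u * (x (t - \<epsilon> * u) - x t))"
    by (rule Bochner_Integration.integrable_bound[where f = "\<lambda>u. \<eta> * \<bar>\<psi> u\<bar>"])
      (use \<psi>(1) in \<open>auto intro!: AE_I2 order_trans[OF le]\<close>)
  have i': "integrable lborel (\<lambda>u. \<psi> u * x t)" using \<psi>(1) by simp
  have "(\<integral>u. \<psi> u * x (t - \<epsilon> * u) \<partial>lborel) = (\<integral>u. \<psi> u * (x (t - \<epsilon> * u) - x t) + \<psi> u * x t \<partial>lborel)"
    by (simp add: algebra_simps)
  also have "\<dots> = (\<integral>u. \<psi> u * (x (t - \<epsilon> * u) - x t) \<partial>lborel) + x t"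
    using i i' \<psi>(2) by (subst Bochner_Integration.integral_add) auto
  finally have "\<bar>(\<integral>u. \<psi> u * x (t - \<epsilon> * u) \<partial>lborel) - x t\<bar> = \<bar>\<integral>u. \<psi> u * (x (t - \<epsilon> * u) - x t) \<partial>lborel\<bar>"
    by simp
  also have "\<dots> \<le> (\<integral>u. \<bar>\<psi> u * (x (t - \<epsilon> * u) - x t)\<bar> \<partial>lborel)" by (rule integral_abs_bound)
  also have "\<dots> \<le> (\<integral>u. \<eta> * \<bar>\<psi> u\<bar> \<partial>lborel)"
    using i \<psi>(1) by (intro integral_mono le) auto
  finally show ?thesis by simp
qed

context stieltjes_pair
begin

lemma convolution_eq_S:
  assumes \<psi>: "AE u in lborel. \<psi> u = measure P {..u} - measure N {..u}"
    and \<psi>m [measurable]: "\<psi> \<in> borel_measurable borel"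
    and supp: "\<And>u. u \<notin> {-1..1} \<Longrightarrow> \<psi> u = 0"
    and x: "continuous_on UNIV x" and \<Phi>: "\<And>r. (\<Phi> has_real_derivative x r) (at r)" and \<epsilon>: "0 < \<epsilon>"
  shows "(\<integral>u. \<psi> u * x (t - \<epsilon> * u) \<partial>lborel) = S (\<lambda>v. \<Phi> (t - \<epsilon> * v)) / \<epsilon>"
proof -
  note CP = integral_cdf_convolution[OF P.finite_measure_axioms sets_P AE_P x \<Phi> \<epsilon>]
    and CN = integral_cdf_convolution[OF N.finite_measure_axioms sets_N AE_N x \<Phi> \<epsilon>]
  have [measurable]: "x \<in> borel_measurable borel"
    using borel_measurable_continuous_onI[OF x] .
  have "(\<integral>u. \<psi> u * x (t - \<epsilon> * u) \<partial>lborel) =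
    (\<integral>u. indicator {-1..1} u * measure P {..u} * x (t - \<epsilon> * u) - indicator {-1..1} u * measure N {..u} * x (t - \<epsilon> * u) \<partial>lborel)"
  proof (rule integral_cong_AE)
    show "(\<lambda>u. indicator {-1..1} u * measure P {..u} * x (t - \<epsilon> * u) - indicator {-1..1} u * measure N {..u} * x (t - \<epsilon> * u))
      \<in> borel_measurable lborel"
      using CP(1) CN(1) by (intro borel_measurable_diff) auto
    show "AE u in lborel. \<psi> u * x (t - \<epsilon> * u) = indicator {-1..1} u * measure P {..u} * x (t - \<epsilon> * u) - indicator {-1..1} u * measure N {..u} * x (t - \<epsilon> * u)"
      using \<psi>
    proof eventually_elim
      case (elim u)
      then show ?case using supp[of u] by (cases "u \<in> {-1..1}") (auto simp: left_diff_distrib)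
    qed
  qed measurable
  also have "\<dots> = (\<integral>v. (\<Phi> (t - \<epsilon> * v) - \<Phi> (t - \<epsilon>)) / \<epsilon> \<partial>P) - (\<integral>v. (\<Phi> (t - \<epsilon> * v) - \<Phi> (t - \<epsilon>)) / \<epsilon> \<partial>N)"
    using CP CN by simp
  also have "\<dots> = S (\<lambda>v. (1 / \<epsilon>) * (\<Phi> (t - \<epsilon> * v) - \<Phi> (t - \<epsilon>)))" by (simp add: S_def)
  \<comment> \<open>The boundary term at \<open>t - \<epsilon>\<close> does not depend on
    \<open>v\<close> and is annihilated by \<open>S\<close>.\<close>
  also have "\<dots> = S (\<lambda>v. \<Phi> (t - \<epsilon> * v)) / \<epsilon>"
  proof -
    have \<Phi>c: "continuous_on UNIV \<Phi>"
      using \<Phi> by (meson DERIV_isCont continuous_at_imp_continuous_on)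
    have "adm (\<lambda>v. \<Phi> (t - \<epsilon> * v))"
      by (intro adm_continuous continuous_on_compose2[OF \<Phi>c]) (auto intro!: continuous_intros)
    then show ?thesis unfolding S_cmult by (subst S_diff) auto
  qed
  finally show ?thesis .
qed

text \<open>Differentiation under the signed integral. By the mean value bound the difference
  quotients of \<open>\<Phi>\<close> are dominated by the maximum of \<open>x\<close> on a window
  \<open>A\<close> that contains all arguments.\<close>

lemma S_has_derivative:
  assumes x: "continuous_on UNIV x" and \<Phi>: "\<And>r. (\<Phi> has_real_derivative x r) (at r)" and \<epsilon>: "0 < \<epsilon>"
  shows "((\<lambda>t. S (\<lambda>v. \<Phi> (t - \<epsilon> * v))) has_real_derivative S (\<lambda>v. x (t - \<epsilon> * v))) (at t)"
proof -
  have \<Phi>c: "continuous_on UNIV \<Phi>"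
    using \<Phi> by (meson DERIV_isCont continuous_at_imp_continuous_on)
  have [measurable]: "\<Phi> \<in> borel_measurable borel" "x \<in> borel_measurable borel"
    using borel_measurable_continuous_onI \<Phi>c x by auto
  have adm: "adm (\<lambda>v. \<Phi> (r - \<epsilon> * v))" for r
    by (intro adm_continuous continuous_on_compose2[OF \<Phi>c]) (auto intro!: continuous_intros)
  define A where "A = {t - 1 - \<epsilon>..t + 1 + \<epsilon>}"
  have "compact (x ` A)"
    by (intro compact_continuous_image continuous_on_subset[OF x]) (auto simp: A_def)
  then obtain K where "\<forall>y\<in>x ` A. norm y \<le> K"
    using compact_imp_bounded bounded_iff by blast
  then have K: "norm (x r) \<le> K" if "r \<in> A" for r using that by auto
  have "((\<lambda>h. S (\<lambda>v. (\<Phi> (t + h - \<epsilon> * v) - \<Phi> (t - \<epsilon> * v)) / h)) \<longlongrightarrow> S (\<lambda>v. x (t - \<epsilon> * v))) (at 0)"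
  proof (rule S_tendsto_at[where K = K])
    fix h u :: real assume u: "u \<in> {-1..1}" and h: "\<bar>h - 0\<bar> \<le> 1"
    have "\<bar>\<epsilon> * u\<bar> \<le> \<epsilon>" using u \<epsilon> by (auto simp: abs_mult abs_le_iff intro!: mult_left_le)
    then have AA: "t + h - \<epsilon> * u \<in> A" "t - \<epsilon> * u \<in> A" using h by (auto simp: A_def)
    have "norm (\<Phi> (t + h - \<epsilon> * u) - \<Phi> (t - \<epsilon> * u)) \<le> K * norm ((t + h - \<epsilon> * u) - (t - \<epsilon> * u))"
    proof (rule field_differentiable_bound[of A \<Phi> x])
      show "(\<Phi> has_real_derivative x z) (at z within A)" for z
        by (rule has_field_derivative_at_within[OF \<Phi>])
      show "convex A" by (simp add: A_def)
    qed (fact AA K)+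
    moreover have "0 \<le> K" using K[of t] \<epsilon> by (auto simp: A_def intro: order_trans[OF abs_ge_zero])
    ultimately show "\<bar>(\<Phi> (t + h - \<epsilon> * u) - \<Phi> (t - \<epsilon> * u)) / h\<bar> \<le> K"
      by (cases "h = 0") (auto simp: divide_le_eq abs_divide)
  next
    fix u :: real
    show "((\<lambda>h. (\<Phi> (t + h - \<epsilon> * u) - \<Phi> (t - \<epsilon> * u)) / h) \<longlongrightarrow> x (t - \<epsilon> * u)) (at 0)"
      using \<Phi>[of "t - \<epsilon> * u"] by (simp add: DERIV_def algebra_simps)
  qed measurable
  moreover have "S (\<lambda>v. (\<Phi> (t + h - \<epsilon> * v) - \<Phi> (t - \<epsilon> * v)) / h) =
    (S (\<lambda>v. \<Phi> (t + h - \<epsilon> * v)) - S (\<lambda>v. \<Phi> (t - \<epsilon> * v))) / h" for h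
    using S_cmult[of "1 / h" "\<lambda>v. \<Phi> (t + h - \<epsilon> * v) - \<Phi> (t - \<epsilon> * v)"] S_diff[OF adm adm] by simp
  ultimately show ?thesis by (simp add: DERIV_def)
qed

lemma continuous_S_shift:
  assumes x: "continuous_on UNIV x"
  shows "continuous_on UNIV (\<lambda>t. S (\<lambda>v. x (t - \<epsilon> * v)))"
proof -
  have "continuous_on UNIV (\<lambda>(t, v). x (t - \<epsilon> * v))"
    unfolding case_prod_beta by (rule continuous_on_compose2[OF x]) (auto intro!: continuous_intros)
  from riemann_tendsto2(2)[OF this] show ?thesis .
qed

text \<open>Although neither factor of the convolution need be differentiable, the formula of
  \<open>convolution_eq_S\<close> contains \<open>t\<close> only through the primitive of
  \<open>x\<close>, which is continuously differentiable.\<close>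

lemma convolution_has_derivative:
  assumes \<psi>: "AE u in lborel. \<psi> u = measure P {..u} - measure N {..u}"
    and \<psi>m: "\<psi> \<in> borel_measurable borel"
    and supp: "\<And>u. u \<notin> {-1..1} \<Longrightarrow> \<psi> u = 0"
    and x: "continuous_on UNIV x" and \<epsilon>: "0 < \<epsilon>"
  shows "((\<lambda>t. \<integral>u. \<psi> u * x (t - \<epsilon> * u) \<partial>lborel) has_real_derivative S (\<lambda>v. x (t - \<epsilon> * v)) / \<epsilon>) (at t)"
proof -
  have "\<exists>\<Phi>. \<forall>r::real. -\<infinity> < ereal r \<longrightarrow> ereal r < \<infinity> \<longrightarrow> (\<Phi> has_vector_derivative x r) (at r)"
    using x by (intro einterval_antiderivative) (auto simp: continuous_on_eq_continuous_at)
  then obtain \<Phi> where \<Phi>: "\<And>r. (\<Phi> has_real_derivative x r) (at r)"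
    by (auto simp: has_real_derivative_iff_has_vector_derivative)
  have "(\<integral>u. \<psi> u * x (t - \<epsilon> * u) \<partial>lborel) = S (\<lambda>v. \<Phi> (t - \<epsilon> * v)) / \<epsilon>" for t
    by (rule convolution_eq_S[OF \<psi> \<psi>m _ x \<Phi> \<epsilon>]) (rule supp)
  then show ?thesis
    by (simp only:) (intro DERIV_cdivide S_has_derivative[OF x \<Phi> \<epsilon>])
qed

end

subsection \<open>The Banach indicatrix\<close>

lemma continuous_bounded_Icc:
  fixes h :: "real \<Rightarrow> real"
  assumes "continuous_on UNIV h"
  obtains K where "0 \<le> K" "\<And>t. t \<in> {a..b} \<Longrightarrow> \<bar>h t\<bar> \<le> K"
proof -
  have "compact (h ` {a..b})"
    by (intro compact_continuous_image continuous_on_subset[OF assms]) auto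
  then obtain K where "\<forall>y\<in>h ` {a..b}. norm y \<le> K"
    using compact_imp_bounded bounded_iff by blast
  then show ?thesis by (intro that[of "\<bar>K\<bar>"]) force+
qed

definition cell :: "nat \<Rightarrow> int \<Rightarrow> real set" where
  "cell n k = {t. \<lfloor>2 ^ n * t\<rfloor> = k}"

lemma cell_eq: "cell n k = {of_int k / 2 ^ n ..< (of_int k + 1) / 2 ^ n}"
  by (auto simp: cell_def floor_eq_iff field_simps)

lemma is_interval_cell: "is_interval (cell n k)"
  unfolding cell_eq by (simp add: is_interval_connected_1)

text \<open>Integer division by \<open>2\<close> maps the index of a dyadic cell to that of its
  parent, so the occupied coarse cells are an image of the occupied fine ones.\<close>

lemma card_floor_le_Suc:
  assumes "finite ((\<lambda>t. \<lfloor>2 ^ Suc n * t\<rfloor>) ` A)"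
  shows "card ((\<lambda>t::real. \<lfloor>2 ^ n * t\<rfloor>) ` A) \<le> card ((\<lambda>t. \<lfloor>2 ^ Suc n * t\<rfloor>) ` A)"
proof -
  have "\<lfloor>2 ^ n * t\<rfloor> = \<lfloor>2 ^ Suc n * t\<rfloor> div 2" for t :: real
  proof -
    have "\<lfloor>2 ^ Suc n * t\<rfloor> div 2 = \<lfloor>2 ^ Suc n * t / real_of_int 2\<rfloor>"
      using floor_divide_real_eq_div[of 2 "2 ^ Suc n * t"] by simp
    then show ?thesis by simp
  qed
  then have "(\<lambda>t::real. \<lfloor>2 ^ n * t\<rfloor>) ` A = (\<lambda>k. k div 2) ` (\<lambda>t. \<lfloor>2 ^ Suc n * t\<rfloor>) ` A"
    by (simp add: image_image)
  then show ?thesis using card_image_le[OF assms] by simp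
qed

lemma inj_on_floor_eventually:
  assumes "finite (F :: real set)"
  shows "\<exists>n. inj_on (\<lambda>t. \<lfloor>2 ^ n * t\<rfloor>) F"
proof -
  have "\<forall>\<^sub>F n in sequentially. \<forall>p\<in>F \<times> F. fst p \<noteq> snd p \<longrightarrow> \<lfloor>2 ^ n * fst p\<rfloor> \<noteq> \<lfloor>2 ^ n * snd p\<rfloor>"
  proof (intro eventually_ball_finite ballI)
    fix p assume "p \<in> F \<times> F"
    show "\<forall>\<^sub>F n in sequentially. fst p \<noteq> snd p \<longrightarrow> \<lfloor>2 ^ n * fst p\<rfloor> \<noteq> \<lfloor>2 ^ n * snd p\<rfloor>"
    proof (cases "fst p = snd p")
      case False
      then have d: "0 < \<bar>fst p - snd p\<bar>" by simp
      have "\<forall>\<^sub>F n in sequentially. (1 / \<bar>fst p - snd p\<bar>) < 2 ^ n"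
        using filterlim_realpow_sequentially_gt1[of "2::real"]
        by (auto simp: filterlim_at_infinity_imp_filterlim_at_top filterlim_at_top_dense dest!: filterlim_at_infinity_imp_norm_at_top)
      then show ?thesis
      proof eventually_elim
        case (elim n)
        then have "1 < 2 ^ n * \<bar>fst p - snd p\<bar>" using d by (simp add: divide_less_eq)
        then have "1 < \<bar>2 ^ n * fst p - 2 ^ n * snd p\<bar>"
          by (simp add: abs_mult flip: right_diff_distrib)
        then show ?case by linarith
      qed
    qed simp
  qed (use assms in simp)
  then obtain n where "\<forall>p\<in>F \<times> F. fst p \<noteq> snd p \<longrightarrow> \<lfloor>2 ^ n * fst p\<rfloor> \<noteq> \<lfloor>2 ^ n * snd p\<rfloor>"
    by (auto simp: eventually_sequentially)
  then show ?thesis by (intro exI[of _ n]) (force simp: inj_on_def)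
qed

text \<open>Any finite subset is eventually separated by the dyadic cells, so the counts of occupied
  cells reach its cardinality. An infinite set has finite subsets of every size, which gives
  infinity on both sides. The crossing number thereby becomes a countable supremum, hence measurable
  in the level.\<close>

lemma SUP_card_floor:
  assumes fin: "\<And>n. finite ((\<lambda>t::real. \<lfloor>2 ^ n * t\<rfloor>) ` A)"
  shows "(SUP n. ennreal (card ((\<lambda>t. \<lfloor>2 ^ n * t\<rfloor>) ` A))) = emeasure (count_space UNIV) A"
proof (rule antisym)
  show "(SUP n. ennreal (card ((\<lambda>t. \<lfloor>2 ^ n * t\<rfloor>) ` A))) \<le> emeasure (count_space UNIV) A"
  proof (cases "finite A")
    case True
    then show ?thesis
      by (intro SUP_least) (simp add: emeasure_count_space_finite card_image_le flip: ennreal_of_nat_eq_real_of_nat)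
  qed (simp add: emeasure_count_space_infinite)
  have *: "ennreal (card F) \<le> (SUP n. ennreal (card ((\<lambda>t. \<lfloor>2 ^ n * t\<rfloor>) ` A)))" if F: "finite F" "F \<subseteq> A" for F
  proof -
    obtain n :: nat where n: "inj_on (\<lambda>t. \<lfloor>2 ^ n * t\<rfloor>) F" using inj_on_floor_eventually[OF F(1)] by blast
    have "card F = card ((\<lambda>t. \<lfloor>2 ^ n * t\<rfloor>) ` F)" using n by (simp add: card_image)
    also have "\<dots> \<le> card ((\<lambda>t. \<lfloor>2 ^ n * t\<rfloor>) ` A)" using F by (intro card_mono fin) auto
    finally show ?thesis by (intro SUP_upper2[of n]) (auto intro!: ennreal_leI)
  qed
  show "emeasure (count_space UNIV) A \<le> (SUP n. ennreal (card ((\<lambda>t. \<lfloor>2 ^ n * t\<rfloor>) ` A)))"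
  proof (cases "finite A")
    case True
    then show ?thesis using *[OF True] by (simp add: emeasure_count_space_finite ennreal_of_nat_eq_real_of_nat)
  next
    case False
    have "of_nat k \<le> (SUP n. ennreal (card ((\<lambda>t. \<lfloor>2 ^ n * t\<rfloor>) ` A)))" for k
    proof -
      obtain F where F: "finite F" "card F = k" "F \<subseteq> A"
        using infinite_arbitrarily_large[OF False, of k] by blast
      show ?thesis using *[OF F(1,3)] F(2) by (simp add: ennreal_of_nat_eq_real_of_nat)
    qed
    then have "(SUP n. ennreal (card ((\<lambda>t. \<lfloor>2 ^ n * t\<rfloor>) ` A))) = \<infinity>"
      by (metis ennreal_Ex_less_of_nat infinity_ennreal_def leD top.not_eq_extremum)
    then show ?thesis by (simp only: infinity_ennreal_def top_greatest)
  qed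
qed

lemma set_integral_abs_le:
  fixes h :: "real \<Rightarrow> real"
  assumes [measurable]: "A \<in> sets borel" "h \<in> borel_measurable borel"
    and A: "A \<subseteq> {c..d}" "c \<le> d" and h: "\<And>t. t \<in> A \<Longrightarrow> \<bar>h t\<bar> \<le> L" and L: "0 \<le> L"
  shows "set_integrable lborel A h" "\<bar>LINT t:A|lborel. h t\<bar> \<le> L * (d - c)"
proof -
  show i: "set_integrable lborel A h"
    unfolding set_integrable_def
  proof (rule integrableI_bounded_set[where A = "{c..d}" and B = L])
    show "AE t in lborel. t \<in> {c..d} \<longrightarrow> norm (indicator A t *\<^sub>R h t) \<le> L"
      using h L by (intro AE_I2) (auto simp: indicator_def)
    show "AE t in lborel. t \<notin> {c..d} \<longrightarrow> indicator A t *\<^sub>R h t = 0"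
      using A by (intro AE_I2) (auto simp: indicator_def)
  qed (use A in auto)
  have "\<bar>LINT t:A|lborel. h t\<bar> \<le> (\<integral>t. \<bar>indicator A t *\<^sub>R h t\<bar> \<partial>lborel)"
    unfolding set_lebesgue_integral_def by (rule integral_abs_bound)
  also have "\<dots> \<le> (\<integral>t. L * indicator {c..d} t \<partial>lborel)"
  proof (rule integral_mono)
    show "integrable lborel (\<lambda>t. \<bar>indicator A t *\<^sub>R h t\<bar>)"
      using i unfolding set_integrable_def by (rule integrable_abs)
    show "integrable lborel (\<lambda>t. L * indicator {c..d} t)" by (simp add: A(2))
  qed (use A h L in \<open>auto simp: indicator_def\<close>)
  also have "\<dots> = L * (d - c)" using A(2) by simp
  finally show "\<bar>LINT t:A|lborel. h t\<bar> \<le> L * (d - c)" .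
qed

text \<open>Without critical points \<open>y\<close> is injective on the interval by Rolle's
  theorem, and the classical substitution formula applies.\<close>

lemma change_of_variables_noncritical:
  fixes y D g :: "real \<Rightarrow> real"
  assumes y: "\<And>t. (y has_real_derivative D t) (at t)" and D: "continuous_on UNIV D"
    and J: "is_interval J" "bounded J" and D0: "\<And>t. t \<in> J \<Longrightarrow> D t \<noteq> 0"
    and g [measurable]: "g \<in> borel_measurable borel" and gK: "\<And>x. \<bar>g x\<bar> \<le> K"
  shows "(LINT x:y ` J|lborel. g x) = (LINT t:J|lborel. g (y t) * \<bar>D t\<bar>)"
proof -
  have yc: "continuous_on UNIV y" using y by (meson DERIV_isCont continuous_at_imp_continuous_on)
  note [measurable] = borel_measurable_continuous_onI[OF yc] borel_measurable_continuous_onI[OF D]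
  have Jb: "J \<in> sets borel" by (rule real_interval_borel_measurable[OF J(1)])
  have yJ: "is_interval (y ` J)"
    using J(1) connected_continuous_image[OF continuous_on_subset[OF yc]] by (auto simp: is_interval_connected_1)
  have yJb: "y ` J \<in> sets borel" by (rule real_interval_borel_measurable[OF yJ])
  have inj: "inj_on y J"
  proof (rule inj_onI, rule ccontr)
    fix s t assume st: "s \<in> J" "t \<in> J" "y s = y t" "s \<noteq> t"
    have "\<exists>z\<in>J. D z = 0" if *: "s < t" "s \<in> J" "t \<in> J" "y s = y t" for s t
    proof -
      obtain z where z: "s < z" "z < t" "D z = 0"
        using MVT2[OF *(1), of y D] y * by auto
      then have "z \<in> J" using J(1) * unfolding is_interval_1 by (meson less_imp_le)
      with z show ?thesis by blast
    qed
    from this[of s t] this[of t s] st D0 show False by (metis linorder_neqE_linordered_idom)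
  qed
  have int: "set_integrable lborel J (\<lambda>t. \<bar>D t\<bar> * g (y t))"
  proof -
    obtain a where "J \<subseteq> cbox (- a) a" using J(2) bounded_subset_cbox_symmetric by metis
    then have aJ: "J \<subseteq> {- \<bar>a\<bar>..\<bar>a\<bar>}" by force
    obtain L where L: "0 \<le> L" "\<And>t. t \<in> {- \<bar>a\<bar>..\<bar>a\<bar>} \<Longrightarrow> \<bar>D t\<bar> \<le> L"
      using continuous_bounded_Icc[OF D] by blast
    have K0: "0 \<le> K" using gK[of 0] by linarith
    show ?thesis
    proof (rule set_integral_abs_le(1)[OF Jb _ aJ])
      show "\<bar>\<bar>D t\<bar> * g (y t)\<bar> \<le> L * K" if "t \<in> J" for t
        unfolding abs_mult abs_abs using aJ that by (intro mult_mono gK L) auto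
    qed (use L K0 in simp_all)
  qed
  have leb: "set_integrable lebesgue A h \<longleftrightarrow> set_integrable lborel A h"
    "(LINT x:A|lebesgue. h x) = (LINT x:A|lborel. h x)"
    if [measurable]: "A \<in> sets borel" "h \<in> borel_measurable borel" for A and h :: "real \<Rightarrow> real"
    unfolding set_integrable_def set_lebesgue_integral_def
    by (subst integrable_completion integral_completion; simp)+
  let ?b = "integral J (\<lambda>t. \<bar>D t\<bar> * g (y t))"
  have "(\<lambda>t. \<bar>D t\<bar> * g (y t)) absolutely_integrable_on J \<and> integral J (\<lambda>t. \<bar>D t\<bar> * g (y t)) = ?b"
    using int leb(1)[OF Jb, of "\<lambda>t. \<bar>D t\<bar> * g (y t)"] by simp
  then have R: "g absolutely_integrable_on (y ` J) \<and> integral (y ` J) g = ?b"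
    by (subst (asm) has_absolute_integral_change_of_variables_1')
      (use Jb inj in \<open>auto intro: has_field_derivative_at_within[OF y]\<close>)
  have "(LINT x:y ` J|lborel. g x) = integral (y ` J) g"
    using R set_lebesgue_integral_eq_integral(2)[of "y ` J" g] leb(2)[OF yJb g] by simp
  also have "\<dots> = (LINT t:J|lborel. \<bar>D t\<bar> * g (y t))"
    using R set_lebesgue_integral_eq_integral(2)[of J "\<lambda>t. \<bar>D t\<bar> * g (y t)"] int
      leb[OF Jb, of "\<lambda>t. \<bar>D t\<bar> * g (y t)"] by simp
  finally show ?thesis by (simp add: mult.commute)
qed


text \<open>The crossings are the increasing limit of the numbers of dyadic cells that contain a crossing.
  On a cell without critical points the change of variables is exact, and on a cell with a critical
  point both sides are small compared to the length of the cell.\<close>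

lemma banach_indicatrix:
  fixes y D f :: "real \<Rightarrow> real"
  assumes y: "\<And>t. (y has_real_derivative D t) (at t)" and D: "continuous_on UNIV D"
    and I: "is_interval I" "bounded I"
    and f [measurable]: "f \<in> borel_measurable borel" and fK: "\<And>x. \<bar>f x\<bar> \<le> K"
  shows "AE x in lborel. crossings y x I < \<infinity>"
    and "integrable lborel (\<lambda>x. f x * enn2real (crossings y x I))"
    and "(\<integral>x. f x * enn2real (crossings y x I) \<partial>lborel) = (LINT t:I|lborel. f (y t) * \<bar>D t\<bar>)"
proof -
  have yc: "continuous_on UNIV y" using y by (meson DERIV_isCont continuous_at_imp_continuous_on)
  note [measurable] = borel_measurable_continuous_onI[OF yc] borel_measurable_continuous_onI[OF D]
    real_interval_borel_measurable[OF I(1)]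
  obtain a0 where "I \<subseteq> cbox (- a0) a0" using I(2) bounded_subset_cbox_symmetric by metis
  then have "I \<subseteq> {- \<bar>a0\<bar>..\<bar>a0\<bar>}" by force
  then obtain a b where ab: "I \<subseteq> {a..b}" "a \<le> b"
    using that[of "- \<bar>a0\<bar>" "\<bar>a0\<bar>"] by simp
  define fl where "fl n t = \<lfloor>2 ^ n * t\<rfloor>" for n and t :: real
  define A where "A x = {t \<in> I. y t = x}" for x
  define idx where "idx n = {\<lfloor>2 ^ n * a\<rfloor>..\<lfloor>2 ^ n * b\<rfloor>}" for n :: nat
  define J where "J n k = I \<inter> cell n k" for n k
  define N where "N n x = real (card (fl n ` A x))" for n x
  have fl_idx: "fl n t \<in> idx n" if "t \<in> I" for n t
    using that ab by (auto simp: fl_def idx_def intro!: floor_mono)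
  have Ji: "is_interval (J n k)" for n k
    unfolding J_def by (intro is_interval_Int I is_interval_cell)
  have Jb [measurable]: "J n k \<in> sets borel" for n k by (rule real_interval_borel_measurable[OF Ji])
  have yJb [measurable]: "y ` J n k \<in> sets borel" for n k
    using Ji connected_continuous_image[OF continuous_on_subset[OF yc]]
    by (intro real_interval_borel_measurable) (auto simp: is_interval_connected_1)
  have N_sum: "N n x = (\<Sum>k\<in>idx n. indicator (y ` J n k) x)" for n x
  proof -
    have "fl n ` A x = {k \<in> idx n. x \<in> y ` J n k}"
      using fl_idx by (auto simp: A_def J_def cell_def fl_def)
    then have "N n x = (\<Sum>k\<in>{k \<in> idx n. x \<in> y ` J n k}. 1)" by (simp add: N_def)
    also have "\<dots> = (\<Sum>k\<in>idx n. indicator (y ` J n k) x)"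
      by (intro sum.mono_neutral_cong_left) (auto simp: idx_def)
    finally show ?thesis .
  qed
  have Nm [measurable]: "N n \<in> borel_measurable borel" for n
    unfolding N_sum[abs_def] by measurable
  have Afin: "finite (fl n ` A x)" for n x
    by (rule finite_subset[of _ "idx n"]) (use fl_idx in \<open>auto simp: A_def idx_def\<close>)
  have cross: "(SUP n. ennreal (N n x)) = crossings y x I" for x
    using SUP_card_floor[of "A x"] Afin unfolding N_def crossings_def A_def fl_def by simp
  have Nmono: "N n x \<le> N m x" if "n \<le> m" for n m x
    using that
  proof (induction m rule: dec_induct)
    case (step m)
    then show ?case using card_floor_le_Suc[of m "A x"] Afin[of "Suc m" x]
      unfolding N_def fl_def by linarith
  qed simp
  have K0: "0 \<le> K" using fK[of 0] by linarith
  \<comment> \<open>Kept general in \<open>g\<close>: the constant \<open>1\<close> gives the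
    integrability of the crossing number, which then serves as dominating function for
    \<open>g = f\<close>.\<close>
  have R: "integrable lborel (\<lambda>x. g x * N n x)"
    "(\<lambda>n. \<integral>x. g x * N n x \<partial>lborel) \<longlonglongrightarrow> (LINT t:I|lborel. g (y t) * \<bar>D t\<bar>)"
    if [measurable]: "g \<in> borel_measurable borel" and gK: "\<And>x. \<bar>g x\<bar> \<le> L" for g and L :: real and n
  proof -
    have L0: "0 \<le> L" using gK[of 0] by linarith
    obtain KD where KD0: "0 \<le> KD" and KD: "\<And>t. t \<in> {a..b} \<Longrightarrow> \<bar>D t\<bar> \<le> KD"
      using continuous_bounded_Icc[OF D] by blast
    obtain Ky where Ky0: "0 \<le> Ky" and Ky: "\<And>t. t \<in> {a..b} \<Longrightarrow> \<bar>y t\<bar> \<le> Ky"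
      using continuous_bounded_Icc[OF yc] by blast
    have JI: "t \<in> {a..b}" if "t \<in> J n k" for t n k using that ab(1) by (auto simp: J_def)
    have yJI: "y ` J n k \<subseteq> {-Ky..Ky}" for n k
    proof
      fix x assume "x \<in> y ` J n k"
      then obtain t where "t \<in> J n k" "x = y t" by blast
      then show "x \<in> {-Ky..Ky}" using Ky[OF JI] by (auto simp: abs_le_iff minus_le_iff)
    qed
    have gJ: "set_integrable lborel (y ` J n k) g" for n k
      by (rule set_integral_abs_le(1)[OF yJb _ yJI, where L = L]) (use Ky0 gK L0 in simp_all)
    have JI': "J n k \<subseteq> {a..b}" for n k using JI by blast
    have gD: "set_integrable lborel (J n k) (\<lambda>t. g (y t) * \<bar>D t\<bar>)" for n k
    proof (rule set_integral_abs_le(1)[OF Jb _ JI' ab(2)])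
      show "\<bar>g (y t) * \<bar>D t\<bar>\<bar> \<le> L * KD" if "t \<in> J n k" for t
        unfolding abs_mult abs_abs by (intro mult_mono gK KD JI[OF that] L0) simp
    qed (use L0 KD0 in simp_all)
    have eqN: "g x * N n x = (\<Sum>k\<in>idx n. indicator (y ` J n k) x *\<^sub>R g x)" for n x
      by (simp add: N_sum sum_distrib_left mult.commute)
    show "integrable lborel (\<lambda>x. g x * N n x)"
      unfolding eqN using gJ unfolding set_integrable_def by (intro Bochner_Integration.integrable_sum)
    have RN: "(\<integral>x. g x * N n x \<partial>lborel) = (\<Sum>k\<in>idx n. LINT x:y ` J n k|lborel. g x)" for n
      unfolding eqN set_lebesgue_integral_def using gJ unfolding set_integrable_def
      by (intro Bochner_Integration.integral_sum)
    have RI: "(LINT t:I|lborel. g (y t) * \<bar>D t\<bar>) = (\<Sum>k\<in>idx n. LINT t:J n k|lborel. g (y t) * \<bar>D t\<bar>)" for n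
    proof -
      have ind: "indicator I t = (\<Sum>k\<in>idx n. indicator (J n k) t :: real)" for t
      proof (cases "t \<in> I")
        case True
        then show ?thesis using fl_idx[OF True, of n]
          by (subst sum.remove[of _ "fl n t"]) (auto simp: idx_def J_def cell_def fl_def indicator_def intro!: sum.neutral)
      qed (auto simp: J_def)
      have "(LINT t:I|lborel. g (y t) * \<bar>D t\<bar>) = (\<integral>t. (\<Sum>k\<in>idx n. indicator (J n k) t *\<^sub>R (g (y t) * \<bar>D t\<bar>)) \<partial>lborel)"
        unfolding set_lebesgue_integral_def ind by (simp add: sum_distrib_right)
      also have "\<dots> = (\<Sum>k\<in>idx n. LINT t:J n k|lborel. g (y t) * \<bar>D t\<bar>)"
        unfolding set_lebesgue_integral_def using gD unfolding set_integrable_def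
        by (intro Bochner_Integration.integral_sum)
      finally show ?thesis .
    qed
    show "(\<lambda>n. \<integral>x. g x * N n x \<partial>lborel) \<longlonglongrightarrow> (LINT t:I|lborel. g (y t) * \<bar>D t\<bar>)"
    proof (rule LIMSEQ_I)
      fix r :: real assume r: "0 < r"
      \<comment> \<open>The sum of the cell errors is at most
        \<open>3 * L * (b - a + 2) * \<eta>\<close>; the extra \<open>1\<close> keeps the
        denominator positive when \<open>L = 0\<close> and makes the final estimate strict.\<close>
      define \<eta> where "\<eta> = r / (3 * L * (b - a + 2) + 1)"
      have den: "0 < 3 * L * (b - a + 2) + 1" using L0 ab(2) by (simp add: add_nonneg_pos)
      have \<eta>: "0 < \<eta>" using r den by (simp add: \<eta>_def)
      have "uniformly_continuous_on {a..b} D"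
        by (intro compact_uniformly_continuous continuous_on_subset[OF D]) auto
      then obtain d where d: "0 < d" "\<And>s t. s \<in> {a..b} \<Longrightarrow> t \<in> {a..b} \<Longrightarrow> \<bar>s - t\<bar> < d \<Longrightarrow> \<bar>D s - D t\<bar> < \<eta>"
        unfolding uniformly_continuous_on_def dist_real_def using \<eta> by metis
      obtain n0 where n0: "(1 / 2) ^ n0 < d" using real_arch_pow_inv[OF d(1), of "1 / 2"] by auto
      have "\<bar>(\<integral>x. g x * N n x \<partial>lborel) - (LINT t:I|lborel. g (y t) * \<bar>D t\<bar>)\<bar> < r" if n: "n0 \<le> n" for n
      proof -
        have pn: "1 / 2 ^ n < d"
          using n0 power_decreasing[OF n, of "1 / 2 :: real"] by (simp add: power_one_over)
        \<comment> \<open>On a cell with a critical point \<open>D\<close> is at most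
          \<open>\<eta>\<close> in absolute value. The image of the cell then lies in an interval of
          length \<open>2 * \<eta> / 2 ^ n\<close>, and the integral of the speed over the cell is
          at most \<open>\<eta> / 2 ^ n\<close>; together these give the factor
          \<open>3\<close>.\<close>
        have loc: "\<bar>(LINT x:y ` J n k|lborel. g x) - (LINT t:J n k|lborel. g (y t) * \<bar>D t\<bar>)\<bar> \<le> 3 * L * \<eta> / 2 ^ n" for k
        proof (cases "\<exists>s\<in>J n k. D s = 0")
          case False
          then have "(LINT x:y ` J n k|lborel. g x) = (LINT t:J n k|lborel. g (y t) * \<bar>D t\<bar>)"
            using I(2) by (intro change_of_variables_noncritical[OF y D Ji _ _ _ gK])
              (auto simp: J_def intro: bounded_Int)
          then show ?thesis using L0 \<eta> by simp
        next
          case True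
          then obtain s where s: "s \<in> J n k" "D s = 0" by blast
          have len: "\<bar>t - s\<bar> \<le> 1 / 2 ^ n" if "t \<in> J n k" for t
            using that s(1) by (auto simp: J_def cell_eq field_simps abs_le_iff)
          have Jab: "t \<in> {a..b}" if "t \<in> J n k" for t using that ab by (auto simp: J_def)
          have Dle: "\<bar>D t\<bar> \<le> \<eta>" if "t \<in> J n k" for t
            using d(2)[OF Jab[OF that] Jab[OF s(1)]] len[OF that] pn s(2) by auto
          have yle: "\<bar>y t - y s\<bar> \<le> \<eta> * (1 / 2 ^ n)" if t: "t \<in> J n k" for t
          proof -
            have "norm (y t - y s) \<le> \<eta> * norm (t - s)"
            proof (rule field_differentiable_bound[of "J n k" y D])
              show "convex (J n k)" using Ji by (simp add: is_interval_convex)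
              show "norm (D z) \<le> \<eta>" if "z \<in> J n k" for z using Dle[OF that] by simp
            qed (use t s(1) y in \<open>auto intro: has_field_derivative_at_within\<close>)
            also have "\<dots> \<le> \<eta> * (1 / 2 ^ n)" using len[OF t] \<eta> by (intro mult_left_mono) auto
            finally show ?thesis by simp
          qed
          have 1: "\<bar>LINT x:y ` J n k|lborel. g x\<bar> \<le> L * ((y s + \<eta> * (1 / 2 ^ n)) - (y s - \<eta> * (1 / 2 ^ n)))"
          proof (rule set_integral_abs_le(2)[OF yJb _ _ _ gK L0])
            show "y ` J n k \<subseteq> {y s - \<eta> * (1 / 2 ^ n)..y s + \<eta> * (1 / 2 ^ n)}"
              using yle by (auto simp: abs_le_iff algebra_simps)
          qed (use \<eta> in auto)
          have 2: "\<bar>LINT t:J n k|lborel. g (y t) * \<bar>D t\<bar>\<bar> \<le> (L * \<eta>) * ((of_int k + 1) / 2 ^ n - of_int k / 2 ^ n)"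
            using Dle gK L0 \<eta>
            by (intro set_integral_abs_le(2)) (auto simp: J_def cell_eq abs_mult divide_right_mono intro!: mult_mono)
          have e: "(L * \<eta>) * ((of_int k + 1) / 2 ^ n - of_int k / 2 ^ n) = L * \<eta> / 2 ^ n"
            "L * ((y s + \<eta> * (1 / 2 ^ n)) - (y s - \<eta> * (1 / 2 ^ n))) = 2 * (L * \<eta> / 2 ^ n)"
            "3 * L * \<eta> / 2 ^ n = 3 * (L * \<eta> / 2 ^ n)"
            by (simp_all add: diff_divide_distrib[symmetric])
          show ?thesis using 1 2 unfolding e abs_le_iff by linarith
        qed
        have "\<bar>(\<integral>x. g x * N n x \<partial>lborel) - (LINT t:I|lborel. g (y t) * \<bar>D t\<bar>)\<bar> \<le>
          (\<Sum>k\<in>idx n. \<bar>(LINT x:y ` J n k|lborel. g x) - (LINT t:J n k|lborel. g (y t) * \<bar>D t\<bar>)\<bar>)"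
          unfolding RN RI[of n] sum_subtractf[symmetric] by (rule sum_abs)
        also have "\<dots> \<le> (\<Sum>k\<in>idx n. 3 * L * \<eta> / 2 ^ n)" by (intro sum_mono loc)
        also have "\<dots> = real (card (idx n)) * (3 * L * \<eta> / 2 ^ n)" by simp
        \<comment> \<open>At most \<open>2 ^ n * (b - a) + 2\<close> cells are listed, as both ends
          may be cut off inside a cell.\<close>
        also have "\<dots> \<le> (2 ^ n * (b - a + 2)) * (3 * L * \<eta> / 2 ^ n)"
        proof (rule mult_right_mono)
          have "(2::real) ^ n * a \<le> 2 ^ n * b" using ab(2) by simp
          then have "real (card (idx n)) = real_of_int \<lfloor>2 ^ n * b\<rfloor> - real_of_int \<lfloor>2 ^ n * a\<rfloor> + 1"
            using floor_mono[of "2 ^ n * a" "2 ^ n * b"] by (simp add: idx_def)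
          also have "\<dots> \<le> 2 ^ n * b - 2 ^ n * a + 2" by linarith
          also have "\<dots> \<le> 2 ^ n * b - 2 ^ n * a + 2 ^ n * 2" by simp
          also have "\<dots> = 2 ^ n * (b - a + 2)" by (simp add: algebra_simps)
          finally show "real (card (idx n)) \<le> 2 ^ n * (b - a + 2)" .
        qed (use L0 \<eta> in auto)
        also have "\<dots> = 3 * L * (b - a + 2) * \<eta>" by simp
        also have "\<dots> < (3 * L * (b - a + 2) + 1) * \<eta>" using \<eta> by (simp add: distrib_right)
        also have "\<dots> = r" using den by (simp add: \<eta>_def)
        finally show ?thesis .
      qed
      then show "\<exists>no. \<forall>n\<ge>no. norm ((\<integral>x. g x * N n x \<partial>lborel) - (LINT t:I|lborel. g (y t) * \<bar>D t\<bar>)) < r"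
        by auto
    qed
  qed
  define C where "C x = crossings y x I" for x
  have Cm [measurable]: "C \<in> borel_measurable borel"
    unfolding C_def cross[symmetric, abs_def] by measurable
  \<comment> \<open>Monotone convergence with \<open>g = 1\<close>: the total number of crossings
    integrates to the length of the curve, which is finite.\<close>
  have "(\<integral>\<^sup>+x. C x \<partial>lborel) = (SUP n. \<integral>\<^sup>+x. ennreal (N n x) \<partial>lborel)"
    unfolding C_def cross[symmetric]
    by (intro nn_integral_monotone_convergence_SUP) (auto simp: incseq_def le_fun_def intro!: ennreal_leI Nmono)
  also have "\<dots> = (SUP n. ennreal (\<integral>x. 1 * N n x \<partial>lborel))"
    using R(1)[of "\<lambda>_. 1" 1] by (intro SUP_cong refl) (simp add: nn_integral_eq_integral N_def)
  also have "\<dots> = ennreal (LINT t:I|lborel. 1 * \<bar>D t\<bar>)"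
  proof (rule LIMSEQ_unique)
    show "(\<lambda>n. ennreal (\<integral>x. 1 * N n x \<partial>lborel)) \<longlonglongrightarrow> (SUP n. ennreal (\<integral>x. 1 * N n x \<partial>lborel))"
      using R(1)[of "\<lambda>_. 1" 1]
      by (intro LIMSEQ_SUP) (auto simp: incseq_def intro!: ennreal_leI integral_mono Nmono)
    show "(\<lambda>n. ennreal (\<integral>x. 1 * N n x \<partial>lborel)) \<longlonglongrightarrow> ennreal (LINT t:I|lborel. 1 * \<bar>D t\<bar>)"
      using R(2)[of "\<lambda>_. 1" 1] by (intro tendsto_ennrealI) auto
  qed
  finally have Cfin: "(\<integral>\<^sup>+x. C x \<partial>lborel) < \<infinity>" by (simp add: less_top)
  show AE: "AE x in lborel. crossings y x I < \<infinity>"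
  proof -
    have "AE x in lborel. C x \<noteq> \<infinity>"
      by (rule nn_integral_PInf_AE) (use Cfin in auto)
    then show ?thesis by (simp add: C_def less_top)
  qed
  have Ci: "integrable lborel (\<lambda>x. enn2real (C x))"
  proof (rule integrableI_bounded)
    have "(\<integral>\<^sup>+x. ennreal (norm (enn2real (C x))) \<partial>lborel) \<le> (\<integral>\<^sup>+x. C x \<partial>lborel)"
      by (intro nn_integral_mono) (simp add: ennreal_enn2real_if)
    then show "(\<integral>\<^sup>+x. ennreal (norm (enn2real (C x))) \<partial>lborel) < \<infinity>" using Cfin by order
  qed measurable
  have lim: "(\<lambda>n. N n x) \<longlonglongrightarrow> enn2real (C x)" "N n x \<le> enn2real (C x)" if "C x < \<infinity>" for x n
  proof -
    have "(\<lambda>n. ennreal (N n x)) \<longlonglongrightarrow> C x"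
      unfolding C_def cross[symmetric] by (intro LIMSEQ_SUP) (auto simp: incseq_def intro!: ennreal_leI Nmono)
    then have "(\<lambda>n. enn2real (ennreal (N n x))) \<longlonglongrightarrow> enn2real (C x)"
      using that by (intro tendsto_enn2real) auto
    then show "(\<lambda>n. N n x) \<longlonglongrightarrow> enn2real (C x)" by (simp add: N_def)
    have "ennreal (N n x) \<le> C x" unfolding C_def cross[symmetric] by (intro SUP_upper) auto
    then have "enn2real (ennreal (N n x)) \<le> enn2real (C x)" using that by (intro enn2real_mono) auto
    then show "N n x \<le> enn2real (C x)" by (simp add: N_def)
  qed
  have dom: "AE x in lborel. (\<lambda>n. f x * N n x) \<longlonglongrightarrow> f x * enn2real (C x)"
    using AE unfolding C_def[symmetric] by (auto elim!: eventually_mono intro!: tendsto_mult_left lim)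
  have dom': "AE x in lborel. norm (f x * N n x) \<le> K * enn2real (C x)" for n
    using AE unfolding C_def[symmetric]
  proof eventually_elim
    case (elim x)
    have "\<bar>f x\<bar> * \<bar>N n x\<bar> \<le> K * enn2real (C x)"
      using lim(2)[OF elim, of n] fK K0 by (intro mult_mono) (auto simp: N_def)
    then show ?case by (simp add: abs_mult)
  qed
  show "integrable lborel (\<lambda>x. f x * enn2real (crossings y x I))"
    unfolding C_def[symmetric] using Ci
    by (intro integrable_dominated_convergence[where w = "\<lambda>x. K * enn2real (C x)", OF _ _ _ dom dom']) auto
  have "(\<lambda>n. \<integral>x. f x * N n x \<partial>lborel) \<longlonglongrightarrow> (\<integral>x. f x * enn2real (C x) \<partial>lborel)"
    using Ci by (intro integral_dominated_convergence[where w = "\<lambda>x. K * enn2real (C x)", OF _ _ _ dom dom']) auto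
  then show "(\<integral>x. f x * enn2real (crossings y x I) \<partial>lborel) = (LINT t:I|lborel. f (y t) * \<bar>D t\<bar>)"
    using R(2)[OF f fK] unfolding C_def by (rule LIMSEQ_unique)
qed

subsection \<open>Hoelder continuity from dyadic increments\<close>

text \<open>Kolmogorov chaining. Each time is reached from its dyadic approximation at level
  \<open>n\<close> at the cost of a geometric tail, and the two approximations are equal or
  neighbours. This explains the constant: one neighbour step, two tails with sum
  \<open>2 / (1 - 2 powr (- \<gamma>))\<close>, and \<open>2 powr \<gamma>\<close> for rounding the
  distance to a power of two.\<close>

lemma dyadic_increments_imp_holder:
  fixes x :: "real \<Rightarrow> real" and T n0 :: nat
  assumes x: "continuous_on {0..} x" and \<gamma>: "0 < \<gamma>"
    and inc: "\<And>n k. n0 \<le> n \<Longrightarrow> k < T * 2 ^ n \<Longrightarrow>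
      \<bar>x (real (Suc k) / 2 ^ n) - x (real k / 2 ^ n)\<bar> \<le> (2 powr (- \<gamma>)) ^ n"
    and st: "s \<in> {0..<real T}" "t \<in> {0..<real T}" "\<bar>s - t\<bar> \<le> (1 / 2) ^ n0"
  shows "\<bar>x s - x t\<bar> \<le> 2 powr \<gamma> * (1 + 2 / (1 - 2 powr (- \<gamma>))) * \<bar>s - t\<bar> powr \<gamma>"
proof -
  define q where "q = 2 powr (- \<gamma>)"
  have q: "0 < q" "q < 1" unfolding q_def using \<gamma> by (auto intro!: powr_less_one)
  define d where "d m r = nat \<lfloor>2 ^ m * r\<rfloor>" for m and r :: real
  have d_real: "real (d m r) = real_of_int \<lfloor>2 ^ m * r\<rfloor>" if "0 \<le> r" for m r
    using that by (simp add: d_def)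
  have d_bound: "d m r < T * 2 ^ m" if "r \<in> {0..<real T}" for m r
  proof -
    have "real (d m r) \<le> 2 ^ m * r" using that d_real[of r m] by simp
    also have "\<dots> < 2 ^ m * real T" using that by simp
    also have "\<dots> = real (T * 2 ^ m)" by simp
    finally show ?thesis by (simp only: of_nat_less_iff)
  qed
  have step: "\<bar>x (real (d (Suc m) r) / 2 ^ Suc m) - x (real (d m r) / 2 ^ m)\<bar> \<le> q ^ Suc m"
    if m: "n0 \<le> m" and r: "r \<in> {0..<real T}" for m r
  proof -
    define e where "e = 2 * d m r"
    have r0: "0 \<le> r" using r by simp
    have eq: "real (d m r) / 2 ^ m = real e / 2 ^ Suc m" by (simp add: e_def)
    have "real e \<le> 2 ^ Suc m * r" "2 ^ Suc m * r < real e + 2"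
      using d_real[OF r0, of m] floor_correct[of "2 ^ m * r"]
      unfolding e_def power_Suc mult.assoc of_nat_mult by linarith+
    then have "int e \<le> \<lfloor>2 ^ Suc m * r\<rfloor>" "\<lfloor>2 ^ Suc m * r\<rfloor> \<le> int e + 1"
      by (simp_all add: le_floor_iff floor_le_iff)
    \<comment> \<open>Refining the level by one either keeps the left dyadic neighbour or moves it
      by one fine step, so at most one increment is spent per level.\<close>
    then have "d (Suc m) r = e \<or> d (Suc m) r = Suc e" unfolding d_def by linarith
    then show ?thesis
    proof
      assume h: "d (Suc m) r = Suc e"
      have "e < T * 2 ^ Suc m" using d_bound[OF r, of "Suc m"] h by linarith
      from inc[OF _ this] m show ?thesis unfolding eq h q_def by simp
    qed (use q in \<open>simp add: eq\<close>)
  qed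
  have tail: "\<bar>x (real (d m r) / 2 ^ m) - x (real (d n r) / 2 ^ n)\<bar> \<le> (q ^ n - q ^ m) / (1 - q)"
    if "n \<le> m" and n: "n0 \<le> n" and r: "r \<in> {0..<real T}" for m n r
    using that(1)
  proof (induction m rule: dec_induct)
    case (step m)
    have "(q ^ n - q ^ Suc m) / (1 - q) = (q ^ n - q ^ m) / (1 - q) + q ^ m"
      using q by (simp add: field_simps)
    moreover have "q ^ Suc m \<le> q ^ m" using q by (intro power_decreasing) auto
    moreover have "\<bar>x (real (d (Suc m) r) / 2 ^ Suc m) - x (real (d m r) / 2 ^ m)\<bar> \<le> q ^ Suc m"
      using step(1) n by (intro \<open>\<And>r m. n0 \<le> m \<Longrightarrow> r \<in> {0..<real T} \<Longrightarrow> _ \<le> q ^ Suc m\<close> r) auto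
    ultimately show ?case using step.IH by linarith
  qed simp
  have approx: "\<bar>x r - x (real (d n r) / 2 ^ n)\<bar> \<le> q ^ n / (1 - q)"
    if n: "n0 \<le> n" and r: "r \<in> {0..<real T}" for n r
  proof (rule LIMSEQ_le_const2)
    have r0: "0 \<le> r" using r by simp
    have "(\<lambda>m. real (d m r) / 2 ^ m) \<longlonglongrightarrow> r"
    proof (rule tendsto_sandwich)
      show "\<forall>\<^sub>F m in sequentially. r - (1 / 2) ^ m \<le> real (d m r) / 2 ^ m"
        unfolding d_real[OF r0] using floor_div_ge[of "2 ^ _" r]
        by (intro always_eventually allI) (simp add: power_one_over)
      show "\<forall>\<^sub>F m in sequentially. real (d m r) / 2 ^ m \<le> r"
        unfolding d_real[OF r0] by (intro always_eventually allI floor_div_le) simp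
      have "(\<lambda>m. r - (1 / 2) ^ m) \<longlonglongrightarrow> r - 0"
        by (intro tendsto_diff tendsto_const LIMSEQ_realpow_zero) auto
      then show "(\<lambda>m. r - (1 / 2) ^ m) \<longlonglongrightarrow> r" by simp
    qed (rule tendsto_const)
    then have "(\<lambda>m. x (real (d m r) / 2 ^ m)) \<longlonglongrightarrow> x r"
      by (intro continuous_on_tendsto_compose[OF x]) (use r0 in auto)
    then show "(\<lambda>m. \<bar>x (real (d m r) / 2 ^ m) - x (real (d n r) / 2 ^ n)\<bar>) \<longlonglongrightarrow> \<bar>x r - x (real (d n r) / 2 ^ n)\<bar>"
      by (intro tendsto_intros)
    show "\<exists>N. \<forall>m\<ge>N. \<bar>x (real (d m r) / 2 ^ m) - x (real (d n r) / 2 ^ n)\<bar> \<le> q ^ n / (1 - q)"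
    proof (intro exI allI impI)
      fix m assume "n \<le> m"
      have "(q ^ n - q ^ m) / (1 - q) \<le> q ^ n / (1 - q)" using q by (intro divide_right_mono) auto
      with tail[OF \<open>n \<le> m\<close> n r]
      show "\<bar>x (real (d m r) / 2 ^ m) - x (real (d n r) / 2 ^ n)\<bar> \<le> q ^ n / (1 - q)" by linarith
    qed
  qed
  have main: "\<bar>x s - x t\<bar> \<le> 2 powr \<gamma> * (1 + 2 / (1 - q)) * \<bar>s - t\<bar> powr \<gamma>"
    if "s < t" "s \<in> {0..<real T}" "t \<in> {0..<real T}" "\<bar>s - t\<bar> \<le> (1 / 2) ^ n0" for s t
  proof -
    \<comment> \<open>The first dyadic scale below the distance; its predecessor \<open>n\<close>
      satisfies \<open>(1 / 2) ^ Suc n < \<bar>s - t\<bar>\<close> and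
      \<open>\<bar>s - t\<bar> \<le> (1 / 2) ^ n\<close>, and the hypothesis on the distance forces
      \<open>n0 \<le> n\<close>.\<close>
    define N where "N = (LEAST N. (1 / 2 :: real) ^ N < \<bar>s - t\<bar>)"
    have "\<exists>N. (1 / 2 :: real) ^ N < \<bar>s - t\<bar>" using that(1) by (intro real_arch_pow_inv) auto
    then have N: "(1 / 2) ^ N < \<bar>s - t\<bar>" unfolding N_def by (rule LeastI_ex)
    have "n0 < N"
    proof (rule ccontr)
      assume "\<not> n0 < N"
      then have "(1 / 2 :: real) ^ n0 \<le> (1 / 2) ^ N" by (intro power_decreasing) auto
      then show False using N that(4) by linarith
    qed
    then obtain n where n: "N = Suc n" "n0 \<le> n" by (metis Suc_leI less_Suc_eq_le not0_implies_Suc not_less0)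
    have le: "\<bar>s - t\<bar> \<le> (1 / 2) ^ n"
      using not_less_Least[of n "\<lambda>N. (1 / 2 :: real) ^ N < \<bar>s - t\<bar>"] n(1) unfolding N_def by linarith
    have s0: "0 \<le> s" "0 \<le> t" using that by auto
    have "2 ^ n * (t - s) \<le> 2 ^ n * (1 / 2) ^ n" using le that(1) by (intro mult_left_mono) auto
    then have ts: "2 ^ n * t \<le> 2 ^ n * s + 1" by (simp add: right_diff_distrib power_one_over)
    have "\<lfloor>2 ^ n * s\<rfloor> \<le> \<lfloor>2 ^ n * t\<rfloor>" using that(1) by (intro floor_mono) auto
    moreover have "\<lfloor>2 ^ n * t\<rfloor> \<le> \<lfloor>2 ^ n * s\<rfloor> + 1" using floor_mono[OF ts] by simp
    moreover have "0 \<le> \<lfloor>2 ^ n * s\<rfloor>" using s0 by simp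
    ultimately have "d n t = d n s \<or> d n t = Suc (d n s)" unfolding d_def by linarith
    then have mid: "\<bar>x (real (d n t) / 2 ^ n) - x (real (d n s) / 2 ^ n)\<bar> \<le> q ^ n"
      using inc[OF n(2) d_bound[OF that(2)]] q by (auto simp: q_def)
    have "\<bar>x s - x t\<bar> \<le> q ^ n / (1 - q) + q ^ n / (1 - q) + q ^ n"
      using approx[OF n(2) that(2)] approx[OF n(2) that(3)] mid by linarith
    also have "\<dots> = (1 + 2 / (1 - q)) * q ^ n" by (simp add: distrib_right)
    also have "\<dots> \<le> (1 + 2 / (1 - q)) * (2 powr \<gamma> * \<bar>s - t\<bar> powr \<gamma>)"
    proof (rule mult_left_mono)
      have "q ^ n = ((1 / 2) ^ n) powr \<gamma>"
        by (simp add: q_def powr_minus_divide powr_power powr_powr flip: powr_realpow add: powr_divide power_one_over powr_mult mult.commute)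
      also have "\<dots> \<le> (2 * \<bar>s - t\<bar>) powr \<gamma>"
        using N \<gamma> n(1) by (intro powr_mono2) auto
      also have "\<dots> = 2 powr \<gamma> * \<bar>s - t\<bar> powr \<gamma>" by (simp add: powr_mult)
      finally show "q ^ n \<le> 2 powr \<gamma> * \<bar>s - t\<bar> powr \<gamma>" .
    qed (use q in auto)
    finally show ?thesis by (simp add: mult_ac)
  qed
  show ?thesis
    using main[of s t] main[of t s] st
    by (cases s t rule: linorder_cases) (auto simp: q_def abs_minus_commute)
qed

subsection \<open>Absolute continuity of the occupation measure\<close>

text \<open>The occupation measure of an open set is controlled through the moving averages
  \<open>\<mu>[z, z + \<delta>] / \<delta>\<close>, whose square integral is at most the proportion of pairs of times at which
  the path values are \<open>\<delta>\<close>-close.\<close>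

lemma occupation_moving_average_le:
  fixes x :: "real \<Rightarrow> real" and l :: real
  assumes [measurable]: "x \<in> borel_measurable borel" "I \<in> sets borel" "U \<in> sets borel"
    and \<delta>: "0 < \<delta>" and l: "0 < l"
  shows "(\<integral>\<^sup>+t\<in>I. (\<integral>\<^sup>+z. indicator U z * indicator {z..z + \<delta>} (x t) \<partial>lborel) / \<delta> \<partial>lborel)
    \<le> emeasure lborel U / l + l * ((\<integral>\<^sup>+t\<in>I. (\<integral>\<^sup>+s\<in>I. indicator {..\<delta>} \<bar>x t - x s\<bar> \<partial>lborel) \<partial>lborel) / \<delta>)"
proof -
  define m where "m z = (\<integral>\<^sup>+t\<in>I. indicator {z..z + \<delta>} (x t) \<partial>lborel)" for z
  define W where "W = (\<integral>\<^sup>+t\<in>I. (\<integral>\<^sup>+s\<in>I. indicator {..\<delta>} \<bar>x t - x s\<bar> \<partial>lborel) \<partial>lborel)"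
  have [measurable]: "Measurable.pred (borel \<Otimes>\<^sub>M borel) (\<lambda>(t, z). x t \<in> {z..z + \<delta>})"
    by (simp add: case_prod_beta)
  have im [measurable]: "(\<lambda>(t, z). indicator {z..z + \<delta>} (x t) :: ennreal) \<in> borel_measurable (borel \<Otimes>\<^sub>M borel)"
  proof -
    have "(\<lambda>(t, z). indicator {z..z + \<delta>} (x t) :: ennreal) = (\<lambda>p. if snd p \<le> x (fst p) \<and> x (fst p) \<le> snd p + \<delta> then 1 else 0)"
      by (auto simp: indicator_def fun_eq_iff)
    then show ?thesis by simp
  qed
  have mm [measurable]: "m \<in> borel_measurable borel"
    unfolding m_def indicator_def by measurable
  have 1: "(\<integral>\<^sup>+t\<in>I. (\<integral>\<^sup>+z. indicator U z * indicator {z..z + \<delta>} (x t) \<partial>lborel) / \<delta> \<partial>lborel)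
    = (\<integral>\<^sup>+z. indicator U z * (m z / ennreal \<delta>) \<partial>lborel)"
  proof -
    have ieq: "indicator {z..z + \<delta>} (x t) = (of_bool (z \<le> x t \<and> x t \<le> z + \<delta>) :: ennreal)" for t z
      by (auto simp: indicator_def)
    have "(\<lambda>z. indicator U z * indicator {z..z + \<delta>} (x t) :: ennreal) \<in> borel_measurable (lborel :: real measure)" for t
      unfolding ieq by measurable
    note gm = this
    have "(\<integral>\<^sup>+t\<in>I. (\<integral>\<^sup>+z. indicator U z * indicator {z..z + \<delta>} (x t) \<partial>lborel) / \<delta> \<partial>lborel)
      = (\<integral>\<^sup>+t. (\<integral>\<^sup>+z. indicator U z * indicator {z..z + \<delta>} (x t) * indicator I t / ennreal \<delta> \<partial>lborel) \<partial>lborel)"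
    proof (intro nn_integral_cong)
      fix t
      have "(\<integral>\<^sup>+z. indicator U z * indicator {z..z + \<delta>} (x t) * indicator I t / ennreal \<delta> \<partial>lborel) =
        (\<integral>\<^sup>+z. indicator U z * indicator {z..z + \<delta>} (x t) * indicator I t \<partial>lborel) / ennreal \<delta>"
        by (intro nn_integral_divide borel_measurable_times gm) simp
      also have "\<dots> = (\<integral>\<^sup>+z. indicator U z * indicator {z..z + \<delta>} (x t) \<partial>lborel) * indicator I t / ennreal \<delta>"
        by (simp only: nn_integral_multc[OF gm])
      finally show "(\<integral>\<^sup>+z. indicator U z * indicator {z..z + \<delta>} (x t) \<partial>lborel) / \<delta> * indicator I t =
        (\<integral>\<^sup>+z. indicator U z * indicator {z..z + \<delta>} (x t) * indicator I t / ennreal \<delta> \<partial>lborel)"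
        by (simp add: divide_ennreal_def mult_ac)
    qed
    also have "\<dots> = (\<integral>\<^sup>+z. (\<integral>\<^sup>+t. indicator U z * indicator {z..z + \<delta>} (x t) * indicator I t / ennreal \<delta> \<partial>lborel) \<partial>lborel)"
      unfolding indicator_def by (intro lborel_pair.Fubini') measurable
    also have "\<dots> = (\<integral>\<^sup>+z. indicator U z * (m z / ennreal \<delta>) \<partial>lborel)"
      unfolding m_def indicator_def
      by (intro nn_integral_cong) (simp add: nn_integral_divide nn_integral_cmult divide_ennreal_def mult_ac)
    finally show ?thesis .
  qed
  \<comment> \<open>The square of \<open>m z\<close> is an integral over pairs of times. A window of
    length \<open>\<delta>\<close> contains both path values only if they are
    \<open>\<delta>\<close>-close, and then its left end \<open>z\<close> ranges over a set of
    measure at most \<open>\<delta>\<close>.\<close>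
  have 2: "(\<integral>\<^sup>+z. m z * m z \<partial>lborel) \<le> \<delta> * W"
  proof -
    have "(\<integral>\<^sup>+z. m z * m z \<partial>lborel) =
      (\<integral>\<^sup>+z. (\<integral>\<^sup>+t. (\<integral>\<^sup>+s. indicator {z..z + \<delta>} (x t) * indicator I t * (indicator {z..z + \<delta>} (x s) * indicator I s) \<partial>lborel) \<partial>lborel) \<partial>lborel)"
    proof (intro nn_integral_cong)
      fix z
      define g :: "real \<Rightarrow> ennreal" where "g t = indicator {z..z + \<delta>} (x t) * indicator I t" for t
      have gm: "g \<in> borel_measurable lborel" unfolding g_def indicator_def by measurable
      have "(\<integral>\<^sup>+t. (\<integral>\<^sup>+s. g t * g s \<partial>lborel) \<partial>lborel) = m z * m z"
        unfolding nn_integral_cmult[OF gm] nn_integral_multc[OF gm] by (simp add: m_def g_def[abs_def])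
      then show "m z * m z = (\<integral>\<^sup>+t. (\<integral>\<^sup>+s. indicator {z..z + \<delta>} (x t) * indicator I t *
          (indicator {z..z + \<delta>} (x s) * indicator I s) \<partial>lborel) \<partial>lborel)"
        by (simp only: g_def)
    qed
    also have "\<dots> = (\<integral>\<^sup>+t. (\<integral>\<^sup>+z. (\<integral>\<^sup>+s. indicator {z..z + \<delta>} (x t) * indicator I t * (indicator {z..z + \<delta>} (x s) * indicator I s) \<partial>lborel) \<partial>lborel) \<partial>lborel)"
      unfolding indicator_def by (rule lborel_pair.Fubini') measurable
    also have "\<dots> = (\<integral>\<^sup>+t. (\<integral>\<^sup>+s. (\<integral>\<^sup>+z. indicator {z..z + \<delta>} (x t) * indicator I t * (indicator {z..z + \<delta>} (x s) * indicator I s) \<partial>lborel) \<partial>lborel) \<partial>lborel)"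
      unfolding indicator_def by (rule nn_integral_cong, rule lborel_pair.Fubini') measurable
    also have "\<dots> \<le> (\<integral>\<^sup>+t. (\<integral>\<^sup>+s. ennreal \<delta> * (indicator {..\<delta>} \<bar>x t - x s\<bar> * indicator I s * indicator I t) \<partial>lborel) \<partial>lborel)"
    proof (intro nn_integral_mono)
      fix t s :: real
      have "(\<integral>\<^sup>+z. indicator {z..z + \<delta>} (x t) * indicator I t * (indicator {z..z + \<delta>} (x s) * indicator I s) \<partial>lborel)
        \<le> (\<integral>\<^sup>+z. indicator {..\<delta>} \<bar>x t - x s\<bar> * indicator I s * indicator I t * indicator {x t - \<delta>..x t} z \<partial>lborel)"
        by (intro nn_integral_mono) (auto simp: indicator_def)
      also have "\<dots> = ennreal \<delta> * (indicator {..\<delta>} \<bar>x t - x s\<bar> * indicator I s * indicator I t)"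
        using \<delta> by (subst nn_integral_cmult_indicator) (auto simp: mult.commute)
      finally show "(\<integral>\<^sup>+z. indicator {z..z + \<delta>} (x t) * indicator I t * (indicator {z..z + \<delta>} (x s) * indicator I s) \<partial>lborel)
        \<le> ennreal \<delta> * (indicator {..\<delta>} \<bar>x t - x s\<bar> * indicator I s * indicator I t)" .
    qed
    also have "\<dots> = \<delta> * W"
      unfolding W_def by (simp add: nn_integral_cmult nn_integral_multc)
    finally show ?thesis .
  qed
  have "(\<integral>\<^sup>+z. indicator U z * (m z / ennreal \<delta>) \<partial>lborel) \<le> (\<integral>\<^sup>+z. indicator U z / ennreal l + ennreal l * (m z * m z / (ennreal \<delta> * ennreal \<delta>)) \<partial>lborel)"
  proof (intro nn_integral_mono)
    fix z
    show "indicator U z * (m z / ennreal \<delta>) \<le> indicator U z / ennreal l + ennreal l * (m z * m z / (ennreal \<delta> * ennreal \<delta>))"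
    proof (cases "m z")
      case (real a)
      have "a / \<delta> \<le> 1 / l + l * (a * a / (\<delta> * \<delta>))"
      proof -
        \<comment> \<open>A weighted arithmetic-geometric mean inequality takes the place of
          Cauchy-Schwarz; the weight \<open>l\<close> stays free and is chosen when the set is
          known.\<close>
        have "2 * c \<le> 1 / l + l * c\<^sup>2" for c
        proof -
          have "0 \<le> (1 - l * c)\<^sup>2 / l" using l by simp
          also have "\<dots> = 1 / l + l * c\<^sup>2 - 2 * c"
            using l by (simp add: power2_eq_square field_simps)
          finally show ?thesis by simp
        qed
        from this[of "a / \<delta>"] have "2 * (a / \<delta>) \<le> 1 / l + l * (a / \<delta>)\<^sup>2" .
        moreover have "0 \<le> a / \<delta>" using real \<delta> by simp
        ultimately show ?thesis by (simp add: power2_eq_square)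
      qed
      then have "ennreal (a / \<delta>) \<le> ennreal (1 / l + l * (a * a / (\<delta> * \<delta>)))" by (rule ennreal_leI)
      also have "\<dots> = 1 / ennreal l + ennreal l * (m z * m z / (ennreal \<delta> * ennreal \<delta>))"
        using real l \<delta> by (simp add: divide_ennreal ennreal_mult[symmetric] ennreal_plus[symmetric] del: ennreal_plus flip: ennreal_1)
      finally show ?thesis
        using real \<delta> by (auto simp: indicator_def divide_ennreal)
    next
      case top
      have "ennreal l * (m z * m z / (ennreal \<delta> * ennreal \<delta>)) = \<infinity>"
        using top l \<delta> by (simp add: ennreal_mult_top ennreal_top_divide ennreal_top_mult flip: ennreal_mult)
      then show ?thesis by simp
    qed
  qed
  also have "\<dots> = emeasure lborel U / ennreal l + ennreal l * ((\<integral>\<^sup>+z. m z * m z \<partial>lborel) / (ennreal \<delta> * ennreal \<delta>))"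
    by (simp add: nn_integral_add nn_integral_divide nn_integral_cmult)
  also have "\<dots> \<le> emeasure lborel U / ennreal l + ennreal l * (ennreal \<delta> * W / (ennreal \<delta> * ennreal \<delta>))"
    using 2 by (intro add_left_mono mult_left_mono) (auto simp: divide_ennreal_def intro!: mult_right_mono)
  also have "\<dots> = emeasure lborel U / l + l * (W / \<delta>)"
  proof -
    have "ennreal \<delta> * W / (ennreal \<delta> * ennreal \<delta>) = W / ennreal \<delta>"
    proof (cases W)
      case (real w)
      then show ?thesis using \<delta> by (simp add: divide_ennreal flip: ennreal_mult)
    next
      case top
      then show ?thesis using \<delta> by (simp add: ennreal_mult_top ennreal_top_divide flip: ennreal_mult)
    qed
    then show ?thesis by simp
  qed
  finally show ?thesis unfolding 1 W_def .
qed

text \<open>For open sets the moving averages give occupation at most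
  \<open>emeasure lborel U / l + l * C\<close> with any \<open>l\<close>; outer regularity then
  passes to null sets. A finite lower limit suffices, because the bound is reached through Fatou's
  lemma.\<close>

lemma occupation_absolutely_continuous:
  fixes x :: "real \<Rightarrow> real"
  assumes xm [measurable]: "x \<in> borel_measurable borel" and I [measurable]: "I \<in> sets borel"
    and \<delta>: "\<And>n. 0 < \<delta> n" "\<delta> \<longlonglongrightarrow> 0"
    and fin: "liminf (\<lambda>n. (\<integral>\<^sup>+t\<in>I. (\<integral>\<^sup>+s\<in>I. indicator {..\<delta> n} \<bar>x t - x s\<bar> \<partial>lborel) \<partial>lborel) / \<delta> n) < \<infinity>"
  shows "absolutely_continuous lborel (occupation_measure x I)"
proof -
  define a where "a n = (\<integral>\<^sup>+t\<in>I. (\<integral>\<^sup>+s\<in>I. indicator {..\<delta> n} \<bar>x t - x s\<bar> \<partial>lborel) \<partial>lborel) / \<delta> n" for n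
  obtain C where C: "liminf a \<le> ennreal C" "0 \<le> C"
  proof -
    have "liminf a < \<infinity>" using fin by (simp only: a_def[abs_def])
    then show ?thesis by (cases "liminf a" rule: ennreal_cases) (auto intro: that)
  qed
  define \<mu> where "\<mu> A = (\<integral>\<^sup>+t\<in>I. indicator A (x t) \<partial>lborel)" for A
  have occ: "emeasure (occupation_measure x I) A = \<mu> A" if "A \<in> sets borel" for A
  proof -
    have "emeasure (occupation_measure x I) A = emeasure (restrict_space lborel I) (x -` A \<inter> I)"
      unfolding occupation_measure_def using that
      by (subst emeasure_distr) (auto simp: measurable_restrict_space1 space_restrict_space)
    also have "\<dots> = emeasure lborel (x -` A \<inter> I)"
      by (intro emeasure_restrict_space) auto
    also have "\<dots> = (\<integral>\<^sup>+t. indicator (x -` A \<inter> I) t \<partial>lborel)"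
      using measurable_sets[OF xm that] by simp
    also have "\<dots> = \<mu> A"
      unfolding \<mu>_def by (intro nn_integral_cong) (auto simp: indicator_def)
    finally show ?thesis .
  qed
  have open_le: "\<mu> U \<le> emeasure lborel U / l + l * C" if U: "open U" and l: "0 < l" for U and l :: real
  proof -
    have [measurable]: "U \<in> sets borel" using U by simp
    define \<phi> where "\<phi> n t = (\<integral>\<^sup>+z. indicator U z * indicator {z..z + \<delta> n} (x t) \<partial>lborel) / \<delta> n" for n t
    \<comment> \<open>If \<open>x t\<close> lies in the open set, all windows of small length
      \<open>\<delta> n\<close> containing \<open>x t\<close> start inside the set, so the moving
      average is eventually at least \<open>1\<close>.\<close>
    have lim: "indicator U (x t) \<le> liminf (\<lambda>n. \<phi> n t)" for t
    proof (cases "x t \<in> U")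
      case True
      then obtain e where e: "0 < e" "\<And>z. \<bar>z - x t\<bar> < e \<Longrightarrow> z \<in> U"
        using U unfolding open_dist dist_real_def by metis
      have "\<forall>\<^sub>F n in sequentially. \<delta> n < e" using \<delta>(2) e(1) by (rule order_tendstoD)
      then have "\<forall>\<^sub>F n in sequentially. 1 \<le> \<phi> n t"
      proof eventually_elim
        case (elim n)
        have "\<phi> n t \<ge> (\<integral>\<^sup>+z. indicator {x t - \<delta> n..x t} z \<partial>lborel) / \<delta> n"
          unfolding \<phi>_def divide_ennreal_def
          using e(2) elim by (intro mult_right_mono nn_integral_mono) (auto simp: indicator_def)
        then show ?case using \<delta>(1)[of n] by (simp add: divide_ennreal)
      qed
      then show ?thesis using True by (intro Liminf_bounded) auto
    qed simp
    have [measurable]: "\<phi> n \<in> borel_measurable borel" for n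
    proof -
      have ieq: "indicator {z..z + \<delta> n} (x t) = (of_bool (z \<le> x t \<and> x t \<le> z + \<delta> n) :: ennreal)" for t z
        by (auto simp: indicator_def)
      show ?thesis unfolding \<phi>_def ieq by measurable
    qed
    have "\<mu> U \<le> (\<integral>\<^sup>+t. liminf (\<lambda>n. \<phi> n t * indicator I t) \<partial>lborel)"
      unfolding \<mu>_def using lim by (intro nn_integral_mono) (auto simp: indicator_def)
    also have "\<dots> \<le> liminf (\<lambda>n. \<integral>\<^sup>+t\<in>I. \<phi> n t \<partial>lborel)"
      by (intro nn_integral_liminf) measurable
    also have "\<dots> \<le> liminf (\<lambda>n. emeasure lborel U / l + l * a n)"
      unfolding \<phi>_def a_def
      by (intro Liminf_mono always_eventually allI occupation_moving_average_le \<delta> l) measurable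
    also have "\<dots> = emeasure lborel U / l + l * liminf a"
    proof -
      have "mono (\<lambda>r. emeasure lborel U / l + ennreal l * r)"
        by (intro monoI add_left_mono mult_left_mono) auto
      moreover have "continuous_on UNIV (\<lambda>r. emeasure lborel U / l + ennreal l * r)"
        by (intro continuous_on_add_ennreal continuous_on_const ennreal_continuous_on_cmult ) (simp_all add: continuous_on_id l)
      ultimately show ?thesis
        using Liminf_compose_continuous_mono[of "\<lambda>r. emeasure lborel U / l + ennreal l * r" sequentially a] by simp
    qed
    also have "\<dots> \<le> emeasure lborel U / l + l * C"
      using C l by (auto simp: ennreal_mult intro!: add_left_mono mult_left_mono)
    finally show ?thesis .
  qed
  show ?thesis
    unfolding absolutely_continuous_def
  proof
    fix A assume A: "A \<in> null_sets (lborel :: real measure)"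
    have Ab: "A \<in> sets borel" using A by auto
    have eps: "\<mu> A \<le> ennreal e" if e: "0 < e" for e
    proof -
      \<comment> \<open>With an open set of measure below \<open>l * l\<close> the bound becomes
        \<open>l + l * C\<close>, which is exactly \<open>e\<close>.\<close>
      define l where "l = e / (1 + C)"
      have l: "0 < l" using e C(2) by (simp add: l_def)
      obtain U where U: "open U" "A \<subseteq> U" "emeasure lborel (U - A) < ennreal (l * l)"
        using outer_regular_lborel[OF Ab, of "l * l"] l by auto
      have "emeasure lborel U = emeasure lborel (U - A)"
        using A U by (subst emeasure_Diff_null_set) auto
      then have UU: "emeasure lborel U \<le> ennreal (l * l)" using U(3) by simp
      have "\<mu> A \<le> \<mu> U" unfolding \<mu>_def using U(2) by (intro nn_integral_mono) (auto simp: indicator_def)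
      also have "\<dots> \<le> emeasure lborel U / l + l * C" by (rule open_le[OF U(1) l])
      also have "\<dots> \<le> ennreal (l * l) / l + l * C"
        using UU by (intro add_right_mono) (auto simp: divide_ennreal_def intro!: mult_right_mono)
      also have "\<dots> = ennreal (l + l * C)" using l C(2) by (simp add: divide_ennreal ennreal_plus[symmetric] del: ennreal_plus)
      also have "l + l * C = l * (1 + C)" by (simp add: distrib_left)
      also have "\<dots> = e" using C(2) by (simp add: l_def)
      finally show ?thesis .
    qed
    have "\<mu> A \<le> 0"
    proof (rule ennreal_le_epsilon)
      fix e :: real assume "0 < e"
      from eps[OF this] show "\<mu> A \<le> 0 + ennreal e" by (simp only: add_0)
    qed
    then have "emeasure (occupation_measure x I) A = 0" unfolding occ[OF Ab] by simp
    moreover have "A \<in> sets (occupation_measure x I)" using Ab by (simp add: occupation_measure_def)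
    ultimately show "A \<in> null_sets (occupation_measure x I)" by (rule null_setsI)
  qed
qed

subsection \<open>Absolute moments from characteristic functions\<close>

lemma one_minus_cos_le: "1 - cos x \<le> x\<^sup>2 / 2" for x :: real
proof -
  have "1 - cos x = 2 * (sin (x / 2))\<^sup>2" using cos_double_sin[of "x / 2"] by simp
  also have "\<dots> \<le> 2 * (x / 2)\<^sup>2"
    using abs_sin_x_le_abs_x[of "x / 2"] by (intro mult_left_mono) (auto simp: abs_le_square_iff[symmetric])
  finally show ?thesis by (simp add: power2_eq_square)
qed

text \<open>The absolute value is a mixture of the functions \<open>1 - cos (\<theta> x)\<close>. This reduces absolute
  moments, including the mixed ones, to one-dimensional characteristic functions.\<close>

definition kap :: ennreal where "kap = (\<integral>\<^sup>+\<theta>. ennreal ((1 - cos \<theta>) / \<theta>\<^sup>2) \<partial>lborel)"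

lemma kap_abs: "(\<integral>\<^sup>+\<theta>. ennreal ((1 - cos (\<theta> * x)) / \<theta>\<^sup>2) \<partial>lborel) = kap * ennreal \<bar>x\<bar>"
proof (cases "x = 0")
  case False
  have "kap = ennreal \<bar>x\<bar> * (\<integral>\<^sup>+\<theta>. ennreal ((1 - cos (0 + x * \<theta>)) / (0 + x * \<theta>)\<^sup>2) \<partial>lborel)"
    unfolding kap_def using False by (intro nn_integral_real_affine) auto
  then have "kap * ennreal \<bar>x\<bar> = (ennreal \<bar>x\<bar> * ennreal \<bar>x\<bar>) * (\<integral>\<^sup>+\<theta>. ennreal ((1 - cos (0 + x * \<theta>)) / (0 + x * \<theta>)\<^sup>2) \<partial>lborel)"
    by (simp only: mult_ac)
  also have "ennreal \<bar>x\<bar> * ennreal \<bar>x\<bar> = ennreal (x\<^sup>2)"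
    by (simp add: power2_eq_square flip: ennreal_mult)
  also have "ennreal (x\<^sup>2) * (\<integral>\<^sup>+\<theta>. ennreal ((1 - cos (0 + x * \<theta>)) / (0 + x * \<theta>)\<^sup>2) \<partial>lborel)
    = (\<integral>\<^sup>+\<theta>. ennreal (x\<^sup>2) * ennreal ((1 - cos (0 + x * \<theta>)) / (0 + x * \<theta>)\<^sup>2) \<partial>lborel)"
    by (rule nn_integral_cmult[symmetric]) measurable
  also have "\<dots> = (\<integral>\<^sup>+\<theta>. ennreal ((1 - cos (\<theta> * x)) / \<theta>\<^sup>2) \<partial>lborel)"
    using False by (intro nn_integral_cong) (simp add: power_mult_distrib mult.commute flip: ennreal_mult)
  finally show ?thesis by simp
qed simp

lemma kap_finite: "kap < \<infinity>"
proof -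
  have "set_integrable lborel UNIV (\<lambda>x::real. inverse (1 + x\<^sup>2))"
    using integrable_inverse_1_plus_square by simp
  then have i: "integrable lborel (\<lambda>x::real. 4 * inverse (1 + x\<^sup>2))"
    by (simp add: set_integrable_def)
  have "(1 - cos \<theta>) / \<theta>\<^sup>2 \<le> 4 * inverse (1 + \<theta>\<^sup>2)" for \<theta> :: real
  proof (cases "\<theta> = 0")
    case False
    then have p: "0 < \<theta>\<^sup>2" by simp
    have "(1 - cos \<theta>) * (1 + \<theta>\<^sup>2) \<le> 4 * \<theta>\<^sup>2"
    proof -
      have "(1 - cos \<theta>) * (1 + \<theta>\<^sup>2) = (1 - cos \<theta>) + (1 - cos \<theta>) * \<theta>\<^sup>2" by (simp add: algebra_simps)
      also have "\<dots> \<le> \<theta>\<^sup>2 / 2 + 2 * \<theta>\<^sup>2"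
        using one_minus_cos_le[of \<theta>] cos_ge_minus_one[of \<theta>] by (intro add_mono mult_right_mono) auto
      also have "\<dots> \<le> 4 * \<theta>\<^sup>2" using p by simp
      finally show ?thesis .
    qed
    then show ?thesis using p by (simp add: field_simps add_pos_pos)
  qed simp
  then have "kap \<le> (\<integral>\<^sup>+\<theta>. ennreal (4 * inverse (1 + \<theta>\<^sup>2)) \<partial>lborel)"
    unfolding kap_def by (intro nn_integral_mono ennreal_leI)
  also have "\<dots> = ennreal (\<integral>\<theta>. 4 * inverse (1 + \<theta>\<^sup>2) \<partial>lborel)"
    using i by (intro nn_integral_eq_integral) (auto intro!: AE_I2)
  finally show ?thesis by (simp add: le_less_trans)
qed

lemma kap_pos: "0 < kap"
proof -
  have c1: "cos 1 < (1::real)" using cos_monotone_0_pi[of 0 1] pi_gt3 by simp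
  have "0 < ennreal ((1 - cos 1) / 4)" using c1 by simp
  also have "\<dots> = (\<integral>\<^sup>+\<theta>. ennreal ((1 - cos 1) / 4) * indicator {1..2::real} \<theta> \<partial>lborel)"
    by (subst nn_integral_cmult_indicator) auto
  also have "\<dots> \<le> kap" unfolding kap_def
  proof (intro nn_integral_mono)
    fix \<theta> :: real
    show "ennreal ((1 - cos 1) / 4) * indicator {1..2} \<theta> \<le> ennreal ((1 - cos \<theta>) / \<theta>\<^sup>2)"
    proof (cases "\<theta> \<in> {1..2}")
      case True
      then have "cos \<theta> \<le> cos 1" using pi_gt3 by (intro cos_monotone_0_pi_le) auto
      moreover have "\<theta>\<^sup>2 \<le> 4" using True power_mono[of \<theta> 2 2] by auto
      ultimately have "(1 - cos 1) / 4 \<le> (1 - cos \<theta>) / \<theta>\<^sup>2"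
        using True c1 by (intro frac_le) auto
      then show ?thesis using True by (simp add: ennreal_leI)
    qed simp
  qed
  finally show ?thesis .
qed

text \<open>The moments are compared after multiplication by \<open>kap\<close>, so finiteness and
  positivity replace the knowledge of its value.\<close>

lemma kap_cancel: "kap * a \<le> kap * b \<Longrightarrow> a \<le> b"
  using kap_finite kap_pos by (subst (asm) ennreal_mult_le_mult_iff) auto

text \<open>The real part of the characteristic function of a centered Gaussian variable with
  variance \<open>v\<close>. In this form the property includes degenerate laws, passes to pointwise
  limits by dominated convergence, and fits the cosine representation of the absolute value.\<close>

definition cos_gaussian :: "'a measure \<Rightarrow> ('a \<Rightarrow> real) \<Rightarrow> real \<Rightarrow> bool" where
  "cos_gaussian M L v \<longleftrightarrow> L \<in> borel_measurable M \<and>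
     (\<forall>\<theta>. (\<integral>\<omega>. cos (\<theta> * L \<omega>) \<partial>M) = exp (- \<theta>\<^sup>2 * v / 2))"

lemma (in prob_space) integrable_cos_mult:
  fixes L :: "'a \<Rightarrow> real"
  assumes [measurable]: "L \<in> borel_measurable M"
  shows "integrable M (\<lambda>\<omega>. cos (\<theta> * L \<omega>))"
  by (rule integrable_const_bound[where B = 1]) auto

lemma (in prob_space) kap_abs_moment:
  assumes L: "cos_gaussian M L v"
  shows "kap * (\<integral>\<^sup>+\<omega>. ennreal \<bar>L \<omega>\<bar> \<partial>M) = (\<integral>\<^sup>+\<theta>. ennreal ((1 - exp (- \<theta>\<^sup>2 * v / 2)) / \<theta>\<^sup>2) \<partial>lborel)"
proof -
  have [measurable]: "L \<in> borel_measurable M" using L by (simp add: cos_gaussian_def)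
  interpret pair_sigma_finite M lborel ..
  have "kap * (\<integral>\<^sup>+\<omega>. ennreal \<bar>L \<omega>\<bar> \<partial>M) = (\<integral>\<^sup>+\<omega>. (\<integral>\<^sup>+\<theta>. ennreal ((1 - cos (\<theta> * L \<omega>)) / \<theta>\<^sup>2) \<partial>lborel) \<partial>M)"
    by (simp add: kap_abs nn_integral_cmult)
  also have "\<dots> = (\<integral>\<^sup>+\<theta>. (\<integral>\<^sup>+\<omega>. ennreal ((1 - cos (\<theta> * L \<omega>)) / \<theta>\<^sup>2) \<partial>M) \<partial>lborel)"
    by (rule Fubini'[symmetric]) measurable
  also have "\<dots> = (\<integral>\<^sup>+\<theta>. ennreal ((1 - exp (- \<theta>\<^sup>2 * v / 2)) / \<theta>\<^sup>2) \<partial>lborel)"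
  proof (intro nn_integral_cong)
    fix \<theta> :: real
    have "(\<integral>\<^sup>+\<omega>. ennreal ((1 - cos (\<theta> * L \<omega>)) / \<theta>\<^sup>2) \<partial>M) = ennreal (\<integral>\<omega>. (1 - cos (\<theta> * L \<omega>)) / \<theta>\<^sup>2 \<partial>M)"
      by (intro nn_integral_eq_integral integrable_divide Bochner_Integration.integrable_diff
          integrable_const integrable_cos_mult AE_I2) auto
    also have "(\<integral>\<omega>. (1 - cos (\<theta> * L \<omega>)) / \<theta>\<^sup>2 \<partial>M) = (1 - exp (- \<theta>\<^sup>2 * v / 2)) / \<theta>\<^sup>2"
      using L by (simp add: integrable_cos_mult cos_gaussian_def prob_space)
    finally show "(\<integral>\<^sup>+\<omega>. ennreal ((1 - cos (\<theta> * L \<omega>)) / \<theta>\<^sup>2) \<partial>M) = ennreal ((1 - exp (- \<theta>\<^sup>2 * v / 2)) / \<theta>\<^sup>2)" .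
  qed
  finally show ?thesis .
qed

lemma cos_gaussian_std_normal:
  "cos_gaussian std_normal_distribution (\<lambda>x. s * x) (s\<^sup>2)"
proof -
  interpret prob_space std_normal_distribution by (rule prob_space_normal_density) simp
  have "(\<integral>x. cos (\<theta> * (s * x)) \<partial>std_normal_distribution) = exp (- \<theta>\<^sup>2 * s\<^sup>2 / 2)" for \<theta>
  proof -
    have "(\<integral>x. cos (\<theta> * (s * x)) \<partial>std_normal_distribution) = (\<integral>x. Re (iexp ((\<theta> * s) * x)) \<partial>std_normal_distribution)"
      by (simp add: mult.assoc Re_exp)
    also have "\<dots> = Re (char std_normal_distribution (\<theta> * s))"
      unfolding char_def by (intro integral_Re integrable_const_bound[where B = 1]) auto
    finally show ?thesis by (simp add: char_std_normal_distribution power_mult_distrib)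
  qed
  then show ?thesis by (simp add: cos_gaussian_def)
qed

text \<open>The integral is evaluated by reading \<open>kap_abs_moment\<close> backwards for a
  multiple of a standard normal variable, whose absolute moment \<open>sqrt (2 / pi)\<close> is
  known.\<close>

lemma kap_normal_abs:
  assumes "0 \<le> v"
  shows "(\<integral>\<^sup>+\<theta>. ennreal ((1 - exp (- \<theta>\<^sup>2 * v / 2)) / \<theta>\<^sup>2) \<partial>lborel) = kap * ennreal (sqrt (2 / pi) * sqrt v)"
proof -
  interpret prob_space std_normal_distribution by (rule prob_space_normal_density) simp
  have "(\<integral>\<^sup>+x. ennreal \<bar>sqrt v * x\<bar> \<partial>std_normal_distribution) = (\<integral>\<^sup>+x. ennreal (std_normal_density x * \<bar>sqrt v * x\<bar>) \<partial>lborel)"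
    by (subst nn_integral_density) (auto simp: ennreal_mult)
  also have "\<dots> = (\<integral>\<^sup>+x. ennreal (sqrt v * (std_normal_density x * \<bar>x\<bar> ^ 1)) \<partial>lborel)"
    using assms by (intro nn_integral_cong) (simp add: abs_mult mult_ac)
  also have "\<dots> = ennreal (\<integral>x. sqrt v * (std_normal_density x * \<bar>x\<bar> ^ 1) \<partial>lborel)"
    using assms by (intro nn_integral_eq_integral integrable_mult_right integrable_std_normal_moment_abs) auto
  also have "(\<integral>x. sqrt v * (std_normal_density x * \<bar>x\<bar> ^ 1) \<partial>lborel) = sqrt v * sqrt (2 / pi)"
    using integral_std_normal_moment_abs_odd[of 0] by (simp only: integral_mult_right_zero) simp
  finally show ?thesis
    using kap_abs_moment[OF cos_gaussian_std_normal[of "sqrt v"]] assms by (simp add: mult.commute)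
qed

lemma (in prob_space) cos_gaussian_abs_moment:
  assumes "cos_gaussian M L v" "0 \<le> v"
  shows "(\<integral>\<^sup>+\<omega>. ennreal \<bar>L \<omega>\<bar> \<partial>M) = ennreal (sqrt (2 / pi) * sqrt v)"
proof -
  have "kap * (\<integral>\<^sup>+\<omega>. ennreal \<bar>L \<omega>\<bar> \<partial>M) = kap * ennreal (sqrt (2 / pi) * sqrt v)"
    using kap_abs_moment[OF assms(1)] kap_normal_abs[OF assms(2)] by (rule trans)
  note eq = this
  show ?thesis by (rule antisym; rule kap_cancel) (simp_all only: eq order_refl)
qed

text \<open>The functions \<open>2 * n\<^sup>2 * (1 - cos (y / n))\<close> converge to
  \<open>y\<^sup>2\<close>, and their means are at most \<open>v\<close> because
  \<open>1 - exp (- x) \<le> x\<close>. Fatou's lemma gives the upper bound.\<close>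

lemma (in prob_space) cos_gaussian_square_moment:
  assumes L: "cos_gaussian M L v" and v: "0 \<le> v"
  shows "(\<integral>\<^sup>+\<omega>. ennreal ((L \<omega>)\<^sup>2) \<partial>M) \<le> ennreal v"
proof -
  have [measurable]: "L \<in> borel_measurable M" using L by (simp add: cos_gaussian_def)
  define g where "g n y = 2 * (real (Suc n))\<^sup>2 * (1 - cos (1 / real (Suc n) * y))" for n y
  have g0: "0 \<le> g n y" for n y by (simp add: g_def)
  have lim: "(\<lambda>n. g n y) \<longlonglongrightarrow> y\<^sup>2" for y
  proof -
    have "g n y = (y * sinc (y / 2 * (1 / real (Suc n))))\<^sup>2" for n
    proof (cases "y = 0")
      case False
      define m where "m = real (Suc n)"
      define h where "h = y / 2 * (1 / m)"
      have m: "0 < m" by (simp add: m_def)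
      have h: "h \<noteq> 0" "y = 2 * m * h" "1 / m * y = 2 * h" using m False by (simp_all add: h_def)
      have "g n y = 2 * m\<^sup>2 * (1 - cos (2 * h))" unfolding g_def m_def[symmetric] h(3) ..
      also have "\<dots> = (2 * m * sin h)\<^sup>2" using cos_double_sin[of h] by (simp add: power_mult_distrib)
      also have "2 * m * sin h = y * sinc h" using h(1) unfolding h(2) by simp
      finally show ?thesis by (simp add: h_def m_def)
    qed (simp add: g_def)
    moreover have "(\<lambda>n. (y * sinc (y / 2 * (1 / real (Suc n))))\<^sup>2) \<longlonglongrightarrow> (y * sinc (y / 2 * 0))\<^sup>2"
      by (intro tendsto_intros isCont_tendsto_compose[OF isCont_sinc] LIMSEQ_Suc[OF lim_1_over_n])
    ultimately show ?thesis by simp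
  qed
  have "(\<integral>\<^sup>+\<omega>. ennreal ((L \<omega>)\<^sup>2) \<partial>M) = (\<integral>\<^sup>+\<omega>. liminf (\<lambda>n. ennreal (g n (L \<omega>))) \<partial>M)"
  proof (intro nn_integral_cong)
    fix \<omega>
    have "liminf (\<lambda>n. ennreal (g n (L \<omega>))) = ennreal ((L \<omega>)\<^sup>2)"
      by (intro lim_imp_Liminf tendsto_ennrealI lim) simp
    then show "ennreal ((L \<omega>)\<^sup>2) = liminf (\<lambda>n. ennreal (g n (L \<omega>)))" by (rule sym)
  qed
  also have "\<dots> \<le> liminf (\<lambda>n. \<integral>\<^sup>+\<omega>. ennreal (g n (L \<omega>)) \<partial>M)"
    unfolding g_def by (intro nn_integral_liminf) measurable
  also have "\<dots> \<le> ennreal v"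
  proof -
    have E: "(\<integral>\<omega>. 1 - cos (c * L \<omega>) \<partial>M) = 1 - exp (- c\<^sup>2 * v / 2)" for c
      using L by (simp add: integrable_cos_mult cos_gaussian_def prob_space)
    have "(\<integral>\<^sup>+\<omega>. ennreal (g n (L \<omega>)) \<partial>M) \<le> ennreal v" for n
    proof -
      have "(\<integral>\<^sup>+\<omega>. ennreal (g n (L \<omega>)) \<partial>M) = ennreal (\<integral>\<omega>. g n (L \<omega>) \<partial>M)"
        unfolding g_def by (intro nn_integral_eq_integral AE_I2 integrable_mult_right
            Bochner_Integration.integrable_diff integrable_const integrable_cos_mult) auto
      also have "(\<integral>\<omega>. g n (L \<omega>) \<partial>M) = 2 * (real (Suc n))\<^sup>2 * (1 - exp (- (1 / real (Suc n))\<^sup>2 * v / 2))"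
        unfolding g_def by (simp only: integral_mult_right_zero E)
      also have "\<dots> \<le> 2 * (real (Suc n))\<^sup>2 * ((1 / real (Suc n))\<^sup>2 * v / 2)"
        using exp_ge_add_one_self[of "- (1 / real (Suc n))\<^sup>2 * v / 2"] by (intro mult_left_mono) auto
      also have "\<dots> = v" by (simp add: power_divide del: of_nat_Suc)
      finally show ?thesis by (simp add: ennreal_leI)
    qed
    then show ?thesis by (intro Liminf_le) auto
  qed
  finally show ?thesis .
qed

text \<open>The factor \<open>x\<^sup>2\<close> is the point: it makes the excess of a mixed
  absolute moment quadratic in the covariance. For \<open>0 \<le> x\<close> it comes from writing
  \<open>exp x - 2 + exp (- x)\<close> as \<open>exp x * (1 - exp (- x))\<^sup>2\<close>.\<close>

lemma cosh_minus_one_le: "(exp x + exp (- x)) / 2 - 1 \<le> x\<^sup>2 * exp \<bar>x\<bar>" for x :: real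
proof -
  have "(exp x + exp (- x)) / 2 - 1 \<le> x\<^sup>2 * exp x" if x: "0 \<le> x" for x :: real
  proof -
    define y where "y = exp (- (x / 2))"
    have e: "exp (- x) = y * y" "exp x * (y * y) = 1" by (simp_all add: y_def flip: exp_add)
    have ex: "0 < exp x" by simp
    have "0 \<le> 1 - y * y" "1 - y * y \<le> x"
      using exp_ge_add_one_self[of "- x"] x unfolding e(1)[symmetric] by auto
    then have "(1 - y * y) * (1 - y * y) \<le> x * x" using x by (intro mult_mono) auto
    then have "exp x * ((1 - y * y) * (1 - y * y)) \<le> exp x * (x * x)" using ex by (intro mult_left_mono) auto
    moreover have "exp x * ((1 - y * y) * (1 - y * y)) = exp x - 2 * (exp x * (y * y)) + (exp x * (y * y)) * (y * y)"
      by (simp add: algebra_simps)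
    ultimately have "exp x - 2 + exp (- x) \<le> exp x * (x * x)" using e by simp
    moreover have "0 \<le> exp x * (x * x)" by simp
    moreover have "E / 2 - 1 \<le> Q" if "E - 2 \<le> Q" "0 \<le> Q" for E Q :: real using that by linarith
    ultimately have "(exp x + exp (- x)) / 2 - 1 \<le> exp x * (x * x)" by (simp add: algebra_simps)
    then show ?thesis by (simp add: power2_eq_square mult.commute)
  qed
  from this[of x] this[of "- x"] show ?thesis by (cases "0 \<le> x") (auto simp: add.commute)
qed

text \<open>Both absolute values are expanded into cosines and the expectation is taken first. The
  excess over the independent case is a Gaussian factor times \<open>cosh (a * b * r) - 1\<close>;
  this is of order \<open>(a * b * r)\<^sup>2\<close>, which cancels the singular weights
  \<open>1 / a\<^sup>2\<close> and \<open>1 / b\<^sup>2\<close>. The constant depends on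
  \<open>v\<close> alone, so it is uniform over all pairs \<open>X\<close>,
  \<open>Y\<close>.\<close>

lemma (in prob_space) abs_product_moment_le:
  assumes v: "0 < v"
  shows "\<exists>C\<ge>0. \<forall>X Y r. \<bar>r\<bar> \<le> v / 2 \<longrightarrow>
    (\<forall>a b. cos_gaussian M (\<lambda>\<omega>. a * X \<omega> + b * Y \<omega>) ((a\<^sup>2 + b\<^sup>2) * v + 2 * a * b * r)) \<longrightarrow>
    (\<integral>\<^sup>+\<omega>. ennreal (\<bar>X \<omega>\<bar> * \<bar>Y \<omega>\<bar>) \<partial>M) \<le> ennreal (2 / pi * v + C * r\<^sup>2)"
proof -
  obtain k where k: "kap = ennreal k" "0 < k"
  proof -
    obtain r where r: "kap = ennreal r" using kap_finite by (cases kap) auto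
    have "0 < ennreal r" using kap_pos by (simp only: r)
    then show ?thesis by (intro that[OF r]) (simp only: ennreal_less_zero_iff)
  qed
  \<comment> \<open>The Gaussian weight left over once half of the exponent has been spent on the
    growth of the hyperbolic cosine.\<close>
  define G where "G = (\<integral>a. exp (- a\<^sup>2 * v / 4) \<partial>lborel)"
  have Gi: "integrable lborel (\<lambda>a. exp (- a\<^sup>2 * v / 4))"
  proof -
    have "integrable lborel (\<lambda>a. sqrt (2 * pi * (sqrt (2 / v))\<^sup>2) * normal_density 0 (sqrt (2 / v)) a)"
      using v by (intro integrable_mult_right integrable_normal_density) simp
    then show ?thesis using v by (simp add: normal_density_def)
  qed
  have Gn: "(\<integral>\<^sup>+a. ennreal (exp (- a\<^sup>2 * v / 4)) \<partial>lborel) = ennreal G"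
    unfolding G_def by (intro nn_integral_eq_integral Gi) auto
  have G0: "0 \<le> G" unfolding G_def by simp
  show ?thesis
  proof (intro exI[of _ "(G / k)\<^sup>2"] conjI allI impI)
    fix X Y :: "'a \<Rightarrow> real" and r :: real
    assume r: "\<bar>r\<bar> \<le> v / 2"
      and cg: "\<forall>a b. cos_gaussian M (\<lambda>\<omega>. a * X \<omega> + b * Y \<omega>) ((a\<^sup>2 + b\<^sup>2) * v + 2 * a * b * r)"
    have cgX: "cos_gaussian M X v" and cgY: "cos_gaussian M Y v"
      using cg[rule_format, of 1 0] cg[rule_format, of 0 1] by simp_all
    have [measurable]: "X \<in> borel_measurable M" "Y \<in> borel_measurable M"
      using cgX cgY by (auto simp: cos_gaussian_def)
    interpret pair_sigma_finite M lborel ..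
    define F where "F a x = (1 - cos (a * x)) / a\<^sup>2" for a x :: real
    have F0: "0 \<le> F a x" for a x by (simp add: F_def)
    have [measurable]: "(\<lambda>p. F (fst p) (snd p)) \<in> borel_measurable (borel \<Otimes>\<^sub>M borel)"
      unfolding F_def by measurable
    have Fm [measurable]: "(\<lambda>w. F (g w) (h w)) \<in> borel_measurable N"
      if [measurable]: "g \<in> borel_measurable N" "h \<in> borel_measurable N" for g h and N :: "'b measure"
      unfolding F_def by measurable
    define e1 where "e1 a = ennreal ((1 - exp (- a\<^sup>2 * v / 2)) / a\<^sup>2)" for a :: real
    define e2 where "e2 a = ennreal (exp (- a\<^sup>2 * v / 4))" for a :: real
    have [measurable]: "e1 \<in> borel_measurable borel" "e2 \<in> borel_measurable borel"
      unfolding e1_def e2_def by measurable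
    have inner: "(\<integral>\<^sup>+\<omega>. ennreal (F a (X \<omega>) * F b (Y \<omega>)) \<partial>M) \<le> e1 a * e1 b + ennreal (r\<^sup>2) * (e2 a * e2 b)" for a b
    proof (cases "a = 0 \<or> b = 0")
      case False
      let ?E = "\<lambda>w. exp (- w / 2)"
      have i: "integrable M (\<lambda>\<omega>. cos (a * X \<omega>))" "integrable M (\<lambda>\<omega>. cos (b * Y \<omega>))"
        "integrable M (\<lambda>\<omega>. cos (a * X \<omega> + b * Y \<omega>))" "integrable M (\<lambda>\<omega>. cos (a * X \<omega> - b * Y \<omega>))"
        by (intro integrable_const_bound[where B = 1]; simp)+
      have ex: "(\<integral>\<omega>. cos (a * X \<omega>) \<partial>M) = exp (- a\<^sup>2 * v / 2)" "(\<integral>\<omega>. cos (b * Y \<omega>) \<partial>M) = exp (- b\<^sup>2 * v / 2)"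
        using cgX cgY by (auto simp: cos_gaussian_def)
      have ep: "(\<integral>\<omega>. cos (a * X \<omega> + b * Y \<omega>) \<partial>M) = exp (- ((a\<^sup>2 + b\<^sup>2) * v + 2 * a * b * r) / 2)"
        using cg[rule_format, of a b, unfolded cos_gaussian_def, THEN conjunct2, rule_format, of 1] by simp
      have em: "(\<integral>\<omega>. cos (a * X \<omega> - b * Y \<omega>) \<partial>M) = exp (- ((a\<^sup>2 + b\<^sup>2) * v - 2 * a * b * r) / 2)"
        using cg[rule_format, of a "- b", unfolded cos_gaussian_def, THEN conjunct2, rule_format, of 1] by simp
      \<comment> \<open>The product of two cosines is half the sum of the cosines of the sum and the
        difference, so only linear combinations of \<open>X\<close> and \<open>Y\<close>
        occur.\<close>
      have prod: "F a (X \<omega>) * F b (Y \<omega>) = (1 - cos (a * X \<omega>) - cos (b * Y \<omega>)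
          + (cos (a * X \<omega> + b * Y \<omega>) + cos (a * X \<omega> - b * Y \<omega>)) / 2) / (a\<^sup>2 * b\<^sup>2)" for \<omega>
        by (simp add: F_def cos_add cos_diff algebra_simps)
      have "(\<integral>\<omega>. F a (X \<omega>) * F b (Y \<omega>) \<partial>M) = (1 - exp (- a\<^sup>2 * v / 2) - exp (- b\<^sup>2 * v / 2)
          + (exp (- ((a\<^sup>2 + b\<^sup>2) * v + 2 * a * b * r) / 2) + exp (- ((a\<^sup>2 + b\<^sup>2) * v - 2 * a * b * r) / 2)) / 2) / (a\<^sup>2 * b\<^sup>2)"
        unfolding prod using i ex ep em by (simp add: prob_space)
      also have "\<dots> = ((1 - exp (- a\<^sup>2 * v / 2)) * (1 - exp (- b\<^sup>2 * v / 2))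
          + exp (- ((a\<^sup>2 + b\<^sup>2) * v) / 2) * ((exp (a * b * r) + exp (- (a * b * r))) / 2 - 1)) / (a\<^sup>2 * b\<^sup>2)"
      proof -
        have 1: "exp (- ((a\<^sup>2 + b\<^sup>2) * v + 2 * a * b * r) / 2) = exp (- ((a\<^sup>2 + b\<^sup>2) * v) / 2) * exp (- (a * b * r))"
          by (simp add: field_simps flip: exp_add)
        have 2: "exp (- ((a\<^sup>2 + b\<^sup>2) * v - 2 * a * b * r) / 2) = exp (- ((a\<^sup>2 + b\<^sup>2) * v) / 2) * exp (a * b * r)"
          by (simp add: field_simps flip: exp_add)
        have 3: "exp (- ((a\<^sup>2 + b\<^sup>2) * v) / 2) = exp (- a\<^sup>2 * v / 2) * exp (- b\<^sup>2 * v / 2)"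
          by (simp add: field_simps flip: exp_add)
        show ?thesis unfolding 1 2 unfolding 3 by (simp add: field_simps)
      qed
      also have "\<dots> \<le> ((1 - exp (- a\<^sup>2 * v / 2)) * (1 - exp (- b\<^sup>2 * v / 2))
          + (exp (- a\<^sup>2 * v / 4) * exp (- b\<^sup>2 * v / 4)) * (a * b * r)\<^sup>2) / (a\<^sup>2 * b\<^sup>2)"
      proof (intro divide_right_mono add_left_mono)
        have "exp (- ((a\<^sup>2 + b\<^sup>2) * v) / 2) * ((exp (a * b * r) + exp (- (a * b * r))) / 2 - 1)
          \<le> exp (- ((a\<^sup>2 + b\<^sup>2) * v) / 2) * ((a * b * r)\<^sup>2 * exp \<bar>a * b * r\<bar>)"
          by (intro mult_left_mono cosh_minus_one_le) simp
        \<comment> \<open>Here \<open>\<bar>r\<bar> \<le> v / 2\<close> enters: with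
          \<open>\<bar>a * b\<bar> \<le> (a\<^sup>2 + b\<^sup>2) / 2\<close> the growth is absorbed
          by half of the Gaussian exponent.\<close>
        also have "\<dots> \<le> exp (- ((a\<^sup>2 + b\<^sup>2) * v) / 2) * ((a * b * r)\<^sup>2 * exp ((a\<^sup>2 + b\<^sup>2) * v / 4))"
        proof (intro mult_left_mono)
          have "\<bar>a * b\<bar> \<le> (a\<^sup>2 + b\<^sup>2) / 2"
            using sum_squares_bound[of "\<bar>a\<bar>" "\<bar>b\<bar>"] by (simp add: abs_mult)
          then have "\<bar>a * b\<bar> * \<bar>r\<bar> \<le> (a\<^sup>2 + b\<^sup>2) / 2 * (v / 2)" using r by (intro mult_mono) auto
          then show "exp \<bar>a * b * r\<bar> \<le> exp ((a\<^sup>2 + b\<^sup>2) * v / 4)" by (simp add: abs_mult)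
        qed auto
        also have "\<dots> = exp (- a\<^sup>2 * v / 4) * exp (- b\<^sup>2 * v / 4) * (a * b * r)\<^sup>2"
          by (simp add: field_simps flip: exp_add)
        finally show "exp (- ((a\<^sup>2 + b\<^sup>2) * v) / 2) * ((exp (a * b * r) + exp (- (a * b * r))) / 2 - 1)
          \<le> exp (- a\<^sup>2 * v / 4) * exp (- b\<^sup>2 * v / 4) * (a * b * r)\<^sup>2" .
      qed simp
      also have "\<dots> = (1 - exp (- a\<^sup>2 * v / 2)) / a\<^sup>2 * ((1 - exp (- b\<^sup>2 * v / 2)) / b\<^sup>2)
          + r\<^sup>2 * (exp (- a\<^sup>2 * v / 4) * exp (- b\<^sup>2 * v / 4))"
        using False by (simp add: add_divide_distrib power_mult_distrib)
      finally have le: "(\<integral>\<omega>. F a (X \<omega>) * F b (Y \<omega>) \<partial>M) \<le> \<dots>" .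
      have "(\<integral>\<^sup>+\<omega>. ennreal (F a (X \<omega>) * F b (Y \<omega>)) \<partial>M) = ennreal (\<integral>\<omega>. F a (X \<omega>) * F b (Y \<omega>) \<partial>M)"
        using i by (intro nn_integral_eq_integral) (auto simp: prod intro!: AE_I2 simp del: F_def, simp add: F0 flip: prod)
      also have "\<dots> \<le> e1 a * e1 b + ennreal (r\<^sup>2) * (e2 a * e2 b)"
      proof -
        have p: "ennreal (p * q + s * (t * u)) = ennreal p * ennreal q + ennreal s * (ennreal t * ennreal u)"
          if "0 \<le> p" "0 \<le> q" "0 \<le> s" "0 \<le> t" "0 \<le> u" for p q s t u
          using that by (simp add: ennreal_mult)
        have "0 \<le> (1 - exp (- c\<^sup>2 * v / 2)) / c\<^sup>2" for c using v by simp
        then show ?thesis using ennreal_leI[OF le] unfolding e1_def e2_def by (subst (asm) p) auto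
      qed
      finally show ?thesis .
    qed (auto simp: F_def)
    have "kap * kap * (\<integral>\<^sup>+\<omega>. ennreal (\<bar>X \<omega>\<bar> * \<bar>Y \<omega>\<bar>) \<partial>M) = (\<integral>\<^sup>+\<omega>. (kap * ennreal \<bar>X \<omega>\<bar>) * (kap * ennreal \<bar>Y \<omega>\<bar>) \<partial>M)"
      by (simp add: nn_integral_cmult[symmetric] ennreal_mult mult_ac)
    also have "\<dots> = (\<integral>\<^sup>+\<omega>. (\<integral>\<^sup>+a. (\<integral>\<^sup>+b. ennreal (F a (X \<omega>) * F b (Y \<omega>)) \<partial>lborel) \<partial>lborel) \<partial>M)"
      unfolding kap_abs[symmetric] F_def[symmetric]
    proof (intro nn_integral_cong)
      fix \<omega>
      have m: "(\<lambda>a. ennreal (F a x)) \<in> borel_measurable lborel" for x unfolding F_def by measurable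
      show "(\<integral>\<^sup>+a. ennreal (F a (X \<omega>)) \<partial>lborel) * (\<integral>\<^sup>+b. ennreal (F b (Y \<omega>)) \<partial>lborel) =
        (\<integral>\<^sup>+a. (\<integral>\<^sup>+b. ennreal (F a (X \<omega>) * F b (Y \<omega>)) \<partial>lborel) \<partial>lborel)"
        by (simp only: ennreal_mult[OF F0 F0] nn_integral_cmult[OF m] nn_integral_multc[OF m])
    qed
    also have "\<dots> = (\<integral>\<^sup>+a. (\<integral>\<^sup>+\<omega>. (\<integral>\<^sup>+b. ennreal (F a (X \<omega>) * F b (Y \<omega>)) \<partial>lborel) \<partial>M) \<partial>lborel)"
      unfolding F_def by (rule Fubini'[symmetric]) measurable
    also have "\<dots> = (\<integral>\<^sup>+a. (\<integral>\<^sup>+b. (\<integral>\<^sup>+\<omega>. ennreal (F a (X \<omega>) * F b (Y \<omega>)) \<partial>M) \<partial>lborel) \<partial>lborel)"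
      unfolding F_def by (rule nn_integral_cong, rule Fubini'[symmetric]) measurable
    also have "\<dots> \<le> (\<integral>\<^sup>+a. (\<integral>\<^sup>+b. e1 a * e1 b + ennreal (r\<^sup>2) * (e2 a * e2 b) \<partial>lborel) \<partial>lborel)"
      by (intro nn_integral_mono inner)
    also have "\<dots> = (\<integral>\<^sup>+a. e1 a \<partial>lborel) * (\<integral>\<^sup>+a. e1 a \<partial>lborel) + ennreal (r\<^sup>2) * ((\<integral>\<^sup>+a. e2 a \<partial>lborel) * (\<integral>\<^sup>+a. e2 a \<partial>lborel))"
      by (simp add: nn_integral_add nn_integral_cmult nn_integral_multc)
    also have "\<dots> = kap * kap * ennreal (2 / pi * v) + ennreal (r\<^sup>2) * (ennreal G * ennreal G)"
    proof -
      let ?e = "ennreal (sqrt (2 / pi) * sqrt v)"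
      have "?e * ?e = ennreal ((sqrt (2 / pi))\<^sup>2 * (sqrt v)\<^sup>2)"
        using v by (simp add: power2_eq_square mult_ac flip: ennreal_mult)
      also have "\<dots> = ennreal (2 / pi * v)" using v by simp
      finally have e: "(kap * ?e) * (kap * ?e) = kap * kap * ennreal (2 / pi * v)"
        by (metis mult.assoc mult.left_commute)
      show ?thesis unfolding e1_def e2_def kap_normal_abs[OF less_imp_le[OF v]] Gn e ..
    qed
    also have "\<dots> = kap * kap * ennreal (2 / pi * v + (G / k)\<^sup>2 * r\<^sup>2)"
    proof -
      have kk: "kap * kap = ennreal (k * k)" unfolding k(1) using k(2) by (simp flip: ennreal_mult)
      have "k * k * (2 / pi * v) + r\<^sup>2 * (G * G) = k * k * (2 / pi * v + (G / k)\<^sup>2 * r\<^sup>2)"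
        using k(2) by (simp add: distrib_left power_divide power2_eq_square)
      note eq1 = this
      have eq2: "ennreal p * ennreal q + ennreal s * (ennreal t * ennreal t) = ennreal (p * q + s * (t * t))"
        if "0 \<le> p" "0 \<le> q" "0 \<le> s" "0 \<le> t" for p q s t
        using that by (simp add: ennreal_mult)
      have "kap * kap * ennreal (2 / pi * v) + ennreal (r\<^sup>2) * (ennreal G * ennreal G) =
        ennreal (k * k * (2 / pi * v) + r\<^sup>2 * (G * G))"
        unfolding kk using v G0 by (intro eq2) auto
      also have "\<dots> = ennreal (k * k) * ennreal (2 / pi * v + (G / k)\<^sup>2 * r\<^sup>2)"
        unfolding eq1 using v by (intro ennreal_mult) auto
      finally show ?thesis unfolding kk .
    qed
    finally show "(\<integral>\<^sup>+\<omega>. ennreal (\<bar>X \<omega>\<bar> * \<bar>Y \<omega>\<bar>) \<partial>M) \<le> ennreal (2 / pi * v + (G / k)\<^sup>2 * r\<^sup>2)"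
        unfolding mult.assoc by (rule kap_cancel[OF kap_cancel])
  qed simp
qed

subsection \<open>Centered Gaussian variables\<close>

lemma (in prob_space) gaussian_rv_integrable:
  assumes "gaussian_rv M L"
  shows "integrable M L" "integrable M (\<lambda>\<omega>. (L \<omega>)\<^sup>2)"
proof -
  have [measurable]: "L \<in> borel_measurable M" using assms by (simp add: gaussian_rv_def)
  consider \<mu> \<sigma> where "\<sigma> > 0" "distributed M lborel L (\<lambda>x. ennreal (normal_density \<mu> \<sigma> x))" | \<mu> where "AE \<omega> in M. L \<omega> = \<mu>"
    using assms unfolding gaussian_rv_def by blast
  then have "integrable M L \<and> integrable M (\<lambda>\<omega>. (L \<omega>)\<^sup>2)"
  proof cases
    case 1
    have c: "integrable M (\<lambda>\<omega>. (L \<omega> - \<mu>) ^ k)" for k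
      using integrable_normal_moment[OF 1(1), of \<mu> k] distributed_integrable[OF 1(2), of "\<lambda>x. (x - \<mu>) ^ k"] by simp
    have i1: "integrable M L" using Bochner_Integration.integrable_add[OF c[of 1] integrable_const[of \<mu>]] by simp
    have "(\<lambda>\<omega>. (L \<omega>)\<^sup>2) = (\<lambda>\<omega>. (L \<omega> - \<mu>) ^ 2 + (2 * \<mu> * L \<omega> - \<mu>\<^sup>2))"
      by (auto simp: power2_eq_square algebra_simps)
    then show ?thesis using c[of 2] i1 by simp
  next
    case 2
    have "integrable M L \<longleftrightarrow> integrable M (\<lambda>_. \<mu>)" using 2 by (intro integrable_cong_AE) auto
    moreover have "integrable M (\<lambda>\<omega>. (L \<omega>)\<^sup>2) \<longleftrightarrow> integrable M (\<lambda>_. \<mu>\<^sup>2)"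
      using 2 by (intro integrable_cong_AE) auto
    ultimately show ?thesis by simp
  qed
  then show "integrable M L" "integrable M (\<lambda>\<omega>. (L \<omega>)\<^sup>2)" by auto
qed

lemma (in prob_space) gaussian_rv_centered:
  assumes g: "gaussian_rv M L" and m: "(\<integral>\<omega>. L \<omega> \<partial>M) = 0" and v: "(\<integral>\<omega>. (L \<omega>)\<^sup>2 \<partial>M) = v"
  shows "0 < v \<and> distributed M lborel L (normal_density 0 (sqrt v)) \<or> v = 0 \<and> (AE \<omega> in M. L \<omega> = 0)"
proof -
  have [measurable]: "L \<in> borel_measurable M" using g by (simp add: gaussian_rv_def)
  consider \<mu> \<sigma> where "\<sigma> > 0" "distributed M lborel L (\<lambda>x. ennreal (normal_density \<mu> \<sigma> x))" | \<mu> where "AE \<omega> in M. L \<omega> = \<mu>"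
    using g unfolding gaussian_rv_def by blast
  then show ?thesis
  proof cases
    case 1
    have "\<mu> = 0" using normal_distributed_expectation[OF 1] m by simp
    moreover have "\<sigma>\<^sup>2 = v" using normal_distributed_variance[OF 1] m v by simp
    then have "v > 0" "\<sigma> = sqrt v" using 1(1) by auto
    ultimately show ?thesis using 1 by simp
  next
    case 2
    have "(\<integral>\<omega>. L \<omega> \<partial>M) = (\<integral>\<omega>. \<mu> \<partial>M)" using 2 by (intro integral_cong_AE) auto
    then have "\<mu> = 0" using m by (simp add: prob_space)
    moreover have "(\<integral>\<omega>. (L \<omega>)\<^sup>2 \<partial>M) = (\<integral>\<omega>. \<mu>\<^sup>2 \<partial>M)" using 2 by (intro integral_cong_AE) auto
    ultimately show ?thesis using 2 v by simp
  qed
qed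

lemma (in prob_space) gaussian_rv_cos_gaussian:
  assumes g: "gaussian_rv M L" and m: "(\<integral>\<omega>. L \<omega> \<partial>M) = 0" and v: "(\<integral>\<omega>. (L \<omega>)\<^sup>2 \<partial>M) = v"
  shows "cos_gaussian M L v"
proof -
  have [measurable]: "L \<in> borel_measurable M" using g by (simp add: gaussian_rv_def)
  have "(\<integral>\<omega>. cos (\<theta> * L \<omega>) \<partial>M) = exp (- \<theta>\<^sup>2 * v / 2)" for \<theta>
    using gaussian_rv_centered[OF assms]
  proof (elim disjE conjE)
    assume v0: "0 < v" and d: "distributed M lborel L (normal_density 0 (sqrt v))"
    have d': "distributed M lborel (\<lambda>\<omega>. (L \<omega> - 0) / sqrt v) std_normal_density"
      using normal_standard_normal_convert[of "sqrt v" L 0] v0 d by simp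
    have "(\<integral>\<omega>. cos (\<theta> * L \<omega>) \<partial>M) = (\<integral>\<omega>. cos (\<theta> * (sqrt v * ((L \<omega> - 0) / sqrt v))) \<partial>M)"
      using v0 by simp
    also have "\<dots> = (\<integral>x. std_normal_density x * cos (\<theta> * (sqrt v * x)) \<partial>lborel)"
      by (rule distributed_integral[OF d', symmetric]) auto
    also have "\<dots> = (\<integral>x. cos (\<theta> * (sqrt v * x)) \<partial>std_normal_distribution)"
      by (subst integral_density) auto
    also have "\<dots> = exp (- \<theta>\<^sup>2 * (sqrt v)\<^sup>2 / 2)"
      using cos_gaussian_std_normal[of "sqrt v"] unfolding cos_gaussian_def by blast
    finally show ?thesis using v0 by simp
  next
    assume "v = 0" and z: "AE \<omega> in M. L \<omega> = 0"
    have "(\<integral>\<omega>. cos (\<theta> * L \<omega>) \<partial>M) = (\<integral>\<omega>. 1 \<partial>M)" using z by (intro integral_cong_AE) auto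
    then show ?thesis using \<open>v = 0\<close> by (simp add: prob_space)
  qed
  then show ?thesis by (simp add: cos_gaussian_def)
qed

text \<open>Markov's inequality for the moment of order \<open>2 * p\<close>. The order is left free
  because a Hoelder exponent close to \<open>\<alpha> / 2\<close> calls for high moments.\<close>

lemma (in prob_space) gaussian_rv_tail:
  assumes g: "gaussian_rv M L" and m: "(\<integral>\<omega>. L \<omega> \<partial>M) = 0" and v: "(\<integral>\<omega>. (L \<omega>)\<^sup>2 \<partial>M) = v" and l: "0 < l"
  shows "measure M {\<omega> \<in> space M. l < \<bar>L \<omega>\<bar>} \<le> fact (2 * p) / (2 ^ p * fact p) * v ^ p / l ^ (2 * p)"
proof -
  have [measurable]: "L \<in> borel_measurable M" using g by (simp add: gaussian_rv_def)
  show ?thesis using gaussian_rv_centered[OF g m v]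
  proof (elim disjE conjE)
    assume v0: "0 < v" and d: "distributed M lborel L (normal_density 0 (sqrt v))"
    have s: "0 < sqrt v" using v0 by simp
    have i: "integrable M (\<lambda>\<omega>. (L \<omega>) ^ (2 * p))"
      using integrable_normal_moment[OF s, of 0 "2 * p"] distributed_integrable[OF d, of "\<lambda>x. x ^ (2 * p)"] by simp
    have "(\<integral>\<omega>. (L \<omega>) ^ (2 * p) \<partial>M) = (\<integral>x. normal_density 0 (sqrt v) x * x ^ (2 * p) \<partial>lborel)"
      by (rule distributed_integral[OF d, symmetric]) auto
    also have "\<dots> = fact (2 * p) / ((2 / v) ^ p * fact p)"
      using integral_normal_moment_even[OF s, of 0 p] v0 by simp
    finally have e: "(\<integral>\<omega>. (L \<omega>) ^ (2 * p) \<partial>M) = fact (2 * p) / (2 ^ p * fact p) * v ^ p"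
      using v0 by (simp add: power_divide)
    have "measure M {\<omega> \<in> space M. l < \<bar>L \<omega>\<bar>} \<le> measure M {\<omega> \<in> space M. l ^ (2 * p) \<le> (L \<omega>) ^ (2 * p)}"
    proof (rule finite_measure_mono)
      have "l ^ (2 * p) \<le> x ^ (2 * p)" if "l < \<bar>x\<bar>" for x
        using power_mono[of l "\<bar>x\<bar>" "2 * p"] that l by (simp add: power_even_abs)
      then show "{\<omega> \<in> space M. l < \<bar>L \<omega>\<bar>} \<subseteq> {\<omega> \<in> space M. l ^ (2 * p) \<le> (L \<omega>) ^ (2 * p)}" by auto
    qed measurable
    also have "\<dots> \<le> (\<integral>\<omega>. (L \<omega>) ^ (2 * p) \<partial>M) / l ^ (2 * p)"
      using l by (intro integral_Markov_inequality_measure[OF i, where A = "{}"]) (auto intro!: AE_I2)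
    finally show ?thesis unfolding e .
  next
    assume "v = 0" and z: "AE \<omega> in M. L \<omega> = 0"
    have "AE \<omega> in M. \<not> (l < \<bar>L \<omega>\<bar>)" using z l by (auto elim!: eventually_mono)
    then have "measure M {\<omega> \<in> space M. l < \<bar>L \<omega>\<bar>} = 0" by (intro prob_eq_0[THEN iffD2]) auto
    then show ?thesis using \<open>v = 0\<close> l by simp
  qed
qed

lemma (in prob_space) gaussian_rv_small_ball:
  assumes g: "gaussian_rv M L" and m: "(\<integral>\<omega>. L \<omega> \<partial>M) = 0" and v: "(\<integral>\<omega>. (L \<omega>)\<^sup>2 \<partial>M) = v" "0 < v" and d: "0 \<le> d"
  shows "(\<integral>\<^sup>+\<omega>. indicator {..d} \<bar>L \<omega>\<bar> \<partial>M) \<le> ennreal (d / sqrt v)"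
proof -
  have [measurable]: "L \<in> borel_measurable M" using g by (simp add: gaussian_rv_def)
  have D: "distributed M lborel L (normal_density 0 (sqrt v))"
    using gaussian_rv_centered[OF g m v(1)] v(2) by auto
  \<comment> \<open>The peak \<open>1 / sqrt (2 * pi * v)\<close> is below this value since
    \<open>4 \<le> 2 * pi\<close>; an interval of length \<open>2 * d\<close> then has probability
    at most \<open>d / sqrt v\<close>.\<close>
  have "normal_density 0 (sqrt v) x \<le> 1 / (2 * sqrt v)" for x
  proof -
    have "2 * sqrt v \<le> sqrt (2 * pi * v)"
      using v(2) pi_gt3 real_sqrt_le_mono[of "4 * v" "2 * pi * v"] by (simp add: real_sqrt_mult)
    moreover have "exp (- (x - 0)\<^sup>2 / (2 * (sqrt v)\<^sup>2)) \<le> 1" using v(2) by simp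
    ultimately have "exp (- (x - 0)\<^sup>2 / (2 * (sqrt v)\<^sup>2)) / sqrt (2 * pi * v) \<le> 1 / (2 * sqrt v)"
      using v(2) by (intro frac_le) auto
    then show ?thesis using v(2) by (simp add: normal_density_def)
  qed
  note nd = this
  have "(\<integral>\<^sup>+\<omega>. indicator {..d} \<bar>L \<omega>\<bar> \<partial>M) = (\<integral>\<^sup>+x. ennreal (normal_density 0 (sqrt v) x) * indicator {..d} \<bar>x\<bar> \<partial>lborel)"
    by (rule distributed_nn_integral[OF D, symmetric]) simp
  also have "\<dots> \<le> (\<integral>\<^sup>+x. ennreal (1 / (2 * sqrt v)) * indicator {-d..d} x \<partial>lborel)"
    using nd by (intro nn_integral_mono mult_mono) (auto simp: indicator_def ennreal_leI)
  also have "\<dots> = ennreal (1 / (2 * sqrt v)) * ennreal (2 * d)"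
    using d by (subst nn_integral_cmult_indicator) auto
  also have "\<dots> = ennreal (d / sqrt v)" using v(2) d by (simp flip: ennreal_mult)
  finally show ?thesis .
qed

subsection \<open>Fractional Brownian motion\<close>

locale fbm = prob_space M for M :: "'a measure" +
  fixes X :: "real \<Rightarrow> 'a \<Rightarrow> real" and \<alpha> :: real
  assumes fbm: "fractional_brownian_motion M (\<alpha> / 2) X" and \<alpha>: "0 < \<alpha>" "\<alpha> < 2"
begin

definition R :: "real \<Rightarrow> real \<Rightarrow> real" where
  "R s t = (t powr \<alpha> + s powr \<alpha> - \<bar>t - s\<bar> powr \<alpha>) / 2"

text \<open>The continuation to negative times is by the value at \<open>0\<close>, not by zero, so
  that the path is continuous for every \<open>\<omega>\<close> in the space; both continuations
  agree almost surely by \<open>AE_X_0\<close>.\<close>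

definition path :: "'a \<Rightarrow> real \<Rightarrow> real" where "path \<omega> s = X (max 0 s) \<omega>"

text \<open>The definition of a Gaussian process sums over sets of times. Here the times form a
  family with possible repetitions, so the coefficients of equal times are collected.\<close>

lemma gaussian_sum:
  assumes K: "finite K" "\<And>k. k \<in> K \<Longrightarrow> 0 \<le> \<tau> k"
  shows "gaussian_rv M (\<lambda>\<omega>. \<Sum>k\<in>K. c k * X (\<tau> k) \<omega>)"
proof -
  have "(\<Sum>k\<in>K. c k * X (\<tau> k) \<omega>) = (\<Sum>t\<in>\<tau> ` K. (\<Sum>k | k \<in> K \<and> \<tau> k = t. c k) * X t \<omega>)" for \<omega>
  proof -
    have "(\<Sum>k\<in>K. c k * X (\<tau> k) \<omega>) = (\<Sum>t\<in>\<tau> ` K. \<Sum>k | k \<in> K \<and> \<tau> k = t. c k * X (\<tau> k) \<omega>)"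
      by (rule sum.image_gen[OF K(1)])
    also have "\<dots> = (\<Sum>t\<in>\<tau> ` K. (\<Sum>k | k \<in> K \<and> \<tau> k = t. c k) * X t \<omega>)"
      unfolding sum_distrib_right by (intro sum.cong refl) simp
    finally show ?thesis .
  qed
  moreover have "gaussian_rv M (\<lambda>\<omega>. \<Sum>t\<in>\<tau> ` K. (\<Sum>k | k \<in> K \<and> \<tau> k = t. c k) * X t \<omega>)"
  proof -
    have "gaussian_process M {0..} X" using fbm by (simp add: fractional_brownian_motion_def)
    then have gp: "finite J \<Longrightarrow> J \<subseteq> {0..} \<Longrightarrow> gaussian_rv M (\<lambda>\<omega>. \<Sum>t\<in>J. d t * X t \<omega>)" for J d
      by (simp only: gaussian_process_def)
    show ?thesis by (rule gp) (use K in auto)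
  qed
  ultimately show ?thesis by simp
qed

lemma gaussian_X: "0 \<le> t \<Longrightarrow> gaussian_rv M (X t)"
  using gaussian_sum[of "{()}" "\<lambda>_. t" "\<lambda>_. 1"] by simp

lemma X_measurable [measurable (raw)]: "0 \<le> t \<Longrightarrow> X t \<in> borel_measurable M"
  using gaussian_X by (simp add: gaussian_rv_def)

lemma X_mean: "0 \<le> t \<Longrightarrow> (\<integral>\<omega>. X t \<omega> \<partial>M) = 0"
  and X_cov: "0 \<le> s \<Longrightarrow> 0 \<le> t \<Longrightarrow> (\<integral>\<omega>. X s \<omega> * X t \<omega> \<partial>M) = R s t"
  and X_cont: "\<omega> \<in> space M \<Longrightarrow> continuous_on {0..} (\<lambda>t. X t \<omega>)"
  using fbm by (auto simp: fractional_brownian_motion_def R_def)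

lemma X_integrable: "0 \<le> t \<Longrightarrow> integrable M (X t)"
  using gaussian_rv_integrable[OF gaussian_X] by blast

lemma X_prod_integrable:
  assumes "0 \<le> s" "0 \<le> t" shows "integrable M (\<lambda>\<omega>. X s \<omega> * X t \<omega>)"
proof -
  have [measurable]: "X s \<in> borel_measurable M" "X t \<in> borel_measurable M" using assms by auto
  have "integrable M (\<lambda>\<omega>. (X s \<omega>)\<^sup>2 + (X t \<omega>)\<^sup>2)"
    using gaussian_rv_integrable(2)[OF gaussian_X] assms by simp
  then show ?thesis
  proof (rule Bochner_Integration.integrable_bound)
    show "AE \<omega> in M. norm (X s \<omega> * X t \<omega>) \<le> norm ((X s \<omega>)\<^sup>2 + (X t \<omega>)\<^sup>2)"
    proof (intro AE_I2)
      fix \<omega>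
      have "2 * (\<bar>X s \<omega>\<bar> * \<bar>X t \<omega>\<bar>) \<le> (X s \<omega>)\<^sup>2 + (X t \<omega>)\<^sup>2"
        using sum_squares_bound[of "\<bar>X s \<omega>\<bar>" "\<bar>X t \<omega>\<bar>"] by simp
      moreover have "0 \<le> \<bar>X s \<omega>\<bar> * \<bar>X t \<omega>\<bar>" by simp
      ultimately show "norm (X s \<omega> * X t \<omega>) \<le> norm ((X s \<omega>)\<^sup>2 + (X t \<omega>)\<^sup>2)"
        unfolding real_norm_def abs_mult by linarith
    qed
  qed measurable
qed

lemma sum_moments:
  assumes K: "finite K" "\<And>k. k \<in> K \<Longrightarrow> 0 \<le> \<tau> k"
  shows "(\<integral>\<omega>. (\<Sum>k\<in>K. c k * X (\<tau> k) \<omega>) \<partial>M) = 0"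
    "(\<integral>\<omega>. (\<Sum>k\<in>K. c k * X (\<tau> k) \<omega>)\<^sup>2 \<partial>M) = (\<Sum>j\<in>K. \<Sum>k\<in>K. c j * c k * R (\<tau> j) (\<tau> k))"
proof -
  show "(\<integral>\<omega>. (\<Sum>k\<in>K. c k * X (\<tau> k) \<omega>) \<partial>M) = 0"
    using K by (subst Bochner_Integration.integral_sum) (auto simp: X_integrable X_mean)
  have "(\<integral>\<omega>. (\<Sum>k\<in>K. c k * X (\<tau> k) \<omega>)\<^sup>2 \<partial>M) = (\<integral>\<omega>. (\<Sum>j\<in>K. \<Sum>k\<in>K. (c j * c k) * (X (\<tau> j) \<omega> * X (\<tau> k) \<omega>)) \<partial>M)"
    by (simp add: power2_eq_square sum_product mult_ac)
  also have "\<dots> = (\<Sum>j\<in>K. (\<integral>\<omega>. (\<Sum>k\<in>K. (c j * c k) * (X (\<tau> j) \<omega> * X (\<tau> k) \<omega>)) \<partial>M))"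
    using K by (intro Bochner_Integration.integral_sum Bochner_Integration.integrable_sum
        integrable_mult_right X_prod_integrable)
  also have "\<dots> = (\<Sum>j\<in>K. \<Sum>k\<in>K. (\<integral>\<omega>. (c j * c k) * (X (\<tau> j) \<omega> * X (\<tau> k) \<omega>) \<partial>M))"
    using K by (intro sum.cong refl Bochner_Integration.integral_sum integrable_mult_right X_prod_integrable)
  also have "\<dots> = (\<Sum>j\<in>K. \<Sum>k\<in>K. c j * c k * R (\<tau> j) (\<tau> k))"
    using K by (intro sum.cong refl) (simp add: X_cov)
  finally show "(\<integral>\<omega>. (\<Sum>k\<in>K. c k * X (\<tau> k) \<omega>)\<^sup>2 \<partial>M) = (\<Sum>j\<in>K. \<Sum>k\<in>K. c j * c k * R (\<tau> j) (\<tau> k))" .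
qed

lemma cos_gaussian_sum:
  assumes K: "finite K" "\<And>k. k \<in> K \<Longrightarrow> 0 \<le> \<tau> k"
  shows "cos_gaussian M (\<lambda>\<omega>. \<Sum>k\<in>K. c k * X (\<tau> k) \<omega>) (\<Sum>j\<in>K. \<Sum>k\<in>K. c j * c k * R (\<tau> j) (\<tau> k))"
  using gaussian_sum[OF K] sum_moments[OF K] by (intro gaussian_rv_cos_gaussian) auto

lemma increment:
  assumes "0 \<le> s" "0 \<le> t"
  shows "gaussian_rv M (\<lambda>\<omega>. X t \<omega> - X s \<omega>)" "(\<integral>\<omega>. X t \<omega> - X s \<omega> \<partial>M) = 0"
    "(\<integral>\<omega>. (X t \<omega> - X s \<omega>)\<^sup>2 \<partial>M) = \<bar>t - s\<bar> powr \<alpha>"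
proof -
  let ?c = "\<lambda>b. if b then 1 else - 1 :: real" and ?\<tau> = "\<lambda>b. if b then t else s"
  have eq: "(\<Sum>b\<in>UNIV. ?c b * X (?\<tau> b) \<omega>) = X t \<omega> - X s \<omega>" for \<omega>
    by (simp add: UNIV_bool)
  show "gaussian_rv M (\<lambda>\<omega>. X t \<omega> - X s \<omega>)" "(\<integral>\<omega>. X t \<omega> - X s \<omega> \<partial>M) = 0"
    using gaussian_sum[of UNIV ?\<tau> ?c] sum_moments(1)[of UNIV ?\<tau> ?c] assms unfolding eq by auto
  show "(\<integral>\<omega>. (X t \<omega> - X s \<omega>)\<^sup>2 \<partial>M) = \<bar>t - s\<bar> powr \<alpha>"
    using sum_moments(2)[of UNIV ?\<tau> ?c] assms unfolding eq
    by (simp add: UNIV_bool R_def abs_minus_commute field_simps)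
qed

lemma AE_X_0: "AE \<omega> in M. X 0 \<omega> = 0"
proof -
  have "gaussian_rv M (X 0)" "(\<integral>\<omega>. X 0 \<omega> \<partial>M) = 0" by (auto intro: gaussian_X X_mean)
  moreover have "(\<integral>\<omega>. (X 0 \<omega>)\<^sup>2 \<partial>M) = 0" using X_cov[of 0 0] by (simp add: R_def power2_eq_square)
  ultimately show ?thesis using gaussian_rv_centered[of "X 0" 0] by auto
qed

lemma path_cont: "\<omega> \<in> space M \<Longrightarrow> continuous_on UNIV (path \<omega>)"
  unfolding path_def by (rule continuous_on_compose2[OF X_cont]) (auto intro!: continuous_intros)

lemma path_measurable [measurable]: "(\<lambda>\<omega>. path \<omega> s) \<in> borel_measurable M"
  unfolding path_def by (intro X_measurable) simp

lemma continuous_abs_powr: "continuous_on A f \<Longrightarrow> continuous_on A (\<lambda>x. \<bar>f x :: real\<bar> powr \<alpha>)"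
  using \<alpha> by (intro continuous_on_powr' continuous_intros) auto

text \<open>The covariance of \<open>path\<close>, continuous on the whole plane, as the convergence
  of the double Riemann sums requires.\<close>

definition Rm :: "real \<Rightarrow> real \<Rightarrow> real" where "Rm s t = R (max 0 s) (max 0 t)"

lemma continuous_Rm:
  assumes "continuous_on A f" "continuous_on A g"
  shows "continuous_on A (\<lambda>x. Rm (f x) (g x))"
proof -
  have "Rm s t = (\<bar>max 0 t\<bar> powr \<alpha> + \<bar>max 0 s\<bar> powr \<alpha> - \<bar>max 0 t - max 0 s\<bar> powr \<alpha>) / 2" for s t
    by (simp add: Rm_def R_def)
  then show ?thesis
    using assms by (simp only:) (intro continuous_on_divide continuous_on_diff continuous_on_add
      continuous_abs_powr continuous_on_max continuous_on_const, auto)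
qed

end

section \<open>Hoelder regularity and occupation measure of the Gaussian path\<close>

context fbm
begin

text \<open>Kolmogorov's criterion on the dyadic points of \<open>{0..T}\<close>: by Borel-Cantelli
  all increments of high level are small, and \<open>dyadic_increments_imp_holder\<close> passes to
  all times by continuity.\<close>

lemma AE_holder:
  assumes \<gamma>: "0 < \<gamma>" "\<gamma> < \<alpha> / 2"
  shows "AE \<omega> in M. \<forall>T::nat. \<exists>n0 C. \<forall>s t. s \<in> {0..<real T} \<longrightarrow> t \<in> {0..<real T} \<longrightarrow> \<bar>s - t\<bar> \<le> (1 / 2) ^ n0 \<longrightarrow>
    \<bar>X s \<omega> - X t \<omega>\<bar> \<le> C * \<bar>s - t\<bar> powr \<gamma>"
  unfolding AE_all_countable
proof
  fix T :: nat
  \<comment> \<open>Chosen so that \<open>p * (\<alpha> - 2 * \<gamma>)\<close> exceeds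
    \<open>1\<close>: the moment bound then beats the number \<open>T * 2 ^ n\<close> of increments
    at level \<open>n\<close>.\<close>
  obtain p :: nat where p: "1 / (\<alpha> - 2 * \<gamma>) < real p" using reals_Archimedean2 by blast
  define q where "q = 2 powr (- \<gamma>)"
  define c where "c = (fact (2 * p) / (2 ^ p * fact p) :: real)"
  \<comment> \<open>Per level, the number of increments doubles and each tail bound shrinks by
    \<open>2 powr (- p * \<alpha>)\<close> from the variance and grows by
    \<open>2 powr (2 * p * \<gamma>)\<close> from the threshold; \<open>r\<close> is the
    product.\<close>
  define r where "r = 2 powr (1 - real p * (\<alpha> - 2 * \<gamma>))"
  have "1 < real p * (\<alpha> - 2 * \<gamma>)" using p \<gamma> by (simp add: divide_less_eq)
  then have r: "0 < r" "r < 1" unfolding r_def by (auto intro!: powr_less_one)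
  have q: "0 < q" by (simp add: q_def)
  have c0: "0 \<le> c" by (simp add: c_def)
  define A where "A n = (\<Union>k\<in>{..<T * 2 ^ n}. {\<omega> \<in> space M. q ^ n < \<bar>X (real (Suc k) / 2 ^ n) \<omega> - X (real k / 2 ^ n) \<omega>\<bar>})" for n
  have [measurable]: "A n \<in> sets M" for n unfolding A_def by measurable
  have mA: "measure M (A n) \<le> real T * c * r ^ n" for n
  proof -
    have "measure M (A n) \<le> (\<Sum>k<T * 2 ^ n. measure M {\<omega> \<in> space M. q ^ n < \<bar>X (real (Suc k) / 2 ^ n) \<omega> - X (real k / 2 ^ n) \<omega>\<bar>})"
      unfolding A_def by (intro finite_measure_subadditive_finite) auto
    also have "\<dots> \<le> (\<Sum>k<T * 2 ^ n. c * ((1 / 2 ^ n) powr \<alpha>) ^ p / (q ^ n) ^ (2 * p))"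
    proof (intro sum_mono)
      fix k
      have d: "real (Suc k) / 2 ^ n - real k / 2 ^ n = 1 / 2 ^ n" by (simp add: diff_divide_distrib[symmetric])
      show "measure M {\<omega> \<in> space M. q ^ n < \<bar>X (real (Suc k) / 2 ^ n) \<omega> - X (real k / 2 ^ n) \<omega>\<bar>}
        \<le> c * ((1 / 2 ^ n) powr \<alpha>) ^ p / (q ^ n) ^ (2 * p)"
        using gaussian_rv_tail[OF increment[of "real k / 2 ^ n" "real (Suc k) / 2 ^ n"], of "q ^ n" p] q
        unfolding c_def d by simp
    qed
    also have "\<dots> = real T * c * (2 ^ n * ((1 / 2 ^ n) powr \<alpha>) ^ p / (q ^ n) ^ (2 * p))" by simp
    also have "2 ^ n * ((1 / 2 ^ n) powr \<alpha>) ^ p / (q ^ n) ^ (2 * p) = r ^ n"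
    proof -
      have p2: "2 ^ n = 2 powr real n" by (simp add: powr_realpow)
      have "((1 / 2 ^ n) powr \<alpha>) ^ p = 2 powr (- (real n * \<alpha> * real p))"
      proof -
        have "1 / (2 powr real n) = 2 powr (- real n)" by (simp add: powr_minus_divide)
        then show ?thesis unfolding p2 by (simp add: powr_powr powr_power mult_ac)
      qed
      moreover have "(q ^ n) ^ (2 * p) = 2 powr (- (\<gamma> * real n * (2 * real p)))"
        by (simp add: q_def powr_power mult_ac flip: power_mult)
      moreover have "r ^ n = 2 powr ((1 - real p * (\<alpha> - 2 * \<gamma>)) * real n)"
        by (simp add: r_def powr_power mult_ac)
      ultimately show ?thesis unfolding p2
        by (simp flip: powr_add powr_diff add: algebra_simps)
    qed
    finally show ?thesis .
  qed
  have "AE \<omega> in M. \<forall>\<^sub>F n in sequentially. \<omega> \<in> space M - A n"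
  proof (rule borel_cantelli_AE1)
    show "summable (\<lambda>n. measure M (A n))"
    proof (rule summable_comparison_test'[where N = 0])
      show "summable (\<lambda>n. real T * c * r ^ n)" using r by (intro summable_mult summable_geometric) auto
    qed (use mA in auto)
  qed (auto simp: emeasure_eq_measure)
  then show "AE \<omega> in M. \<exists>n0 C. \<forall>s t. s \<in> {0..<real T} \<longrightarrow> t \<in> {0..<real T} \<longrightarrow> \<bar>s - t\<bar> \<le> (1 / 2) ^ n0 \<longrightarrow>
    \<bar>X s \<omega> - X t \<omega>\<bar> \<le> C * \<bar>s - t\<bar> powr \<gamma>"
    using AE_space
  proof eventually_elim
    case (elim \<omega>)
    then obtain n0 where n0: "\<And>n. n0 \<le> n \<Longrightarrow> \<omega> \<notin> A n" by (auto simp: eventually_sequentially)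
    have "\<bar>X (real (Suc k) / 2 ^ n) \<omega> - X (real k / 2 ^ n) \<omega>\<bar> \<le> (2 powr (- \<gamma>)) ^ n"
      if "n0 \<le> n" "k < T * 2 ^ n" for n k
      using n0[OF that(1)] that(2) elim(2) unfolding A_def q_def by (force simp: not_less)
    from dyadic_increments_imp_holder[OF X_cont[OF elim(2)] \<gamma>(1) this]
    show ?case by blast
  qed
qed

text \<open>The \<open>\<delta>\<close>-close pairs of times of the path have measure \<open>O(\<delta>)\<close> in the mean, because
  \<open>\<bar>t - s\<bar> powr (- \<alpha> / 2)\<close> is integrable on bounded squares.\<close>

lemma nn_integral_dist_powr_le:
  assumes "0 \<le> b" "-1 < (e::real)"
  shows "(\<integral>\<^sup>+s\<in>{0..b}. ennreal (\<bar>t - s\<bar> powr e) \<partial>lborel) \<le> ennreal (2 * (\<bar>t\<bar> + b) powr (e + 1) / (e + 1))"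
proof -
  define m where "m = \<bar>t\<bar> + b"
  have m0: "0 \<le> m" using assms by (simp add: m_def)
  have one: "(\<integral>\<^sup>+x\<in>{0..m}. ennreal (x powr e) \<partial>lborel) = ennreal (m powr (e + 1) / (e + 1))"
  proof -
    have "((\<lambda>x. x powr e) has_integral (m powr (e + 1) / (e + 1))) {0..m}"
      using assms m0 by (intro has_integral_powr_from_0)
    then have "(\<integral>\<^sup>+x. ennreal (indicator {0..m} x * x powr e) \<partial>lborel) = ennreal (m powr (e + 1) / (e + 1))"
      by (intro nn_integral_has_integral_lebesgue) auto
    moreover have "(\<integral>\<^sup>+x. ennreal (indicator {0..m} x * x powr e) \<partial>lborel) = (\<integral>\<^sup>+x\<in>{0..m}. ennreal (x powr e) \<partial>lborel)"
      by (intro nn_integral_cong) (auto simp: indicator_def)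
    ultimately show ?thesis by simp
  qed
  have "(\<integral>\<^sup>+s\<in>{0..b}. ennreal (\<bar>t - s\<bar> powr e) \<partial>lborel) \<le>
    (\<integral>\<^sup>+s. ennreal ((s - t) powr e) * indicator {0..m} (s - t) + ennreal ((t - s) powr e) * indicator {0..m} (t - s) \<partial>lborel)"
    by (intro nn_integral_mono) (auto simp: indicator_def m_def abs_if split: if_splits)
  also have "\<dots> = (\<integral>\<^sup>+s. ennreal ((s - t) powr e) * indicator {0..m} (s - t) \<partial>lborel)
    + (\<integral>\<^sup>+s. ennreal ((t - s) powr e) * indicator {0..m} (t - s) \<partial>lborel)"
    by (intro nn_integral_add) measurable
  also have "(\<integral>\<^sup>+s. ennreal ((s - t) powr e) * indicator {0..m} (s - t) \<partial>lborel) = (\<integral>\<^sup>+x\<in>{0..m}. ennreal (x powr e) \<partial>lborel)"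
    by (subst (2) nn_integral_real_affine[where c = 1 and t = "- t"]) auto
  also have "(\<integral>\<^sup>+s. ennreal ((t - s) powr e) * indicator {0..m} (t - s) \<partial>lborel) = (\<integral>\<^sup>+x\<in>{0..m}. ennreal (x powr e) \<partial>lborel)"
    by (subst (2) nn_integral_real_affine[where c = "-1" and t = t]) auto
  finally show ?thesis unfolding one m_def[symmetric] using assms
    by (simp flip: ennreal_plus)
qed

end

text \<open>Rounding the time to a grid gives a jointly measurable function, since countably many
  times occur, and continuity in time recovers the process in the limit. This justifies the
  applications of Tonelli to time and chance.\<close>

lemma measurable_path_pair:
  fixes Z :: "'a \<Rightarrow> real \<Rightarrow> real"
  assumes m: "\<And>t. (\<lambda>\<omega>. Z \<omega> t) \<in> borel_measurable M"
    and c: "\<And>\<omega>. \<omega> \<in> space M \<Longrightarrow> continuous_on UNIV (Z \<omega>)"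
  shows "(\<lambda>p. Z (fst p) (snd p)) \<in> borel_measurable (M \<Otimes>\<^sub>M borel)"
proof (rule borel_measurable_LIMSEQ_real)
  let ?f = "\<lambda>n t. real_of_int \<lfloor>real (Suc n) * t\<rfloor> / real (Suc n)"
  show "(\<lambda>n. Z (fst p) (?f n (snd p))) \<longlonglongrightarrow> Z (fst p) (snd p)" if "p \<in> space (M \<Otimes>\<^sub>M borel)" for p
    using c that by (intro continuous_on_tendsto_compose[OF c floor_div_tendsto]) (auto simp: space_pair_measure)
  show "(\<lambda>p. Z (fst p) (?f n (snd p))) \<in> borel_measurable (M \<Otimes>\<^sub>M borel)" for n
    by (rule measurable_compose_countable'[where I = UNIV and g = "\<lambda>p. \<lfloor>real (Suc n) * snd p\<rfloor>"
        and f = "\<lambda>k p. Z (fst p) (real_of_int k / real (Suc n))"])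
      (auto intro!: measurable_compose[OF measurable_fst m])
qed

context fbm
begin

lemma path_pair_measurable [measurable]:
  "(\<lambda>p. path (fst p) (snd p)) \<in> borel_measurable (M \<Otimes>\<^sub>M borel)"
  by (intro measurable_path_pair path_measurable path_cont)

lemma measurable_path [measurable (raw)]:
  assumes [measurable]: "g \<in> measurable N M" "h \<in> borel_measurable N"
  shows "(\<lambda>x. path (g x) (h x)) \<in> borel_measurable N"
  using measurable_compose[OF _ path_pair_measurable, of "\<lambda>x. (g x, h x)" N] by simp

lemma AE_liminf_close_pairs:
  assumes I [measurable]: "I \<in> sets borel" and b: "I \<subseteq> {0..b}"
  shows "AE \<omega> in M. liminf (\<lambda>n. (\<integral>\<^sup>+t\<in>I. (\<integral>\<^sup>+s\<in>I. indicator {..1 / real (Suc n)} \<bar>path \<omega> t - path \<omega> s\<bar> \<partial>lborel) \<partial>lborel)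
     / ennreal (1 / real (Suc n))) < \<infinity>"
proof (cases "I = {}")
  case False
  then have b0: "0 \<le> b" using b by force
  define h where "h n \<omega> = (\<integral>\<^sup>+t\<in>I. (\<integral>\<^sup>+s\<in>I. indicator {..1 / real (Suc n)} \<bar>path \<omega> t - path \<omega> s\<bar> \<partial>lborel) \<partial>lborel)
     / ennreal (1 / real (Suc n))" for n \<omega>
  have ieq: "indicator {..d} \<bar>x - y\<bar> = (of_bool (\<bar>x - y\<bar> \<le> d) :: ennreal)" for d x y :: real
    by (simp add: indicator_def)
  have hm [measurable]: "h n \<in> borel_measurable M" for n
    unfolding h_def ieq by measurable
  define C where "C = 2 * (2 * b) powr (- \<alpha> / 2 + 1) / (- \<alpha> / 2 + 1) * b"
  have le: "(\<integral>\<^sup>+\<omega>. h n \<omega> \<partial>M) \<le> ennreal C" for n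
  proof -
    define d where "d = 1 / real (Suc n)"
    have d: "0 < d" by (simp add: d_def)
    interpret pair_sigma_finite M lborel ..
    have "(\<integral>\<^sup>+\<omega>. h n \<omega> \<partial>M) = (\<integral>\<^sup>+\<omega>. (\<integral>\<^sup>+t\<in>I. (\<integral>\<^sup>+s\<in>I. indicator {..d} \<bar>path \<omega> t - path \<omega> s\<bar> \<partial>lborel) \<partial>lborel) \<partial>M) / ennreal d"
      unfolding h_def d_def[symmetric] ieq by (intro nn_integral_divide) measurable
    note hY = this
    have "(\<integral>\<^sup>+\<omega>. (\<integral>\<^sup>+t\<in>I. (\<integral>\<^sup>+s\<in>I. indicator {..d} \<bar>path \<omega> t - path \<omega> s\<bar> \<partial>lborel) \<partial>lborel) \<partial>M)
      = (\<integral>\<^sup>+t. (\<integral>\<^sup>+\<omega>. (\<integral>\<^sup>+s\<in>I. indicator {..d} \<bar>path \<omega> t - path \<omega> s\<bar> \<partial>lborel) * indicator I t \<partial>M) \<partial>lborel)"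
      unfolding ieq by (rule Fubini'[symmetric]) measurable
    also have "\<dots> = (\<integral>\<^sup>+t\<in>I. (\<integral>\<^sup>+\<omega>. (\<integral>\<^sup>+s\<in>I. indicator {..d} \<bar>path \<omega> t - path \<omega> s\<bar> \<partial>lborel) \<partial>M) \<partial>lborel)"
      unfolding ieq by (intro nn_integral_cong nn_integral_multc) measurable
    also have "\<dots> = (\<integral>\<^sup>+t\<in>I. (\<integral>\<^sup>+s. (\<integral>\<^sup>+\<omega>. indicator {..d} \<bar>path \<omega> t - path \<omega> s\<bar> * indicator I s \<partial>M) \<partial>lborel) \<partial>lborel)"
      unfolding ieq by (intro nn_integral_cong arg_cong2[where f = "(*)"] Fubini'[symmetric] refl) measurable
    also have "\<dots> = (\<integral>\<^sup>+t\<in>I. (\<integral>\<^sup>+s\<in>I. (\<integral>\<^sup>+\<omega>. indicator {..d} \<bar>path \<omega> t - path \<omega> s\<bar> \<partial>M) \<partial>lborel) \<partial>lborel)"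
      unfolding ieq by (intro nn_integral_cong arg_cong2[where f = "(*)"] nn_integral_multc refl) measurable
    also have "\<dots> \<le> (\<integral>\<^sup>+t\<in>I. ennreal (d * (2 * (2 * b) powr (- \<alpha> / 2 + 1) / (- \<alpha> / 2 + 1))) \<partial>lborel)"
    proof (intro nn_integral_mono)
      fix t
      show "(\<integral>\<^sup>+s\<in>I. (\<integral>\<^sup>+\<omega>. indicator {..d} \<bar>path \<omega> t - path \<omega> s\<bar> \<partial>M) \<partial>lborel) * indicator I t
        \<le> ennreal (d * (2 * (2 * b) powr (- \<alpha> / 2 + 1) / (- \<alpha> / 2 + 1))) * indicator I t"
      proof (cases "t \<in> I")
        case True
        then have t: "0 \<le> t" "t \<le> b" using b by auto
        have "(\<integral>\<^sup>+s\<in>I. (\<integral>\<^sup>+\<omega>. indicator {..d} \<bar>path \<omega> t - path \<omega> s\<bar> \<partial>M) \<partial>lborel)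
          \<le> (\<integral>\<^sup>+s\<in>{0..b}. ennreal d * ennreal (\<bar>t - s\<bar> powr (- \<alpha> / 2)) \<partial>lborel)"
        proof (rule nn_integral_mono_AE)
          \<comment> \<open>The time \<open>s = t\<close> is excluded because the increment
            degenerates there; it is a null set.\<close>
          show "AE s in lborel. (\<integral>\<^sup>+\<omega>. indicator {..d} \<bar>path \<omega> t - path \<omega> s\<bar> \<partial>M) * indicator I s
            \<le> ennreal d * ennreal (\<bar>t - s\<bar> powr (- \<alpha> / 2)) * indicator {0..b} s"
            using AE_lborel_singleton[of t]
          proof eventually_elim
            case (elim s)
            show ?case
            proof (cases "s \<in> I")
              case True
              then have s: "0 \<le> s" "s \<le> b" using b by auto
              have pos: "0 < \<bar>t - s\<bar> powr \<alpha>" using elim by simp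
              have "(\<integral>\<^sup>+\<omega>. indicator {..d} \<bar>X t \<omega> - X s \<omega>\<bar> \<partial>M) \<le> ennreal (d / sqrt (\<bar>t - s\<bar> powr \<alpha>))"
                using d by (intro gaussian_rv_small_ball[OF increment[OF s(1) t(1)] pos]) simp
              also have "d / sqrt (\<bar>t - s\<bar> powr \<alpha>) = d * \<bar>t - s\<bar> powr (- \<alpha> / 2)"
                using elim by (simp add: powr_minus_divide powr_half_sqrt[symmetric] powr_powr)
              finally show ?thesis using True s t d by (simp add: path_def ennreal_mult)
            qed simp
          qed
        qed
        also have "\<dots> = ennreal d * (\<integral>\<^sup>+s\<in>{0..b}. ennreal (\<bar>t - s\<bar> powr (- \<alpha> / 2)) \<partial>lborel)"
          by (simp add: mult.assoc nn_integral_cmult)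
        also have "\<dots> \<le> ennreal d * ennreal (2 * (\<bar>t\<bar> + b) powr (- \<alpha> / 2 + 1) / (- \<alpha> / 2 + 1))"
          using b0 \<alpha> by (intro mult_left_mono nn_integral_dist_powr_le) auto
        also have "\<dots> \<le> ennreal d * ennreal (2 * (2 * b) powr (- \<alpha> / 2 + 1) / (- \<alpha> / 2 + 1))"
          using t b0 \<alpha> by (intro mult_left_mono ennreal_leI divide_right_mono powr_mono2) auto
        also have "\<dots> = ennreal (d * (2 * (2 * b) powr (- \<alpha> / 2 + 1) / (- \<alpha> / 2 + 1)))"
          using d \<alpha> by (intro ennreal_mult[symmetric]) auto
        finally show ?thesis using True by simp
      qed simp
    qed
    also have "\<dots> \<le> (\<integral>\<^sup>+t\<in>{0..b}. ennreal (d * (2 * (2 * b) powr (- \<alpha> / 2 + 1) / (- \<alpha> / 2 + 1))) \<partial>lborel)"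
      using b by (intro nn_integral_mono mult_left_mono) (auto simp: indicator_def)
    also have "\<dots> = ennreal (d * (2 * (2 * b) powr (- \<alpha> / 2 + 1) / (- \<alpha> / 2 + 1))) * ennreal b"
      using b0 by (subst nn_integral_cmult_indicator) auto
    also have "\<dots> = ennreal (d * C)"
      using d b0 \<alpha> by (subst ennreal_mult[symmetric]) (auto simp: C_def)
    finally have "(\<integral>\<^sup>+\<omega>. h n \<omega> \<partial>M) \<le> ennreal (d * C) / ennreal d"
      unfolding hY by (rule divide_right_mono_ennreal)
    also have "\<dots> = ennreal C"
      using d b0 \<alpha> by (subst divide_ennreal) (auto simp: C_def)
    finally show ?thesis .
  qed
  \<comment> \<open>Fatou's lemma turns the bound on the means, uniform in \<open>n\<close>, into an
    almost surely finite lower limit.\<close>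
  have "(\<integral>\<^sup>+\<omega>. liminf (\<lambda>n. h n \<omega>) \<partial>M) \<le> liminf (\<lambda>n. \<integral>\<^sup>+\<omega>. h n \<omega> \<partial>M)"
    by (intro nn_integral_liminf) measurable
  also have "\<dots> \<le> ennreal C" using le by (intro Liminf_le) auto
  finally have "(\<integral>\<^sup>+\<omega>. liminf (\<lambda>n. h n \<omega>) \<partial>M) \<noteq> \<infinity>" by (auto simp: top_unique)
  then have "AE \<omega> in M. liminf (\<lambda>n. h n \<omega>) \<noteq> \<infinity>" by (intro nn_integral_PInf_AE) measurable
  then show ?thesis unfolding h_def by (auto simp: less_top)
qed (simp add: Liminf_const)

lemma AE_occupation_absolutely_continuous:
  assumes I: "I \<in> sets borel" "I \<subseteq> {0..b}"
  shows "AE \<omega> in M. absolutely_continuous lborel (occupation_measure (path \<omega>) I)"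
  using AE_liminf_close_pairs[OF I] AE_space
proof eventually_elim
  case (elim \<omega>)
  show ?case
    using borel_measurable_continuous_onI[OF path_cont[OF elim(2)]] I(1) _ LIMSEQ_Suc[OF lim_1_over_n] elim(1)
    by (rule occupation_absolutely_continuous) simp
qed

end

text \<open>Transfers absolute continuity from the fractional to the grey path. The factor must be
  positive: for \<open>c = 0\<close> the occupation measure is concentrated at
  \<open>0\<close>.\<close>

lemma occupation_measure_scale:
  fixes x :: "real \<Rightarrow> real"
  assumes x [measurable]: "x \<in> borel_measurable borel" and [measurable]: "I \<in> sets borel" and c: "0 < c"
    and ac: "absolutely_continuous lborel (occupation_measure x I)"
  shows "absolutely_continuous lborel (occupation_measure (\<lambda>t. c * x t) I)"
  unfolding absolutely_continuous_def
proof
  fix A :: "real set" assume A: "A \<in> null_sets lborel"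
  then have [measurable]: "A \<in> sets borel" by auto
  let ?A = "(\<lambda>z. c * z) -` A"
  have A' [measurable]: "?A \<in> sets borel" by (rule measurable_sets_borel[of "\<lambda>z. c * z" borel A]) measurable
  have "0 = emeasure lborel A" using A by auto
  also have "\<dots> = (\<integral>\<^sup>+z. indicator A z \<partial>lborel)" by simp
  also have "\<dots> = ennreal \<bar>c\<bar> * (\<integral>\<^sup>+z. indicator A (0 + c * z) \<partial>lborel)"
    using c by (intro nn_integral_real_affine) auto
  also have "(\<integral>\<^sup>+z. indicator A (0 + c * z) \<partial>lborel) = emeasure lborel ?A"
  proof -
    have "indicator A (0 + c * z) = (indicator ?A z :: ennreal)" for z by (simp add: indicator_def)
    then show ?thesis using nn_integral_indicator[of ?A lborel] A' by (simp only: sets_lborel)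
  qed
  finally have "?A \<in> null_sets lborel" using c by (auto simp: null_sets_def)
  then have n: "?A \<in> null_sets (occupation_measure x I)"
    using ac by (auto simp: absolutely_continuous_def)
  have r: "y \<in> borel_measurable (restrict_space lborel I)" if "y \<in> borel_measurable borel" for y :: "real \<Rightarrow> real"
    using that by (intro measurable_restrict_space1) simp
  have "emeasure (occupation_measure (\<lambda>t. c * x t) I) A = emeasure (occupation_measure x I) ?A"
    unfolding occupation_measure_def
    by (subst (1 2) emeasure_distr) (auto intro!: r arg_cong2[where f = emeasure])
  then show "A \<in> null_sets (occupation_measure (\<lambda>t. c * x t) I)"
    using n by (auto simp: null_sets_def occupation_measure_def)
qed

subsection \<open>The normalized derivative as a stationary Gaussian process\<close>

locale fbm_stieltjes = fbm M X \<alpha> + stieltjes_pair P N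
  for M :: "'a measure" and X \<alpha> P N
begin

text \<open>Cosines are bounded, so pointwise convergence of the variables and convergence of the
  variance parameters are enough.\<close>

lemma cos_gaussian_limit:
  fixes L :: "nat \<Rightarrow> 'a \<Rightarrow> real"
  assumes L: "\<And>n. cos_gaussian M (L n) (v n)" and v: "v \<longlonglongrightarrow> w"
    and l: "\<And>\<omega>. \<omega> \<in> space M \<Longrightarrow> (\<lambda>n. L n \<omega>) \<longlonglongrightarrow> K \<omega>"
  shows "cos_gaussian M K w"
proof -
  have [measurable]: "L n \<in> borel_measurable M" for n using L by (simp add: cos_gaussian_def)
  have Km [measurable]: "K \<in> borel_measurable M"
    by (rule borel_measurable_LIMSEQ_real[OF l]) auto
  have "(\<integral>\<omega>. cos (\<theta> * K \<omega>) \<partial>M) = exp (- \<theta>\<^sup>2 * w / 2)" for \<theta>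
  proof (rule LIMSEQ_unique)
    show "(\<lambda>n. \<integral>\<omega>. cos (\<theta> * L n \<omega>) \<partial>M) \<longlonglongrightarrow> (\<integral>\<omega>. cos (\<theta> * K \<omega>) \<partial>M)"
      by (rule integral_dominated_convergence[where w = "\<lambda>_. 1"]) (auto intro!: AE_I2 tendsto_intros l)
    have "(\<integral>\<omega>. cos (\<theta> * L n \<omega>) \<partial>M) = exp (- \<theta>\<^sup>2 * v n / 2)" for n
      using L unfolding cos_gaussian_def by blast
    then show "(\<lambda>n. \<integral>\<omega>. cos (\<theta> * L n \<omega>) \<partial>M) \<longlonglongrightarrow> exp (- \<theta>\<^sup>2 * w / 2)"
      by (simp only:) (intro tendsto_intros v, simp)
  qed
  then show ?thesis using Km by (simp add: cos_gaussian_def)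
qed

definition kern :: "real \<Rightarrow> real \<Rightarrow> (real \<Rightarrow> real) \<Rightarrow> (real \<Rightarrow> real) \<Rightarrow> real \<Rightarrow> real \<Rightarrow> real" where
  "kern a b p q u v = a * a * Rm (p u) (p v) + a * b * Rm (p u) (q v)
     + b * a * Rm (q u) (p v) + b * b * Rm (q u) (q v)"

text \<open>Riemann sums are finite Gaussian sums; both the sums and their variances converge. Two
  time maps are treated together, because the mixed moments call for all linear combinations of the
  process at two times.\<close>

lemma cos_gaussian_S:
  assumes p: "continuous_on UNIV p" and q: "continuous_on UNIV q"
  shows "cos_gaussian M (\<lambda>\<omega>. S (\<lambda>u. a * path \<omega> (p u) + b * path \<omega> (q u)))
    (S (\<lambda>u. S (\<lambda>v. kern a b p q u v)))"
proof (rule cos_gaussian_limit)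
  fix n
  \<comment> \<open>The Boolean component selects the time map, \<open>True\<close> for
    \<open>p\<close> and \<open>False\<close> for \<open>q\<close>, so that both families form a
    single Gaussian sum.\<close>
  define \<tau> where "\<tau> k = max 0 ((if snd k then p else q) (pt n (fst k)))" for k :: "int \<times> bool"
  define c where "c k = wt n (fst k) * (if snd k then a else b)" for k :: "int \<times> bool"
  have K: "finite (idx n \<times> (UNIV :: bool set))" "\<And>k. k \<in> idx n \<times> (UNIV :: bool set) \<Longrightarrow> 0 \<le> \<tau> k"
    by (auto simp: \<tau>_def)
  have 1: "(\<Sum>k\<in>idx n \<times> UNIV. c k * X (\<tau> k) \<omega>) =
    (\<Sum>k\<in>idx n. wt n k * (a * path \<omega> (p (pt n k)) + b * path \<omega> (q (pt n k))))" for \<omega>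
    unfolding sum.cartesian_product'
    by (intro sum.cong refl) (simp add: UNIV_bool c_def \<tau>_def path_def algebra_simps)
  have 2: "(\<Sum>j\<in>idx n \<times> UNIV. \<Sum>k\<in>idx n \<times> UNIV. c j * c k * R (\<tau> j) (\<tau> k)) =
    (\<Sum>j\<in>idx n. \<Sum>k\<in>idx n. wt n j * wt n k * kern a b p q (pt n j) (pt n k))"
    unfolding sum.cartesian_product'
    by (intro sum.cong refl)
      (simp add: UNIV_bool sum.distrib[symmetric] c_def \<tau>_def kern_def Rm_def algebra_simps)
  show "cos_gaussian M (\<lambda>\<omega>. \<Sum>k\<in>idx n. wt n k * (a * path \<omega> (p (pt n k)) + b * path \<omega> (q (pt n k))))
    (\<Sum>j\<in>idx n. \<Sum>k\<in>idx n. wt n j * wt n k * kern a b p q (pt n j) (pt n k))"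
    unfolding 1[symmetric] 2[symmetric] by (rule cos_gaussian_sum) (fact K(1), rule K(2))
next
  have "continuous_on UNIV (\<lambda>(u, v). kern a b p q u v)"
    unfolding kern_def case_prod_beta
    by (intro continuous_on_add continuous_on_mult continuous_on_const continuous_Rm
        continuous_on_compose2[OF p] continuous_on_compose2[OF q] continuous_on_fst continuous_on_snd continuous_on_id) auto
  then show "(\<lambda>n. \<Sum>j\<in>idx n. \<Sum>k\<in>idx n. wt n j * wt n k * kern a b p q (pt n j) (pt n k)) \<longlonglongrightarrow>
    S (\<lambda>u. S (\<lambda>v. kern a b p q u v))"
    by (rule riemann_tendsto2)
next
  fix \<omega> assume "\<omega> \<in> space M"
  then have "continuous_on UNIV (\<lambda>u. a * path \<omega> (p u) + b * path \<omega> (q u))"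
    using continuous_on_compose2[OF path_cont] p q by (intro continuous_intros) auto
  then show "(\<lambda>n. \<Sum>k\<in>idx n. wt n k * (a * path \<omega> (p (pt n k)) + b * path \<omega> (q (pt n k)))) \<longlonglongrightarrow>
    S (\<lambda>u. a * path \<omega> (p u) + b * path \<omega> (q u))"
    by (rule riemann_tendsto)
qed

text \<open>\<open>G \<epsilon> t\<close> is \<open>\<epsilon> powr (1 - \<alpha> / 2)\<close> times the derivative of the regularized path at \<open>t + \<epsilon>\<close>; the
  shift keeps all arguments of the path nonnegative, which makes the process stationary, with
  covariance \<open>\<rho> (\<bar>t - s\<bar> / \<epsilon>)\<close>.\<close>

definition \<rho> :: "real \<Rightarrow> real" where
  "\<rho> \<tau> = - (1 / 2) * S (\<lambda>u. S (\<lambda>v. \<bar>\<tau> + u - v\<bar> powr \<alpha>))"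

definition G :: "real \<Rightarrow> real \<Rightarrow> 'a \<Rightarrow> real" where
  "G \<epsilon> t \<omega> = \<epsilon> powr (- \<alpha> / 2) * S (\<lambda>u. path \<omega> (t + \<epsilon> * (1 - u)))"

lemma continuous_powr_diff: "continuous_on UNIV (\<lambda>(u, v). \<bar>\<tau> + u - v\<bar> powr \<alpha>)"
  unfolding case_prod_beta by (intro continuous_abs_powr continuous_intros)

text \<open>The summands of the covariance that depend on one time only are killed by one of the two
  signed integrals. What remains depends on the difference of the times, and scaling extracts
  \<open>\<epsilon> powr \<alpha>\<close>. On \<open>{-1..1}\<close> all arguments are nonnegative,
  so the truncation in \<open>Rm\<close> has no effect.\<close>

lemma S_S_Rm:
  assumes \<epsilon>: "0 < \<epsilon>" and st: "0 \<le> s" "0 \<le> t"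
  shows "S (\<lambda>u. S (\<lambda>v. Rm (t + \<epsilon> * (1 - u)) (s + \<epsilon> * (1 - v)))) = \<epsilon> powr \<alpha> * \<rho> ((s - t) / \<epsilon>)"
    (is "S (\<lambda>u. S (\<lambda>v. Rm (?p u) (?q v))) = _")
proof -
  let ?d = "\<lambda>u v. \<bar>(s - t) / \<epsilon> + u - v\<bar> powr \<alpha>"
  have pos: "0 \<le> x + \<epsilon> * (1 - u)" if "u \<in> {-1..1}" "0 \<le> x" for u x using that \<epsilon> by auto
  have cont: "continuous_on UNIV (\<lambda>v. Rm (?p u) (?q v))" "continuous_on UNIV (\<lambda>u. Rm (?p u) x)"
      "continuous_on UNIV (?d u)" "continuous_on UNIV (\<lambda>v. \<bar>?q v\<bar> powr \<alpha>)" for u x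
    by (intro continuous_Rm continuous_abs_powr continuous_intros)+
  have Rm_eq: "Rm (?p u) (?q v) = \<bar>?q v\<bar> powr \<alpha> / 2 + \<bar>?p u\<bar> powr \<alpha> / 2 - \<epsilon> powr \<alpha> / 2 * ?d u v"
    if "u \<in> {-1..1}" "v \<in> {-1..1}" for u v
  proof -
    have "?q v - ?p u = \<epsilon> * ((s - t) / \<epsilon> + u - v)" using \<epsilon> by (simp add: field_simps)
    then have "\<bar>?q v - ?p u\<bar> powr \<alpha> = \<epsilon> powr \<alpha> * ?d u v" using \<epsilon> by (simp add: abs_mult powr_mult)
    then show ?thesis using pos[OF that(1) st(2)] pos[OF that(2) st(1)] by (simp add: Rm_def R_def)
  qed
  define k where "k = S (\<lambda>v. \<bar>?q v\<bar> powr \<alpha> / 2)"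
  have inner: "S (\<lambda>v. Rm (?p u) (?q v)) = k - \<epsilon> powr \<alpha> / 2 * S (?d u)" if u: "u \<in> {-1..1}" for u
  proof -
    have "S (\<lambda>v. Rm (?p u) (?q v)) = S (\<lambda>v. \<bar>?q v\<bar> powr \<alpha> / 2 + \<bar>?p u\<bar> powr \<alpha> / 2 - \<epsilon> powr \<alpha> / 2 * ?d u v)"
      by (intro S_cong Rm_eq u borel_measurable_continuous_onI cont) (auto intro!: continuous_intros cont)
    also have "\<dots> = k - \<epsilon> powr \<alpha> / 2 * S (?d u)"
    proof -
      have ad: "adm (\<lambda>v. \<bar>?q v\<bar> powr \<alpha> / 2)" "adm (\<lambda>v. \<epsilon> powr \<alpha> / 2 * ?d u v)"
        by (intro adm_cmult adm_continuous continuous_intros cont; simp)+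
      show ?thesis
        unfolding k_def by (simp only: S_diff S_add S_const S_cmult adm_add adm_const ad)
    qed
    finally show ?thesis .
  qed
  have c2: "continuous_on UNIV (\<lambda>u. S (?d u))"
    using riemann_tendsto2(2)[OF continuous_powr_diff] .
  have c3: "continuous_on UNIV (\<lambda>u. S (\<lambda>v. Rm (?p u) (?q v)))"
    by (rule riemann_tendsto2(2)) (unfold case_prod_beta, intro continuous_Rm continuous_intros)
  have "S (\<lambda>u. S (\<lambda>v. Rm (?p u) (?q v))) = S (\<lambda>u. k - \<epsilon> powr \<alpha> / 2 * S (?d u))"
    by (intro S_cong inner borel_measurable_continuous_onI c3) (auto intro!: continuous_intros c2)
  also have "\<dots> = S (\<lambda>u. k) - S (\<lambda>u. \<epsilon> powr \<alpha> / 2 * S (?d u))"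
    by (intro S_diff adm_const adm_cmult adm_continuous c2)
  also have "\<dots> = - (\<epsilon> powr \<alpha> / 2) * S (\<lambda>u. S (?d u))"
    unfolding S_const S_cmult by simp
  finally show ?thesis by (simp add: \<rho>_def)
qed

text \<open>The two cross terms produce \<open>\<rho>\<close> at opposite arguments, so the
  covariance appears as their mean.\<close>

lemma cos_gaussian_G:
  assumes \<epsilon>: "0 < \<epsilon>" and st: "0 \<le> s" "0 \<le> t"
  shows "cos_gaussian M (\<lambda>\<omega>. a * G \<epsilon> t \<omega> + b * G \<epsilon> s \<omega>)
    ((a\<^sup>2 + b\<^sup>2) * \<rho> 0 + 2 * a * b * ((\<rho> ((s - t) / \<epsilon>) + \<rho> ((t - s) / \<epsilon>)) / 2))"
proof -
  let ?p = "\<lambda>u. t + \<epsilon> * (1 - u)" and ?q = "\<lambda>u. s + \<epsilon> * (1 - u)"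
  define e where "e = \<epsilon> powr (- \<alpha> / 2)"
  have ee: "e * e * \<epsilon> powr \<alpha> = 1" using \<epsilon> by (simp add: e_def flip: powr_add)
  have pq: "continuous_on UNIV ?p" "continuous_on UNIV ?q" by (intro continuous_intros)+
  have k: "S (\<lambda>u. S (\<lambda>v. kern (e * a) (e * b) ?p ?q u v)) =
      (e * a) * (e * a) * (\<epsilon> powr \<alpha> * \<rho> 0) + (e * a) * (e * b) * (\<epsilon> powr \<alpha> * \<rho> ((s - t) / \<epsilon>))
      + (e * b) * (e * a) * (\<epsilon> powr \<alpha> * \<rho> ((t - s) / \<epsilon>)) + (e * b) * (e * b) * (\<epsilon> powr \<alpha> * \<rho> 0)"
  proof -
    have in_cont: "continuous_on UNIV (\<lambda>v. Rm x (y + \<epsilon> * (1 - v)))" for x y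
      by (intro continuous_Rm continuous_intros)
    have out_cont: "continuous_on UNIV (\<lambda>u. S (\<lambda>v. Rm (x + \<epsilon> * (1 - u)) (y + \<epsilon> * (1 - v))))" for x y
      by (rule riemann_tendsto2(2)) (unfold case_prod_beta, intro continuous_Rm continuous_intros)
    have ad: "adm (\<lambda>v. Rm x (y + \<epsilon> * (1 - v)))" "adm (\<lambda>u. S (\<lambda>v. Rm (x + \<epsilon> * (1 - u)) (y + \<epsilon> * (1 - v))))" for x y
      by (intro adm_continuous in_cont out_cont)+
    have "S (\<lambda>v. kern (e * a) (e * b) ?p ?q u v) =
        (e * a) * (e * a) * S (\<lambda>v. Rm (?p u) (?p v)) + (e * a) * (e * b) * S (\<lambda>v. Rm (?p u) (?q v))
      + (e * b) * (e * a) * S (\<lambda>v. Rm (?q u) (?p v)) + (e * b) * (e * b) * S (\<lambda>v. Rm (?q u) (?q v))" for u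
      unfolding kern_def by (simp only: S_add S_cmult adm_add adm_cmult ad)
    then show ?thesis
      by (simp only: S_add S_cmult adm_add adm_cmult ad S_S_Rm[OF \<epsilon>] st) simp
  qed
  have eq: "S (\<lambda>u. e * a * path \<omega> (?p u) + e * b * path \<omega> (?q u)) = a * G \<epsilon> t \<omega> + b * G \<epsilon> s \<omega>"
    if "\<omega> \<in> space M" for \<omega>
  proof -
    have "adm (\<lambda>u. path \<omega> (y + \<epsilon> * (1 - u)))" for y
      by (intro adm_continuous continuous_on_compose2[OF path_cont[OF that]] continuous_intros) auto
    then show ?thesis by (simp only: S_add S_cmult adm_cmult) (simp add: G_def e_def mult_ac)
  qed
  have "(e * a) * (e * a) * (\<epsilon> powr \<alpha> * \<rho> 0) + (e * a) * (e * b) * (\<epsilon> powr \<alpha> * \<rho> ((s - t) / \<epsilon>))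
      + (e * b) * (e * a) * (\<epsilon> powr \<alpha> * \<rho> ((t - s) / \<epsilon>)) + (e * b) * (e * b) * (\<epsilon> powr \<alpha> * \<rho> 0)
    = (e * e * \<epsilon> powr \<alpha>) * (a * a * \<rho> 0 + a * b * \<rho> ((s - t) / \<epsilon>) + a * b * \<rho> ((t - s) / \<epsilon>) + b * b * \<rho> 0)"
    by (simp only: distrib_left mult_ac)
  also have "\<dots> = (a\<^sup>2 + b\<^sup>2) * \<rho> 0 + 2 * a * b * ((\<rho> ((s - t) / \<epsilon>) + \<rho> ((t - s) / \<epsilon>)) / 2)"
    unfolding ee by (simp add: power2_eq_square algebra_simps)
  finally have v: "S (\<lambda>u. S (\<lambda>v. kern (e * a) (e * b) ?p ?q u v)) = \<dots>" unfolding k .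
  have cg: "cos_gaussian M (\<lambda>\<omega>. S (\<lambda>u. e * a * path \<omega> (?p u) + e * b * path \<omega> (?q u)))
    ((a\<^sup>2 + b\<^sup>2) * \<rho> 0 + 2 * a * b * ((\<rho> ((s - t) / \<epsilon>) + \<rho> ((t - s) / \<epsilon>)) / 2))"
    using cos_gaussian_S[OF pq, of "e * a" "e * b"] unfolding v .
  show ?thesis
    by (rule cos_gaussian_limit[where L = "\<lambda>_. _", OF cg tendsto_const]) (simp add: eq)
qed

text \<open>The mean of a cosine is at most \<open>1\<close>, hence so is
  \<open>exp (- \<rho> 0 / 2)\<close>.\<close>

lemma \<rho>_0_nonneg: "0 \<le> \<rho> 0"
proof -
  have cg: "cos_gaussian M (G 1 0) (\<rho> 0)" using cos_gaussian_G[of 1 0 0 1 0] by simp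
  have [measurable]: "G 1 0 \<in> borel_measurable M" using cg by (simp add: cos_gaussian_def)
  have "exp (- \<rho> 0 / 2) = (\<integral>\<omega>. cos (1 * G 1 0 \<omega>) \<partial>M)"
    using cg unfolding cos_gaussian_def by (metis mult_minus_left mult_1 one_power2)
  also have "\<dots> \<le> (\<integral>\<omega>. 1 \<partial>M)" by (intro integral_mono integrable_cos_mult) auto
  finally show ?thesis by (simp add: prob_space)
qed

lemma cos_gaussian_G1:
  assumes "0 < \<epsilon>" "0 \<le> t" shows "cos_gaussian M (G \<epsilon> t) (\<rho> 0)"
  using cos_gaussian_G[OF assms(1) assms(2) assms(2), of 1 0] by simp

end

text \<open>Two applications of the mean value bound, one in each increment, leave the second
  derivative \<open>\<alpha> * (\<alpha> - 1) * x powr (\<alpha> - 2)\<close>.\<close>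

lemma mixed_difference_powr_le:
  fixes T u v \<alpha> :: real
  assumes \<alpha>: "0 < \<alpha>" "\<alpha> < 2" and T: "4 \<le> T" and uv: "\<bar>u\<bar> \<le> 1" "\<bar>v\<bar> \<le> 1"
  shows "\<bar>(T + u - v) powr \<alpha> - (T + u) powr \<alpha> - (T - v) powr \<alpha> + T powr \<alpha>\<bar> \<le> 2 * (T / 2) powr (\<alpha> - 2)"
proof -
  let ?I = "{T - 2..T + 2}"
  \<comment> \<open>All arguments lie in \<open>{T - 2..T + 2}\<close>, hence above
    \<open>T / 2\<close> as \<open>4 \<le> T\<close>, and the power decreases there; the factor
    \<open>2\<close> bounds \<open>\<alpha> * \<bar>\<alpha> - 1\<bar>\<close>.\<close>
  define K where "K = 2 * (T / 2) powr (\<alpha> - 2)"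
  have K0: "0 \<le> K" by (simp add: K_def)
  have d1: "((\<lambda>x. \<alpha> * x powr (\<alpha> - 1)) has_real_derivative \<alpha> * ((\<alpha> - 1) * x powr (\<alpha> - 2))) (at x)" if "x \<in> ?I" for x
    using that T by (auto intro!: derivative_eq_intros simp: algebra_simps)
  have b1: "norm (\<alpha> * ((\<alpha> - 1) * x powr (\<alpha> - 2))) \<le> K" if "x \<in> ?I" for x
  proof -
    have "x powr (\<alpha> - 2) \<le> (T / 2) powr (\<alpha> - 2)" using that T \<alpha> by (intro powr_mono2') auto
    then have "\<alpha> * (\<bar>\<alpha> - 1\<bar> * x powr (\<alpha> - 2)) \<le> 2 * (1 * (T / 2) powr (\<alpha> - 2))"
      using \<alpha> by (intro mult_mono) auto
    then show ?thesis using \<alpha> by (simp add: abs_mult K_def)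
  qed
  define \<phi> where "\<phi> x = (T + x - v) powr \<alpha> - (T + x) powr \<alpha>" for x
  have "norm (\<phi> u - \<phi> 0) \<le> K * norm (u - 0)"
  proof (rule field_differentiable_bound[of "{-1..1}" \<phi> "\<lambda>x. \<alpha> * (T + x - v) powr (\<alpha> - 1) - \<alpha> * (T + x) powr (\<alpha> - 1)"])
    fix x :: real assume x: "x \<in> {-1..1}"
    show "(\<phi> has_real_derivative \<alpha> * (T + x - v) powr (\<alpha> - 1) - \<alpha> * (T + x) powr (\<alpha> - 1)) (at x within {-1..1})"
      unfolding \<phi>_def using x T uv by (auto intro!: derivative_eq_intros)
    have "norm (\<alpha> * (T + x - v) powr (\<alpha> - 1) - \<alpha> * (T + x) powr (\<alpha> - 1)) \<le> K * norm ((T + x - v) - (T + x))"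
      using x uv by (intro field_differentiable_bound[of ?I, OF _ has_field_derivative_at_within[OF d1] b1]) auto
    also have "\<dots> \<le> K * 1" using uv K0 by (intro mult_left_mono) auto
    finally show "norm (\<alpha> * (T + x - v) powr (\<alpha> - 1) - \<alpha> * (T + x) powr (\<alpha> - 1)) \<le> K" by simp
  qed (use uv in auto)
  also have "\<dots> \<le> K * 1" using uv K0 by (intro mult_left_mono) auto
  finally show ?thesis by (simp add: \<phi>_def K_def)
qed

context fbm_stieltjes
begin

text \<open>The terms added in \<open>\<Delta>\<close> depend on at most one of \<open>u\<close> and
  \<open>v\<close>, so the signed integrals do not see them, while the integrand is now a second
  difference and thereby small.\<close>

lemma \<rho>_decay:
  assumes \<tau>: "4 \<le> \<bar>\<tau>\<bar>"
  shows "\<bar>\<rho> \<tau>\<bar> \<le> mass\<^sup>2 * (\<bar>\<tau>\<bar> / 2) powr (\<alpha> - 2)"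
proof -
  let ?g = "\<lambda>x. \<bar>x\<bar> powr \<alpha>"
  define K where "K = 2 * (\<bar>\<tau>\<bar> / 2) powr (\<alpha> - 2)"
  define \<Delta> where "\<Delta> u v = ?g (\<tau> + u - v) - ?g (\<tau> + u) - ?g (\<tau> - v) + ?g \<tau>" for u v
  have cont: "continuous_on UNIV (\<lambda>v. ?g (\<tau> + u - v))" "continuous_on UNIV (\<lambda>v. ?g (\<tau> - v))"
    "continuous_on UNIV (\<lambda>v. \<Delta> u v)" for u
    unfolding \<Delta>_def by (intro continuous_abs_powr continuous_intros)+
  have c\<Delta>: "continuous_on UNIV (\<lambda>(u, v). \<Delta> u v)"
    unfolding \<Delta>_def case_prod_beta by (intro continuous_abs_powr continuous_intros)
  have \<Delta>: "\<bar>\<Delta> u v\<bar> \<le> K" if "u \<in> {-1..1}" "v \<in> {-1..1}" for u v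
  proof (cases "0 \<le> \<tau>")
    case True
    then have "\<Delta> u v = (\<tau> + u - v) powr \<alpha> - (\<tau> + u) powr \<alpha> - (\<tau> - v) powr \<alpha> + \<tau> powr \<alpha>"
      using \<tau> that by (simp add: \<Delta>_def)
    then show ?thesis using mixed_difference_powr_le[OF \<alpha>, of \<tau> u v] \<tau> that True by (simp add: K_def abs_le_iff)
  next
    \<comment> \<open>Reflecting \<open>\<tau>\<close>, \<open>u\<close> and \<open>v\<close>
      reduces negative \<open>\<tau>\<close> to the positive case.\<close>
    case False
    then have "\<Delta> u v = (- \<tau> + (- u) - (- v)) powr \<alpha> - (- \<tau> + (- u)) powr \<alpha> - (- \<tau> - (- v)) powr \<alpha> + (- \<tau>) powr \<alpha>"
      using \<tau> that by (simp add: \<Delta>_def abs_if algebra_simps)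
    then show ?thesis using mixed_difference_powr_le[OF \<alpha>, of "- \<tau>" "- u" "- v"] \<tau> that False by (simp add: K_def abs_le_iff)
  qed
  have ad: "adm (\<lambda>v. ?g (\<tau> + u - v))" "adm (\<lambda>v. ?g (\<tau> - v))" "adm (\<lambda>u. S (\<lambda>v. ?g (\<tau> + u - v)))" for u
    by (intro adm_continuous cont riemann_tendsto2(2) continuous_powr_diff)+
  have "S (\<lambda>v. \<Delta> u v) = S (\<lambda>v. ?g (\<tau> + u - v)) - S (\<lambda>v. ?g (\<tau> - v))" for u
    unfolding \<Delta>_def by (simp only: S_add S_diff adm_diff adm_const ad S_const diff_zero add_0_right)
  then have "S (\<lambda>u. S (\<lambda>v. \<Delta> u v)) = S (\<lambda>u. S (\<lambda>v. ?g (\<tau> + u - v)))"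
    by (simp only: S_diff adm_const ad S_const diff_zero)
  then have "\<rho> \<tau> = - (1 / 2) * S (\<lambda>u. S (\<lambda>v. \<Delta> u v))" by (simp add: \<rho>_def)
  moreover have "\<bar>S (\<lambda>u. S (\<lambda>v. \<Delta> u v))\<bar> \<le> K * mass * mass"
    by (intro S_bound \<Delta> borel_measurable_continuous_onI cont riemann_tendsto2(2)[OF c\<Delta>])
  ultimately have "\<bar>\<rho> \<tau>\<bar> \<le> 1 / 2 * (K * mass * mass)" by (simp add: abs_mult)
  then show ?thesis by (simp add: K_def power2_eq_square mult_ac)
qed

lemma G_cont: "\<omega> \<in> space M \<Longrightarrow> continuous_on UNIV (\<lambda>t. G \<epsilon> t \<omega>)"
  unfolding G_def
proof (intro continuous_on_mult continuous_on_const)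
  assume "\<omega> \<in> space M"
  then have "continuous_on UNIV (\<lambda>(t, u). path \<omega> (t + \<epsilon> * (1 - u)))"
    unfolding case_prod_beta by (intro continuous_on_compose2[OF path_cont] continuous_intros) auto
  from riemann_tendsto2(2)[OF this]
  show "continuous_on UNIV (\<lambda>t. S (\<lambda>u. path \<omega> (t + \<epsilon> * (1 - u))))" .
qed

lemma G_measurable: "G \<epsilon> t \<in> borel_measurable M"
proof -
  \<comment> \<open>Measurability is contained in \<open>cos_gaussian\<close>; the second
    coefficient is set to zero.\<close>
  have "cos_gaussian M (\<lambda>\<omega>. S (\<lambda>u. 1 * path \<omega> (t + \<epsilon> * (1 - u)) + 0 * path \<omega> u))
    (S (\<lambda>u. S (\<lambda>v. kern 1 0 (\<lambda>u. t + \<epsilon> * (1 - u)) (\<lambda>u. u) u v)))"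
    by (intro cos_gaussian_S continuous_intros)
  then have "(\<lambda>\<omega>. S (\<lambda>u. path \<omega> (t + \<epsilon> * (1 - u)))) \<in> borel_measurable M"
    by (simp add: cos_gaussian_def)
  then show ?thesis unfolding G_def[abs_def] by simp
qed

lemma measurable_G [measurable (raw)]:
  assumes [measurable]: "g \<in> measurable L M" "h \<in> borel_measurable L"
  shows "(\<lambda>x. G \<epsilon> (h x) (g x)) \<in> borel_measurable L"
proof -
  have "(\<lambda>p. G \<epsilon> (snd p) (fst p)) \<in> borel_measurable (M \<Otimes>\<^sub>M borel)"
    by (intro measurable_path_pair[of "\<lambda>\<omega> t. G \<epsilon> t \<omega>"] G_measurable G_cont)
  from measurable_compose[OF _ this, of "\<lambda>x. (g x, h x)" L] show ?thesis by simp
qed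

definition F :: "real \<Rightarrow> real \<Rightarrow> 'a \<Rightarrow> real" where
  "F \<epsilon> b \<omega> = (LINT t:{0..b}|lborel. \<bar>G \<epsilon> t \<omega>\<bar>)"

text \<open>The mean of \<open>\<bar>G \<epsilon> t\<bar>\<close>, the same for all
  \<open>\<epsilon>\<close> and all nonnegative \<open>t\<close>.\<close>

definition m1 :: real where "m1 = sqrt (2 / pi) * sqrt (\<rho> 0)"

lemma F_nn:
  assumes "\<omega> \<in> space M"
  shows "ennreal (F \<epsilon> b \<omega>) = (\<integral>\<^sup>+t\<in>{0..b}. ennreal \<bar>G \<epsilon> t \<omega>\<bar> \<partial>lborel)" "0 \<le> F \<epsilon> b \<omega>"
proof -
  have "set_integrable lborel {0..b} (\<lambda>t. \<bar>G \<epsilon> t \<omega>\<bar>)"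
    by (intro borel_integrable_compact[unfolded set_integrable_def[symmetric], unfolded scaleR_conv_of_real]
        borel_integrable_atLeastAtMost') (auto intro!: continuous_intros continuous_on_subset[OF G_cont[OF assms]])
  then show "ennreal (F \<epsilon> b \<omega>) = (\<integral>\<^sup>+t\<in>{0..b}. ennreal \<bar>G \<epsilon> t \<omega>\<bar> \<partial>lborel)"
    unfolding F_def set_lebesgue_integral_def set_integrable_def
    by (subst nn_integral_eq_integral[symmetric]) (auto intro!: nn_integral_cong simp: indicator_def)
  show "0 \<le> F \<epsilon> b \<omega>" unfolding F_def set_lebesgue_integral_def by (intro integral_nonneg_AE AE_I2) auto
qed

lemma F_measurable [measurable]: "F \<epsilon> b \<in> borel_measurable M"
proof -
  have "(\<lambda>\<omega>. enn2real (\<integral>\<^sup>+t\<in>{0..b}. ennreal \<bar>G \<epsilon> t \<omega>\<bar> \<partial>lborel)) \<in> borel_measurable M"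
    by measurable
  then show ?thesis
    by (rule measurable_cong[THEN iffD1, rotated]) (simp add: F_nn(1)[symmetric] F_nn(2))
qed

lemma F_mean:
  assumes "0 < \<epsilon>" "0 \<le> b"
  shows "(\<integral>\<^sup>+\<omega>. ennreal (F \<epsilon> b \<omega>) \<partial>M) = ennreal (b * m1)"
proof -
  interpret pair_sigma_finite M lborel ..
  have "(\<integral>\<^sup>+\<omega>. ennreal (F \<epsilon> b \<omega>) \<partial>M) = (\<integral>\<^sup>+\<omega>. (\<integral>\<^sup>+t\<in>{0..b}. ennreal \<bar>G \<epsilon> t \<omega>\<bar> \<partial>lborel) \<partial>M)"
    by (intro nn_integral_cong F_nn)
  also have "\<dots> = (\<integral>\<^sup>+t. (\<integral>\<^sup>+\<omega>. ennreal \<bar>G \<epsilon> t \<omega>\<bar> * indicator {0..b} t \<partial>M) \<partial>lborel)"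
    by (rule Fubini'[symmetric]) measurable
  also have "\<dots> = (\<integral>\<^sup>+t. ennreal m1 * indicator {0..b} t \<partial>lborel)"
  proof (intro nn_integral_cong)
    fix t :: real
    show "(\<integral>\<^sup>+\<omega>. ennreal \<bar>G \<epsilon> t \<omega>\<bar> * indicator {0..b} t \<partial>M) = ennreal m1 * indicator {0..b} t"
      using cos_gaussian_abs_moment[OF cos_gaussian_G1[OF assms(1)] \<rho>_0_nonneg, of t]
      by (cases "t \<in> {0..b}") (auto simp: m1_def)
  qed
  also have "\<dots> = ennreal (b * m1)"
    using assms by (subst nn_integral_cmult_indicator) (auto simp: m1_def \<rho>_0_nonneg mult.commute simp flip: ennreal_mult)
  finally show ?thesis .
qed

end

section \<open>Variance of the integrated absolute derivative\<close>

context fbm_stieltjes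
begin

text \<open>For times at distance at least \<open>sqrt \<epsilon>\<close> the correlation is \<open>O(\<epsilon> powr ((2 - \<alpha>) / 2))\<close>, and the
  excess of the mixed moment over the product of the means is quadratic in it.\<close>

lemma product_moment_bound:
  assumes p: "0 < \<rho> 0"
  shows "\<exists>C \<epsilon>0. 0 \<le> C \<and> 0 < \<epsilon>0 \<and> (\<forall>\<epsilon> s t. 0 < \<epsilon> \<longrightarrow> \<epsilon> \<le> \<epsilon>0 \<longrightarrow> 0 \<le> s \<longrightarrow> 0 \<le> t \<longrightarrow>
    (\<integral>\<^sup>+\<omega>. ennreal (\<bar>G \<epsilon> t \<omega>\<bar> * \<bar>G \<epsilon> s \<omega>\<bar>) \<partial>M) \<le>
      ennreal (m1\<^sup>2 + C * \<epsilon> powr (2 - \<alpha>)) + ennreal (\<rho> 0) * indicator {t - sqrt \<epsilon>..t + sqrt \<epsilon>} s)"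
proof -
  from abs_product_moment_le[OF p] obtain C where C: "0 \<le> C"
    and CC: "\<And>X Y r. \<bar>r\<bar> \<le> \<rho> 0 / 2 \<Longrightarrow>
      (\<And>a b. cos_gaussian M (\<lambda>\<omega>. a * X \<omega> + b * Y \<omega>) ((a\<^sup>2 + b\<^sup>2) * \<rho> 0 + 2 * a * b * r)) \<Longrightarrow>
      (\<integral>\<^sup>+\<omega>. ennreal (\<bar>X \<omega>\<bar> * \<bar>Y \<omega>\<bar>) \<partial>M) \<le> ennreal (2 / pi * \<rho> 0 + C * r\<^sup>2)"
    by blast
  define K where "K = mass\<^sup>2 * 2 powr (2 - \<alpha>)"
  have K0: "0 \<le> K" by (simp add: K_def)
  \<comment> \<open>At distance \<open>sqrt \<epsilon>\<close> the rescaled distance is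
    \<open>1 / sqrt \<epsilon>\<close>; its power with exponent \<open>\<alpha> - 2\<close> is
    \<open>\<epsilon> powr e\<close>.\<close>
  define e where "e = (2 - \<alpha>) / 2"
  have e: "0 < e" using \<alpha> by (simp add: e_def)
  have "((\<lambda>\<epsilon>. K * \<epsilon> powr e) \<longlongrightarrow> K * 0 powr e) (at_right 0)"
    using e eventually_mono[OF eventually_at_right_less[of "0::real"] less_imp_le]
    by (intro tendsto_intros tendsto_powr') auto
  then have "\<forall>\<^sub>F \<epsilon> in at_right 0. K * \<epsilon> powr e < \<rho> 0 / 2"
    using p by (intro order_tendstoD(2)) auto
  then obtain d where d: "0 < d" "\<And>\<epsilon>. 0 < \<epsilon> \<Longrightarrow> \<epsilon> < d \<Longrightarrow> K * \<epsilon> powr e < \<rho> 0 / 2"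
    by (auto simp: eventually_at_right_field)
  \<comment> \<open>The first bound keeps the covariance below half the variance, as
    \<open>abs_product_moment_le\<close> demands; \<open>1 / 16\<close> makes
    \<open>1 / sqrt \<epsilon>\<close> at least \<open>4\<close>, as \<open>\<rho>_decay\<close>
    demands.\<close>
  define \<epsilon>0 where "\<epsilon>0 = min (d / 2) (1 / 16)"
  have m1sq: "m1\<^sup>2 = 2 / pi * \<rho> 0" using p by (simp add: m1_def power_mult_distrib)
  show ?thesis
  proof (rule exI[of _ "C * K\<^sup>2"], rule exI[of _ \<epsilon>0], intro conjI allI impI)
    show "0 < \<epsilon>0" using d by (simp add: \<epsilon>0_def)
    fix \<epsilon> s t :: real
    assume \<epsilon>: "0 < \<epsilon>" "\<epsilon> \<le> \<epsilon>0" and st: "0 \<le> s" "0 \<le> t"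
    show "(\<integral>\<^sup>+\<omega>. ennreal (\<bar>G \<epsilon> t \<omega>\<bar> * \<bar>G \<epsilon> s \<omega>\<bar>) \<partial>M) \<le>
      ennreal (m1\<^sup>2 + C * K\<^sup>2 * \<epsilon> powr (2 - \<alpha>)) + ennreal (\<rho> 0) * indicator {t - sqrt \<epsilon>..t + sqrt \<epsilon>} s"
    proof (cases "s \<in> {t - sqrt \<epsilon>..t + sqrt \<epsilon>}")
      case True
      have [measurable]: "G \<epsilon> t \<in> borel_measurable M" "G \<epsilon> s \<in> borel_measurable M" by (rule G_measurable)+
      \<comment> \<open>With \<open>h\<close> one half, the elementary bound by the mean of the
        squares gives the variance for nearby times, where no decorrelation is available.\<close>
      obtain h :: real where h: "0 \<le> h" "2 * h = 1" by (rule that[of "1 / 2"]) auto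
      have "(\<integral>\<^sup>+\<omega>. ennreal (\<bar>G \<epsilon> t \<omega>\<bar> * \<bar>G \<epsilon> s \<omega>\<bar>) \<partial>M)
        \<le> (\<integral>\<^sup>+\<omega>. ennreal h * (ennreal ((G \<epsilon> t \<omega>)\<^sup>2) + ennreal ((G \<epsilon> s \<omega>)\<^sup>2)) \<partial>M)"
      proof (intro nn_integral_mono)
        fix \<omega>
        have "2 * (\<bar>G \<epsilon> t \<omega>\<bar> * \<bar>G \<epsilon> s \<omega>\<bar>) \<le> (G \<epsilon> t \<omega>)\<^sup>2 + (G \<epsilon> s \<omega>)\<^sup>2"
          using sum_squares_bound[of "\<bar>G \<epsilon> t \<omega>\<bar>" "\<bar>G \<epsilon> s \<omega>\<bar>"] by simp
        from mult_left_mono[OF this h(1)]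
        have "(2 * h) * (\<bar>G \<epsilon> t \<omega>\<bar> * \<bar>G \<epsilon> s \<omega>\<bar>) \<le> h * ((G \<epsilon> t \<omega>)\<^sup>2 + (G \<epsilon> s \<omega>)\<^sup>2)"
          by (simp only: mult_ac)
        then have "\<bar>G \<epsilon> t \<omega>\<bar> * \<bar>G \<epsilon> s \<omega>\<bar> \<le> h * ((G \<epsilon> t \<omega>)\<^sup>2 + (G \<epsilon> s \<omega>)\<^sup>2)"
          by (simp only: h(2) mult_1)
        then show "ennreal (\<bar>G \<epsilon> t \<omega>\<bar> * \<bar>G \<epsilon> s \<omega>\<bar>) \<le> ennreal h * (ennreal ((G \<epsilon> t \<omega>)\<^sup>2) + ennreal ((G \<epsilon> s \<omega>)\<^sup>2))"
          using h by (simp add: ennreal_leI flip: ennreal_plus ennreal_mult)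
      qed
      also have "\<dots> = ennreal h * ((\<integral>\<^sup>+\<omega>. ennreal ((G \<epsilon> t \<omega>)\<^sup>2) \<partial>M) + (\<integral>\<^sup>+\<omega>. ennreal ((G \<epsilon> s \<omega>)\<^sup>2) \<partial>M))"
        by (simp add: nn_integral_cmult nn_integral_add)
      also have "\<dots> \<le> ennreal h * (ennreal (\<rho> 0) + ennreal (\<rho> 0))"
        using \<epsilon>(1) st p by (intro mult_left_mono add_mono cos_gaussian_square_moment cos_gaussian_G1) auto
      also have "\<dots> = ennreal (\<rho> 0)" 
      proof -
        have "h * (\<rho> 0 + \<rho> 0) = (2 * h) * \<rho> 0" by simp
        then have "h * (\<rho> 0 + \<rho> 0) = \<rho> 0" by (simp only: h(2) mult_1)
        then show ?thesis using p h by (simp flip: ennreal_plus ennreal_mult)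
      qed
      also have "\<dots> \<le> ennreal (m1\<^sup>2 + C * K\<^sup>2 * \<epsilon> powr (2 - \<alpha>)) + ennreal (\<rho> 0) * indicator {t - sqrt \<epsilon>..t + sqrt \<epsilon>} s"
        using True by (simp add: add_increasing)
      finally show ?thesis .
    next
      case False
      then have far: "sqrt \<epsilon> \<le> \<bar>t - s\<bar>" by auto
      define \<tau> where "\<tau> = \<bar>t - s\<bar> / \<epsilon>"
      have sq: "sqrt \<epsilon> * sqrt \<epsilon> = \<epsilon>" "0 < sqrt \<epsilon>" using \<epsilon>(1) by auto
      have "1 / sqrt \<epsilon> = sqrt \<epsilon> / \<epsilon>" using sq by (simp add: field_simps)
      also have "\<dots> \<le> \<tau>" unfolding \<tau>_def using far \<epsilon>(1) by (intro divide_right_mono) auto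
      finally have \<tau>: "1 / sqrt \<epsilon> \<le> \<tau>" .
      have "sqrt \<epsilon> \<le> sqrt (1 / 16)" using \<epsilon>(2) by (intro real_sqrt_le_mono) (simp add: \<epsilon>0_def)
      also have "\<dots> = 1 / 4" by (simp add: real_sqrt_divide)
      finally have "4 \<le> 1 / sqrt \<epsilon>" using sq(2) by (simp add: field_simps)
      with \<tau> have \<tau>4: "4 \<le> \<tau>" by linarith
      have rb: "\<bar>\<rho> x\<bar> \<le> K * \<epsilon> powr e" if x: "\<bar>x\<bar> = \<tau>" for x
      proof -
        have "\<bar>\<rho> x\<bar> \<le> mass\<^sup>2 * (\<tau> / 2) powr (\<alpha> - 2)" using \<rho>_decay[of x] \<tau>4 x by simp
        also have "\<dots> \<le> mass\<^sup>2 * (1 / sqrt \<epsilon> / 2) powr (\<alpha> - 2)"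
          using \<tau> sq(2) \<alpha> by (intro mult_left_mono powr_mono2' divide_right_mono) auto
        also have "(1 / sqrt \<epsilon> / 2) powr (\<alpha> - 2) = 2 powr (2 - \<alpha>) * \<epsilon> powr e"
        proof -
          have "(1 / sqrt \<epsilon> / 2) powr (\<alpha> - 2) = (2 * sqrt \<epsilon>) powr (2 - \<alpha>)"
            using sq(2) powr_minus_divide[of "2 * sqrt \<epsilon>" "2 - \<alpha>"]
            by (simp add: powr_divide powr_mult field_simps powr_minus flip: powr_minus)
          also have "\<dots> = 2 powr (2 - \<alpha>) * \<epsilon> powr e"
            using \<epsilon>(1) by (simp add: powr_mult powr_half_sqrt[symmetric] powr_powr e_def)
          finally show ?thesis .
        qed
        finally show ?thesis by (simp add: K_def)
      qed
      define r where "r = (\<rho> ((s - t) / \<epsilon>) + \<rho> ((t - s) / \<epsilon>)) / 2"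
      have r: "\<bar>r\<bar> \<le> K * \<epsilon> powr e"
        using rb[of "(s - t) / \<epsilon>"] rb[of "(t - s) / \<epsilon>"] \<epsilon>(1) unfolding r_def \<tau>_def
        by (simp add: abs_divide abs_minus_commute)
      have "K * \<epsilon> powr e < \<rho> 0 / 2" using \<epsilon> d(1) by (intro d(2)) (auto simp: \<epsilon>0_def)
      with r have "\<bar>r\<bar> \<le> \<rho> 0 / 2" by linarith
      then have "(\<integral>\<^sup>+\<omega>. ennreal (\<bar>G \<epsilon> t \<omega>\<bar> * \<bar>G \<epsilon> s \<omega>\<bar>) \<partial>M) \<le> ennreal (2 / pi * \<rho> 0 + C * r\<^sup>2)"
        unfolding r_def using cos_gaussian_G[OF \<epsilon>(1) st] by (intro CC)
      also have "\<dots> \<le> ennreal (m1\<^sup>2 + C * K\<^sup>2 * \<epsilon> powr (2 - \<alpha>))"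
      proof (rule ennreal_leI)
        have "r\<^sup>2 \<le> (K * \<epsilon> powr e)\<^sup>2" using power_mono[OF r, of 2] by simp
        also have "\<dots> = K\<^sup>2 * \<epsilon> powr (2 - \<alpha>)"
          by (simp add: power_mult_distrib power2_eq_square e_def flip: powr_add)
        finally show "2 / pi * \<rho> 0 + C * r\<^sup>2 \<le> m1\<^sup>2 + C * K\<^sup>2 * \<epsilon> powr (2 - \<alpha>)"
          unfolding m1sq using C mult_left_mono[of "r\<^sup>2" _ C] by (simp add: mult.assoc)
      qed
      also have "\<dots> \<le> \<dots> + ennreal (\<rho> 0) * indicator {t - sqrt \<epsilon>..t + sqrt \<epsilon>} s" by simp
      finally show ?thesis .
    qed
  qed (use C in simp)
qed

text \<open>The square of \<open>F\<close> is an integral over pairs of times. For each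
  \<open>t\<close> the strip of close \<open>s\<close> has length
  \<open>2 * sqrt \<epsilon>\<close>, which yields the last term.\<close>

lemma F_second_moment:
  assumes "0 < \<epsilon>" "0 \<le> b" "0 \<le> A" "0 \<le> D"
    and le: "\<And>s t. 0 \<le> s \<Longrightarrow> 0 \<le> t \<Longrightarrow> (\<integral>\<^sup>+\<omega>. ennreal (\<bar>G \<epsilon> t \<omega>\<bar> * \<bar>G \<epsilon> s \<omega>\<bar>) \<partial>M) \<le>
      ennreal A + ennreal D * indicator {t - sqrt \<epsilon>..t + sqrt \<epsilon>} s"
  shows "(\<integral>\<^sup>+\<omega>. ennreal ((F \<epsilon> b \<omega>)\<^sup>2) \<partial>M) \<le> ennreal (b\<^sup>2 * A + 2 * b * D * sqrt \<epsilon>)"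
proof -
  interpret pair_sigma_finite M lborel ..
  let ?g = "\<lambda>t \<omega>. ennreal \<bar>G \<epsilon> t \<omega>\<bar> * indicator {0..b} t"
  have "(\<integral>\<^sup>+\<omega>. ennreal ((F \<epsilon> b \<omega>)\<^sup>2) \<partial>M) = (\<integral>\<^sup>+\<omega>. (\<integral>\<^sup>+t. ?g t \<omega> \<partial>lborel) * (\<integral>\<^sup>+s. ?g s \<omega> \<partial>lborel) \<partial>M)"
    using F_nn by (intro nn_integral_cong) (simp add: power2_eq_square ennreal_mult)
  also have "\<dots> = (\<integral>\<^sup>+\<omega>. (\<integral>\<^sup>+t. (\<integral>\<^sup>+s. ?g t \<omega> * ?g s \<omega> \<partial>lborel) \<partial>lborel) \<partial>M)"
  proof (intro nn_integral_cong)
    fix \<omega> assume "\<omega> \<in> space M"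
    then have m: "(\<lambda>t. ?g t \<omega>) \<in> borel_measurable lborel"
      using borel_measurable_continuous_onI[OF G_cont] by measurable
    show "(\<integral>\<^sup>+t. ?g t \<omega> \<partial>lborel) * (\<integral>\<^sup>+s. ?g s \<omega> \<partial>lborel) = (\<integral>\<^sup>+t. (\<integral>\<^sup>+s. ?g t \<omega> * ?g s \<omega> \<partial>lborel) \<partial>lborel)"
      by (simp only: nn_integral_cmult[OF m] nn_integral_multc[OF m])
  qed
  also have "\<dots> = (\<integral>\<^sup>+t. (\<integral>\<^sup>+\<omega>. (\<integral>\<^sup>+s. ?g t \<omega> * ?g s \<omega> \<partial>lborel) \<partial>M) \<partial>lborel)"
    by (rule Fubini'[symmetric]) measurable
  also have "\<dots> = (\<integral>\<^sup>+t. (\<integral>\<^sup>+s. (\<integral>\<^sup>+\<omega>. ?g t \<omega> * ?g s \<omega> \<partial>M) \<partial>lborel) \<partial>lborel)"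
    by (rule nn_integral_cong, rule Fubini'[symmetric]) measurable
  also have "\<dots> \<le> (\<integral>\<^sup>+t. ennreal (b * A + 2 * D * sqrt \<epsilon>) * indicator {0..b} t \<partial>lborel)"
  proof (intro nn_integral_mono)
    fix t :: real
    show "(\<integral>\<^sup>+s. (\<integral>\<^sup>+\<omega>. ?g t \<omega> * ?g s \<omega> \<partial>M) \<partial>lborel) \<le> ennreal (b * A + 2 * D * sqrt \<epsilon>) * indicator {0..b} t"
    proof (cases "t \<in> {0..b}")
      case True
      have "(\<integral>\<^sup>+s. (\<integral>\<^sup>+\<omega>. ?g t \<omega> * ?g s \<omega> \<partial>M) \<partial>lborel)
        \<le> (\<integral>\<^sup>+s. ennreal A * indicator {0..b} s + ennreal D * indicator {t - sqrt \<epsilon>..t + sqrt \<epsilon>} s \<partial>lborel)"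
      proof (intro nn_integral_mono)
        fix s :: real
        show "(\<integral>\<^sup>+\<omega>. ?g t \<omega> * ?g s \<omega> \<partial>M) \<le> ennreal A * indicator {0..b} s + ennreal D * indicator {t - sqrt \<epsilon>..t + sqrt \<epsilon>} s"
          using le[of s t] True by (cases "s \<in> {0..b}") (auto simp: ennreal_mult)
      qed
      also have "\<dots> = ennreal A * ennreal b + ennreal D * ennreal (2 * sqrt \<epsilon>)"
        using assms(1,2) by (simp add: nn_integral_add nn_integral_cmult_indicator)
      also have "\<dots> = ennreal (b * A + 2 * D * sqrt \<epsilon>)"
        using assms by (simp add: mult_ac flip: ennreal_mult ennreal_plus)
      finally show ?thesis using True by simp
    qed simp
  qed
  also have "\<dots> = ennreal (b * A + 2 * D * sqrt \<epsilon>) * ennreal b"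
    using assms by (subst nn_integral_cmult_indicator) auto
  also have "\<dots> = ennreal (b\<^sup>2 * A + 2 * b * D * sqrt \<epsilon>)"
    using assms by (simp add: power2_eq_square algebra_simps flip: ennreal_mult)
  finally show ?thesis .
qed

lemma F_variance:
  assumes "0 < \<epsilon>" "0 \<le> b" "0 \<le> A"
    and m2: "(\<integral>\<^sup>+\<omega>. ennreal ((F \<epsilon> b \<omega>)\<^sup>2) \<partial>M) \<le> ennreal (b\<^sup>2 * m1\<^sup>2 + A)"
  shows "(\<integral>\<^sup>+\<omega>. ennreal ((F \<epsilon> b \<omega> - b * m1)\<^sup>2) \<partial>M) \<le> ennreal A"
proof -
  have m10: "0 \<le> m1" by (simp add: m1_def \<rho>_0_nonneg)
  have i2: "integrable M (\<lambda>\<omega>. (F \<epsilon> b \<omega>)\<^sup>2)"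
    using le_less_trans[OF m2 ennreal_less_top] by (intro integrableI_bounded) auto
  have i1: "integrable M (F \<epsilon> b)"
  proof (rule integrableI_bounded)
    have "(\<integral>\<^sup>+\<omega>. ennreal (norm (F \<epsilon> b \<omega>)) \<partial>M) = (\<integral>\<^sup>+\<omega>. ennreal (F \<epsilon> b \<omega>) \<partial>M)"
      using F_nn(2) by (intro nn_integral_cong) simp
    then show "(\<integral>\<^sup>+\<omega>. ennreal (norm (F \<epsilon> b \<omega>)) \<partial>M) < \<infinity>" using F_mean[OF assms(1,2)] by simp
  qed measurable
  have e1: "(\<integral>\<omega>. F \<epsilon> b \<omega> \<partial>M) = b * m1"
  proof -
    have "ennreal (\<integral>\<omega>. F \<epsilon> b \<omega> \<partial>M) = ennreal (b * m1)"
      using F_mean[OF assms(1,2)] F_nn(2) by (subst nn_integral_eq_integral[OF i1, symmetric]) (auto intro!: AE_I2)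
    moreover have "0 \<le> (\<integral>\<omega>. F \<epsilon> b \<omega> \<partial>M)" using F_nn(2) by (intro integral_nonneg_AE AE_I2)
    ultimately show ?thesis using assms m10 by simp
  qed
  have "ennreal (\<integral>\<omega>. (F \<epsilon> b \<omega>)\<^sup>2 \<partial>M) \<le> ennreal (b\<^sup>2 * m1\<^sup>2 + A)"
    using m2 by (subst nn_integral_eq_integral[OF i2, symmetric]) auto
  then have e2: "(\<integral>\<omega>. (F \<epsilon> b \<omega>)\<^sup>2 \<partial>M) \<le> b\<^sup>2 * m1\<^sup>2 + A"
    using assms by (subst (asm) ennreal_le_iff) auto
  have sq: "(F \<epsilon> b \<omega> - b * m1)\<^sup>2 = (F \<epsilon> b \<omega>)\<^sup>2 - 2 * (b * m1) * F \<epsilon> b \<omega> + (b * m1)\<^sup>2" for \<omega>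
    by (simp add: power2_eq_square algebra_simps)
  have "(\<integral>\<^sup>+\<omega>. ennreal ((F \<epsilon> b \<omega> - b * m1)\<^sup>2) \<partial>M) = ennreal (\<integral>\<omega>. (F \<epsilon> b \<omega> - b * m1)\<^sup>2 \<partial>M)"
  proof (rule nn_integral_eq_integral)
    show "integrable M (\<lambda>\<omega>. (F \<epsilon> b \<omega> - b * m1)\<^sup>2)" unfolding sq using i1 i2 by simp
  qed simp
  also have "(\<integral>\<omega>. (F \<epsilon> b \<omega> - b * m1)\<^sup>2 \<partial>M) = (\<integral>\<omega>. (F \<epsilon> b \<omega>)\<^sup>2 \<partial>M) - 2 * (b * m1) * (b * m1) + (b * m1)\<^sup>2"
    unfolding sq using i1 i2 by (simp add: e1 prob_space)
  also have "ennreal \<dots> \<le> ennreal A"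
    using e2 by (intro ennreal_leI) (simp add: power2_eq_square power_mult_distrib algebra_simps)
  finally show ?thesis .
qed

end

section \<open>Almost sure convergence along a mesh\<close>

context fbm_stieltjes
begin

text \<open>The smaller of two exponents: \<open>1 / 2\<close> from the strip of close times and
  \<open>2 - \<alpha>\<close> from the squared correlation of distant times.\<close>

definition rate :: real where "rate = min (1 / 2) (2 - \<alpha>)"

lemma F_variance_rate:
  assumes p: "0 < \<rho> 0" and b: "0 \<le> b"
  shows "\<exists>C \<epsilon>0. 0 \<le> C \<and> 0 < \<epsilon>0 \<and> (\<forall>\<epsilon>. 0 < \<epsilon> \<longrightarrow> \<epsilon> \<le> \<epsilon>0 \<longrightarrow>
    (\<integral>\<^sup>+\<omega>. ennreal ((F \<epsilon> b \<omega> - b * m1)\<^sup>2) \<partial>M) \<le> ennreal (C * \<epsilon> powr rate))"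
proof -
  from product_moment_bound[OF p] obtain C \<epsilon>0 where C: "0 \<le> C" "0 < \<epsilon>0"
    and le: "\<And>\<epsilon> s t. 0 < \<epsilon> \<Longrightarrow> \<epsilon> \<le> \<epsilon>0 \<Longrightarrow> 0 \<le> s \<Longrightarrow> 0 \<le> t \<Longrightarrow>
      (\<integral>\<^sup>+\<omega>. ennreal (\<bar>G \<epsilon> t \<omega>\<bar> * \<bar>G \<epsilon> s \<omega>\<bar>) \<partial>M) \<le>
      ennreal (m1\<^sup>2 + C * \<epsilon> powr (2 - \<alpha>)) + ennreal (\<rho> 0) * indicator {t - sqrt \<epsilon>..t + sqrt \<epsilon>} s"
    by blast
  define K where "K = b\<^sup>2 * C + 2 * b * \<rho> 0"
  have "(\<integral>\<^sup>+\<omega>. ennreal ((F \<epsilon> b \<omega> - b * m1)\<^sup>2) \<partial>M) \<le> ennreal (K * \<epsilon> powr rate)"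
    if \<epsilon>: "0 < \<epsilon>" "\<epsilon> \<le> min \<epsilon>0 1" for \<epsilon>
  proof -
    define A where "A = b\<^sup>2 * (C * \<epsilon> powr (2 - \<alpha>)) + 2 * b * \<rho> 0 * sqrt \<epsilon>"
    have A0: "0 \<le> A" using b C p \<epsilon> by (simp add: A_def)
    have "(\<integral>\<^sup>+\<omega>. ennreal ((F \<epsilon> b \<omega>)\<^sup>2) \<partial>M) \<le> ennreal (b\<^sup>2 * (m1\<^sup>2 + C * \<epsilon> powr (2 - \<alpha>)) + 2 * b * \<rho> 0 * sqrt \<epsilon>)"
      using \<epsilon> b C p le by (intro F_second_moment) auto
    also have "b\<^sup>2 * (m1\<^sup>2 + C * \<epsilon> powr (2 - \<alpha>)) + 2 * b * \<rho> 0 * sqrt \<epsilon> = b\<^sup>2 * m1\<^sup>2 + A"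
      by (simp add: A_def distrib_left)
    finally have "(\<integral>\<^sup>+\<omega>. ennreal ((F \<epsilon> b \<omega> - b * m1)\<^sup>2) \<partial>M) \<le> ennreal A"
      using \<epsilon> b A0 by (intro F_variance) auto
    also have "A \<le> K * \<epsilon> powr rate"
    proof -
      have "\<epsilon> powr (2 - \<alpha>) \<le> \<epsilon> powr rate" "sqrt \<epsilon> \<le> \<epsilon> powr rate"
        using \<epsilon> unfolding powr_half_sqrt[OF less_imp_le[OF \<epsilon>(1)], symmetric] rate_def
        by (auto intro!: powr_mono' min.cobounded1 min.cobounded2 simp del: min_le_iff_disj)
      then have "A \<le> b\<^sup>2 * (C * \<epsilon> powr rate) + 2 * b * \<rho> 0 * \<epsilon> powr rate"
        unfolding A_def using b C p by (intro add_mono mult_left_mono) auto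
      then show ?thesis by (simp add: K_def algebra_simps)
    qed
    finally show ?thesis by (simp add: ennreal_leI)
  qed
  note var = this
  have "0 \<le> K" using b C p by (simp add: K_def)
  with var C(2) show ?thesis by - (rule exI[of _ K], rule exI[of _ "min \<epsilon>0 1"], auto)
qed

text \<open>The mesh exponent \<open>k\<close> makes the variances at most a multiple of
  \<open>1 / n\<^sup>2\<close>, hence summable. The variance bound holds only for small \<epsilon>,
  so the sequence is shifted by \<open>n0\<close>.\<close>

lemma AE_F_seq:
  assumes p: "0 < \<rho> 0" and b: "0 \<le> b" and k: "2 \<le> real k * rate"
  shows "AE \<omega> in M. (\<lambda>n. F ((1 / real (Suc n)) ^ k) b \<omega>) \<longlonglongrightarrow> b * m1"
proof -
  have k0: "0 < k" using k by (cases k) auto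
  from F_variance_rate[OF p b] obtain C \<epsilon>0 where C: "0 \<le> C" "0 < \<epsilon>0"
    and le: "\<And>\<epsilon>. 0 < \<epsilon> \<Longrightarrow> \<epsilon> \<le> \<epsilon>0 \<Longrightarrow>
      (\<integral>\<^sup>+\<omega>. ennreal ((F \<epsilon> b \<omega> - b * m1)\<^sup>2) \<partial>M) \<le> ennreal (C * \<epsilon> powr rate)"
    by blast
  define e where "e n = (1 / real (Suc n)) ^ k" for n
  have e0: "0 < e n" for n by (simp add: e_def)
  have "e \<longlonglongrightarrow> 0 ^ k" unfolding e_def by (intro tendsto_intros LIMSEQ_Suc[OF lim_1_over_n])
  then have "e \<longlonglongrightarrow> 0" by (simp only: zero_power[OF k0])
  then have "\<forall>\<^sub>F n in sequentially. e n < \<epsilon>0" using C(2) by (rule order_tendstoD)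
  then obtain n0 where n0: "\<And>n. n0 \<le> n \<Longrightarrow> e n \<le> \<epsilon>0"
    unfolding eventually_sequentially by (meson less_imp_le)
  define u where "u n \<omega> = (F (e (n + n0)) b \<omega> - b * m1)\<^sup>2" for n \<omega>
  have sumi: "summable (\<lambda>n. C * (1 / real (Suc (n + n0)))\<^sup>2)"
  proof -
    have "summable (\<lambda>n. inverse (real n ^ 2))" by (rule inverse_power_summable) simp
    then have "summable (\<lambda>n. inverse (real (n + Suc n0) ^ 2))" by (subst summable_iff_shift)
    then show ?thesis by (intro summable_mult) (simp add: power_one_over inverse_eq_divide del: of_nat_Suc)
  qed
  have ule: "(\<integral>\<^sup>+\<omega>. ennreal (u n \<omega>) \<partial>M) \<le> ennreal (C * (1 / real (Suc (n + n0)))\<^sup>2)" for n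
  proof -
    have "(\<integral>\<^sup>+\<omega>. ennreal (u n \<omega>) \<partial>M) \<le> ennreal (C * e (n + n0) powr rate)"
      unfolding u_def by (intro le e0 n0) simp
    also have "e (n + n0) powr rate = (1 / real (Suc (n + n0))) powr (real k * rate)"
      unfolding e_def by (subst powr_realpow[symmetric]) (auto simp: powr_powr)
    also have "C * \<dots> \<le> C * (1 / real (Suc (n + n0))) powr 2"
      using C k by (intro mult_left_mono powr_mono') auto
    also have "(1 / real (Suc (n + n0))) powr 2 = (1 / real (Suc (n + n0)))\<^sup>2"
      using powr_realpow[of "1 / real (Suc (n + n0))" 2] by simp
    finally show ?thesis by (simp add: ennreal_leI)
  qed
  have um [measurable]: "(\<lambda>\<omega>. ennreal (u n \<omega>)) \<in> borel_measurable M" for n unfolding u_def by measurable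
  \<comment> \<open>The sum of all squared deviations has finite mean, so it is almost surely finite
    and its terms tend to zero.\<close>
  have "(\<integral>\<^sup>+\<omega>. (\<Sum>n. ennreal (u n \<omega>)) \<partial>M) = (\<Sum>n. \<integral>\<^sup>+\<omega>. ennreal (u n \<omega>) \<partial>M)"
    by (intro nn_integral_suminf um)
  also have "\<dots> \<le> (\<Sum>n. ennreal (C * (1 / real (Suc (n + n0)))\<^sup>2))"
    by (intro suminf_le ule) auto
  also have "\<dots> = ennreal (\<Sum>n. C * (1 / real (Suc (n + n0)))\<^sup>2)"
    using sumi C by (intro suminf_ennreal2) auto
  finally have "(\<integral>\<^sup>+\<omega>. (\<Sum>n. ennreal (u n \<omega>)) \<partial>M) \<noteq> \<infinity>" by (auto simp: top_unique)
  then have "AE \<omega> in M. (\<Sum>n. ennreal (u n \<omega>)) \<noteq> \<infinity>" by (intro nn_integral_PInf_AE) measurable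
  then show ?thesis
  proof eventually_elim
    case (elim \<omega>)
    have "summable (\<lambda>n. u n \<omega>)"
      using elim by (intro summable_suminf_not_top) (auto simp: u_def)
    then have "(\<lambda>n. u n \<omega>) \<longlonglongrightarrow> 0" by (rule summable_LIMSEQ_zero)
    then have "(\<lambda>n. sqrt (u n \<omega>)) \<longlonglongrightarrow> sqrt 0" by (intro tendsto_intros)
    then have "(\<lambda>n. \<bar>F (e (n + n0)) b \<omega> - b * m1\<bar>) \<longlonglongrightarrow> 0" by (simp add: u_def)
    then have "(\<lambda>n. F (e (n + n0)) b \<omega> - b * m1) \<longlonglongrightarrow> 0" by (rule tendsto_rabs_zero_cancel)
    then have "(\<lambda>n. F (e (n + n0)) b \<omega>) \<longlonglongrightarrow> b * m1" by (simp add: LIM_zero_iff)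
    then have "(\<lambda>n. F (e n) b \<omega>) \<longlonglongrightarrow> b * m1" by (rule LIMSEQ_offset)
    then show ?case by (simp only: e_def)
  qed
qed

text \<open>Without the normalizing power, \<open>F\<close> depends on \<epsilon> only through the
  arguments of the path, which move by at most \<open>2 * (e - \<epsilon>)\<close>. They stay below
  \<open>b + 2\<close>, which is the reason for the condition on \<open>T\<close>.\<close>

lemma F_scaled_diff:
  assumes \<omega>: "\<omega> \<in> space M" and e: "0 < \<epsilon>" "\<epsilon> \<le> e" "e \<le> 1" and b: "0 \<le> b" and T: "b + 2 < real T"
    and \<gamma>: "0 < \<gamma>" and C: "0 \<le> C"
    and h: "\<And>s t. s \<in> {0..<real T} \<Longrightarrow> t \<in> {0..<real T} \<Longrightarrow> \<bar>s - t\<bar> \<le> 2 * (e - \<epsilon>) \<Longrightarrow>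
      \<bar>X s \<omega> - X t \<omega>\<bar> \<le> C * \<bar>s - t\<bar> powr \<gamma>"
  shows "\<bar>\<epsilon> powr (\<alpha> / 2) * F \<epsilon> b \<omega> - e powr (\<alpha> / 2) * F e b \<omega>\<bar> \<le> C * (2 * (e - \<epsilon>)) powr \<gamma> * mass * b"
proof -
  define W where "W x t = S (\<lambda>u. path \<omega> (t + x * (1 - u)))" for x t
  have GW: "x powr (\<alpha> / 2) * \<bar>G x t \<omega>\<bar> = \<bar>W x t\<bar>" if "0 < x" for x t
    using that by (simp add: G_def W_def abs_mult flip: mult.assoc powr_add)
  have Wc: "continuous_on UNIV (W x)" for x
  proof -
    have "continuous_on UNIV (\<lambda>(t, u). path \<omega> (t + x * (1 - u)))"
      unfolding case_prod_beta by (intro continuous_on_compose2[OF path_cont[OF \<omega>]] continuous_intros) auto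
    from riemann_tendsto2(2)[OF this] show ?thesis by (simp add: W_def[abs_def])
  qed
  have FW: "x powr (\<alpha> / 2) * F x b \<omega> = (LINT t:{0..b}|lborel. \<bar>W x t\<bar>)" if "0 < x" for x
    unfolding F_def set_integral_mult_right[symmetric] GW[OF that] ..
  have Wi: "set_integrable lborel {0..b} (\<lambda>t. \<bar>W x t\<bar>)" for x
    by (intro borel_integrable_atLeastAtMost' continuous_on_rabs continuous_on_subset[OF Wc]) simp
  define K where "K = C * (2 * (e - \<epsilon>)) powr \<gamma>"
  have K0: "0 \<le> K" using C by (simp add: K_def)
  have ad: "adm (\<lambda>u. path \<omega> (t + x * (1 - u)))" for t x
    by (intro adm_continuous continuous_on_compose2[OF path_cont[OF \<omega>]] continuous_intros) auto
  have "\<bar>\<bar>W \<epsilon> t\<bar> - \<bar>W e t\<bar>\<bar> \<le> K * mass" if t: "t \<in> {0..b}" for t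
  proof -
    have "W \<epsilon> t - W e t = S (\<lambda>u. path \<omega> (t + \<epsilon> * (1 - u)) - path \<omega> (t + e * (1 - u)))"
      unfolding W_def by (simp only: S_diff ad)
    also have "\<bar>\<dots>\<bar> \<le> K * mass"
    proof (rule S_bound)
      show "(\<lambda>u. path \<omega> (t + \<epsilon> * (1 - u)) - path \<omega> (t + e * (1 - u))) \<in> borel_measurable borel"
        using adm_diff[OF ad ad] by (rule adm_measurable)
      fix u :: real assume u: "u \<in> {-1..1}"
      let ?s = "t + \<epsilon> * (1 - u)" and ?s' = "t + e * (1 - u)"
      have le: "0 \<le> \<epsilon> * (1 - u)" "\<epsilon> * (1 - u) \<le> 1 * 2" "0 \<le> e * (1 - u)" "e * (1 - u) \<le> 1 * 2"
        using u e by (intro mult_nonneg_nonneg mult_mono; simp)+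
      have s: "?s \<in> {0..<real T}" "?s' \<in> {0..<real T}" using le t T by auto
      have "?s - ?s' = - ((e - \<epsilon>) * (1 - u))" by (simp add: algebra_simps)
      then have d: "\<bar>?s - ?s'\<bar> = (e - \<epsilon>) * (1 - u)" using u e by (simp add: abs_mult)
      also have "\<dots> \<le> (e - \<epsilon>) * 2" using u e by (intro mult_left_mono) auto
      finally have d2: "\<bar>?s - ?s'\<bar> \<le> 2 * (e - \<epsilon>)" by simp
      have "\<bar>X ?s \<omega> - X ?s' \<omega>\<bar> \<le> C * \<bar>?s - ?s'\<bar> powr \<gamma>" by (rule h[OF s d2])
      also have "\<dots> \<le> K" unfolding K_def using C \<gamma> d2 by (intro mult_left_mono powr_mono2) auto
      finally show "\<bar>path \<omega> ?s - path \<omega> ?s'\<bar> \<le> K" using s by (simp add: path_def)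
    qed
    finally show ?thesis by linarith
  qed
  then have "\<bar>LINT t:{0..b}|lborel. \<bar>W \<epsilon> t\<bar> - \<bar>W e t\<bar>\<bar> \<le> K * mass * (b - 0)"
    using borel_measurable_continuous_onI[OF Wc] b K0 by (intro set_integral_abs_le(2)) auto
  moreover have "(LINT t:{0..b}|lborel. \<bar>W \<epsilon> t\<bar> - \<bar>W e t\<bar>) = \<epsilon> powr (\<alpha> / 2) * F \<epsilon> b \<omega> - e powr (\<alpha> / 2) * F e b \<omega>"
    using e FW Wi by (simp add: set_integral_diff)
  ultimately show ?thesis by (simp add: K_def)
qed

end

section \<open>From the mesh to all small regularization parameters\<close>

context fbm_stieltjes
begin

text \<open>Between consecutive points of the mesh \<open>(1 / N) ^ k\<close> the function \<open>F\<close> moves little, by the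
  Hoelder continuity of the path: the mesh is so fine that the exponent \<open>\<gamma>\<close> may be taken slightly
  below \<open>\<alpha> / 2\<close>.\<close>

lemma F_tendsto_of_mesh:
  assumes \<omega>: "\<omega> \<in> space M" and b: "0 \<le> b" and T: "b + 2 < real T" and k: "0 < k"
    and h: "\<And>s t. s \<in> {0..<real T} \<Longrightarrow> t \<in> {0..<real T} \<Longrightarrow> \<bar>s - t\<bar> \<le> (1 / 2) ^ n0 \<Longrightarrow>
      \<bar>X s \<omega> - X t \<omega>\<bar> \<le> C * \<bar>s - t\<bar> powr \<gamma>"
    and \<gamma>: "\<gamma> = \<alpha> / 2 * (real k + 1 / 2) / (real k + 1)"
    and lim: "(\<lambda>n. F ((1 / real (Suc n)) ^ k) b \<omega>) \<longlonglongrightarrow> b * m1"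
  shows "((\<lambda>\<epsilon>. F \<epsilon> b \<omega>) \<longlongrightarrow> b * m1) (at_right 0)"
proof -
  define H where "H = \<alpha> / 2"
  have H: "0 < H" using \<alpha> by (simp add: H_def)
  have \<gamma>0: "0 < \<gamma>" using \<alpha> k by (simp add: \<gamma>)
  define e where "e N = (1 / real N) ^ k" for N
  \<comment> \<open>The mesh index just above \<epsilon>: for \<epsilon> at most \<open>1\<close>,
    \<epsilon> lies between \<open>e (Suc (N \<epsilon>))\<close> and
    \<open>e (N \<epsilon>)\<close>.\<close>
  define N where "N \<epsilon> = nat \<lfloor>\<epsilon> powr (- 1 / real k)\<rfloor>" for \<epsilon> :: real
  define q where "q n = (e n / e (Suc n)) powr H" for n
  define D where "D = \<bar>C\<bar> * (2 * real k) powr \<gamma> * mass * b * 2 powr (real k * H)"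
  \<comment> \<open>The three errors are the deviation at the mesh point, the ratio of the
    normalizing powers within a mesh interval, and the Hoelder oscillation of the unnormalized
    integral.\<close>
  define B where "B n = \<bar>F (e n) b \<omega> - b * m1\<bar> + (q n - 1) * \<bar>F (e n) b \<omega>\<bar> + D * (1 / real n) powr (H / 2)" for n
  have Fe: "(\<lambda>n. F (e n) b \<omega>) \<longlonglongrightarrow> b * m1"
    by (rule LIMSEQ_offset[of _ 1]) (use lim in \<open>simp add: e_def\<close>)
  have q1: "q \<longlonglongrightarrow> 1"
  proof -
    have "q (Suc n) = ((1 + 1 / real (Suc n)) ^ k) powr H" for n
      by (simp add: q_def e_def power_divide[symmetric] field_simps del: power_divide)
    moreover have "(\<lambda>n. ((1 + 1 / real (Suc n)) ^ k) powr H) \<longlonglongrightarrow> ((1 + 0) ^ k) powr H"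
      by (intro tendsto_intros LIMSEQ_Suc[OF lim_1_over_n]) auto
    ultimately have "(\<lambda>n. q (Suc n)) \<longlonglongrightarrow> 1" by simp
    then show ?thesis by (rule LIMSEQ_imp_Suc)
  qed
  have B0: "B \<longlonglongrightarrow> 0"
  proof -
    have "B \<longlonglongrightarrow> \<bar>b * m1 - b * m1\<bar> + (1 - 1) * \<bar>b * m1\<bar> + D * 0 powr (H / 2)"
      unfolding B_def using H
      by (intro tendsto_intros Fe q1 tendsto_powr' lim_1_over_n) auto
    then show ?thesis by simp
  qed
  \<comment> \<open>Bernoulli's inequality: the spacing of the mesh gains a factor of order
    \<open>1 / n\<close> over the mesh point itself.\<close>
  have gap: "e n - e (Suc n) \<le> real k * (1 / real n) ^ Suc k" "e (Suc n) \<le> e n" if n: "0 < n" for n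
  proof -
    have eS: "e (Suc n) = e n * (1 - 1 / real (Suc n)) ^ k"
    proof -
      have "1 - 1 / real (Suc n) = real n / real (Suc n)" by (simp add: field_simps)
      then show ?thesis using n by (simp add: e_def power_mult_distrib[symmetric])
    qed
    have "1 + real k * (- (1 / real (Suc n))) \<le> (1 + - (1 / real (Suc n))) ^ k"
      by (rule Bernoulli_inequality) (simp add: field_simps)
    then have "1 - (1 - 1 / real (Suc n)) ^ k \<le> real k * (1 / real (Suc n))" by simp
    then have "e n * (1 - (1 - 1 / real (Suc n)) ^ k) \<le> e n * (real k * (1 / real (Suc n)))"
      by (rule mult_left_mono) (simp add: e_def)
    also have "\<dots> \<le> e n * (real k * (1 / real n))"
      using n by (intro mult_left_mono) (auto simp: e_def frac_le)
    finally have "e n * (1 - (1 - 1 / real (Suc n)) ^ k) \<le> real k * (1 / real n) ^ Suc k"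
      by (simp add: e_def mult_ac)
    then show "e n - e (Suc n) \<le> real k * (1 / real n) ^ Suc k" unfolding eS by (simp add: right_diff_distrib)
    show "e (Suc n) \<le> e n" unfolding e_def using n by (intro power_mono) (auto simp: frac_le)
  qed
  have root_pow: "(\<epsilon> powr (- 1 / real k)) ^ k = 1 / \<epsilon>" if "0 < \<epsilon>" for \<epsilon> :: real
  proof -
    have "(\<epsilon> powr (- 1 / real k)) ^ k = \<epsilon> powr (real k * (- 1 / real k))"
      using that by (intro powr_power) simp
    also have "real k * (- 1 / real k) = - 1" using k by simp
    finally show ?thesis using that by (simp add: powr_minus_divide)
  qed
  have N_lim: "filterlim N at_top (at_right 0)"
  proof -
    have "\<forall>\<^sub>F \<epsilon> in at_right 0. Z \<le> N \<epsilon>" for Z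
    proof -
      have "\<forall>\<^sub>F \<epsilon> in at_right 0. \<epsilon> \<in> {0<..<(1 / real (Suc Z)) ^ k}"
        by (intro eventually_at_right_real) simp
      then show ?thesis
      proof eventually_elim
        case (elim \<epsilon>)
        then have "real (Suc Z) ^ k < 1 / \<epsilon>" by (simp add: power_one_over field_simps)
        also have "1 / \<epsilon> = (\<epsilon> powr (- 1 / real k)) ^ k" using elim by (intro root_pow[symmetric]) simp
        finally have "real (Suc Z) < \<epsilon> powr (- 1 / real k)" by (rule power_less_imp_less_base) simp
        then show ?case unfolding N_def by linarith
      qed
    qed
    then show ?thesis by (auto simp: filterlim_at_top)
  qed
  have main: "\<bar>F \<epsilon> b \<omega> - b * m1\<bar> \<le> B (N \<epsilon>)"
    if \<epsilon>: "0 < \<epsilon>" "\<epsilon> \<le> 1" and small: "2 * real k * (1 / real (N \<epsilon>)) ^ Suc k \<le> (1 / 2) ^ n0" for \<epsilon>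
  proof -
    define n where "n = N \<epsilon>"
    define z where "z = \<epsilon> powr (- 1 / real k)"
    have z1: "1 \<le> z" using ge_one_powr_ge_zero[of "1 / \<epsilon>" "1 / real k"] \<epsilon>
      by (simp add: z_def powr_divide powr_minus_divide)
    have zk: "z ^ k = 1 / \<epsilon>" unfolding z_def by (rule root_pow[OF \<epsilon>(1)])
    have nz: "real n \<le> z" "z \<le> real (Suc n)" "0 < n"
      using z1 unfolding n_def N_def z_def[symmetric] by linarith+
    have "real n ^ k \<le> 1 / \<epsilon>" "1 / \<epsilon> \<le> real (Suc n) ^ k"
      unfolding zk[symmetric] using nz z1 by (intro power_mono; simp)+
    then have en: "\<epsilon> \<le> e n" "e (Suc n) \<le> \<epsilon>"
      using \<epsilon> nz by (auto simp: e_def power_one_over field_simps)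
    have e1: "e n \<le> 1" using nz by (simp add: e_def power_le_one)
    have ep: "0 < e n" "0 < e (Suc n)" using nz by (auto simp: e_def)
    have d: "e n - \<epsilon> \<le> real k * (1 / real n) ^ Suc k" using gap(1)[OF nz(3)] en by linarith
    have d0: "0 \<le> e n - \<epsilon>" using en by simp
    have "\<bar>\<epsilon> powr H * F \<epsilon> b \<omega> - e n powr H * F (e n) b \<omega>\<bar> \<le> \<bar>C\<bar> * (2 * (e n - \<epsilon>)) powr \<gamma> * mass * b"
      unfolding H_def
    proof (rule F_scaled_diff[OF \<omega> \<epsilon>(1) en(1) e1 b T \<gamma>0])
      fix s t assume st: "s \<in> {0..<real T}" "t \<in> {0..<real T}" "\<bar>s - t\<bar> \<le> 2 * (e n - \<epsilon>)"
      have "2 * (e n - \<epsilon>) \<le> 2 * (real k * (1 / real n) ^ Suc k)" using d by (intro mult_left_mono) auto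
      with st(3) small have "\<bar>s - t\<bar> \<le> (1 / 2) ^ n0" unfolding n_def mult.assoc by (meson order_trans)
      from h[OF st(1,2) this] have "\<bar>X s \<omega> - X t \<omega>\<bar> \<le> C * \<bar>s - t\<bar> powr \<gamma>" .
      also have "\<dots> \<le> \<bar>C\<bar> * \<bar>s - t\<bar> powr \<gamma>" by (intro mult_right_mono) auto
      finally show "\<bar>X s \<omega> - X t \<omega>\<bar> \<le> \<bar>C\<bar> * \<bar>s - t\<bar> powr \<gamma>" .
    qed simp
    also have "\<dots> \<le> \<bar>C\<bar> * (2 * (real k * (1 / real n) ^ Suc k)) powr \<gamma> * mass * b"
      using d d0 b \<gamma>0 by (intro mult_right_mono mult_left_mono powr_mono2) auto
    finally have W: "\<bar>\<epsilon> powr H * F \<epsilon> b \<omega> - e n powr H * F (e n) b \<omega>\<bar> \<le> \<bar>C\<bar> * (2 * (real k * (1 / real n) ^ Suc k)) powr \<gamma> * mass * b" .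
    define r where "r = (e n / \<epsilon>) powr H"
    have pe: "0 < \<epsilon> powr H" using \<epsilon> by simp
    have "F \<epsilon> b \<omega> - r * F (e n) b \<omega> = (\<epsilon> powr H * F \<epsilon> b \<omega> - e n powr H * F (e n) b \<omega>) / \<epsilon> powr H"
      using pe \<epsilon> ep by (simp add: r_def powr_divide diff_divide_distrib)
    then have "\<bar>F \<epsilon> b \<omega> - r * F (e n) b \<omega>\<bar> \<le> \<bar>C\<bar> * (2 * (real k * (1 / real n) ^ Suc k)) powr \<gamma> * mass * b / \<epsilon> powr H"
      using W pe by (simp add: divide_right_mono)
    also have "\<dots> \<le> \<bar>C\<bar> * (2 * (real k * (1 / real n) ^ Suc k)) powr \<gamma> * mass * b / e (Suc n) powr H"
      using en ep b H by (intro divide_left_mono powr_mono2 mult_pos_pos) auto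
    also have "\<dots> \<le> D * (1 / real n) powr (H / 2)"
    proof -
      have n1: "1 / real n = real n powr (- 1)" using nz by (simp add: powr_minus_divide)
      have 1: "(2 * (real k * (1 / real n) ^ Suc k)) powr \<gamma> = (2 * real k) powr \<gamma> * real n powr (- (real k + 1) * \<gamma>)"
      proof -
        have "(1 / real n) ^ Suc k = real n powr (- (real k + 1))"
          unfolding n1 using nz by (subst powr_power) (auto simp: algebra_simps)
        then show ?thesis by (simp add: powr_mult powr_powr mult.assoc[symmetric] del: power_Suc)
      qed
      have 2: "1 / e (Suc n) powr H = real (Suc n) powr (real k * H)"
        by (simp add: e_def power_one_over powr_divide powr_realpow[symmetric] powr_powr del: of_nat_Suc)
      have "real (Suc n) powr (real k * H) \<le> (2 * real n) powr (real k * H)"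
        using nz H by (intro powr_mono2) auto
      also have "\<dots> = 2 powr (real k * H) * real n powr (real k * H)" by (simp add: powr_mult)
      finally have 3: "1 / e (Suc n) powr H \<le> 2 powr (real k * H) * real n powr (real k * H)" unfolding 2 .
      \<comment> \<open>The spacing contributes \<open>n\<close> to the power
        \<open>- (k + 1) * \<gamma>\<close> and the normalization the power \<open>k * H\<close>; by
        the choice of \<open>\<gamma>\<close> their sum is \<open>- H / 2\<close>, so a decay
        remains although \<open>\<gamma>\<close> is below \<open>H\<close>.\<close>
      have "(real k + 1) * \<gamma> = H * (real k + 1 / 2)"
        unfolding \<gamma> H_def by (simp add: field_simps)
      then have 4: "- (real k + 1) * \<gamma> + real k * H = - (H / 2)" by (simp add: algebra_simps)
      have "\<bar>C\<bar> * (2 * (real k * (1 / real n) ^ Suc k)) powr \<gamma> * mass * b / e (Suc n) powr H =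
        \<bar>C\<bar> * (2 * (real k * (1 / real n) ^ Suc k)) powr \<gamma> * mass * b * (1 / e (Suc n) powr H)" by simp
      also have "\<dots> \<le> \<bar>C\<bar> * (2 * (real k * (1 / real n) ^ Suc k)) powr \<gamma> * mass * b * (2 powr (real k * H) * real n powr (real k * H))"
        using b by (intro mult_left_mono 3) auto
      also have "\<dots> = D * (real n powr (- (real k + 1) * \<gamma>) * real n powr (real k * H))"
        unfolding 1 D_def by (simp only: mult_ac)
      also have "real n powr (- (real k + 1) * \<gamma>) * real n powr (real k * H) = real n powr (- (H / 2))"
        unfolding powr_add[symmetric] 4 ..
      also have "\<dots> = (1 / real n) powr (H / 2)" using nz by (simp add: powr_divide powr_minus_divide)
      finally show ?thesis .
    qed
    finally have 1: "\<bar>F \<epsilon> b \<omega> - r * F (e n) b \<omega>\<bar> \<le> D * (1 / real n) powr (H / 2)" .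
    have r: "1 \<le> r" "r \<le> q n"
    proof -
      have "1 \<le> e n / \<epsilon>" using en \<epsilon> by simp
      then show "1 \<le> r" unfolding r_def using H by (intro ge_one_powr_ge_zero) auto
      show "r \<le> q n" unfolding r_def q_def using en ep \<epsilon> H
        by (intro powr_mono2 divide_left_mono mult_pos_pos) auto
    qed
    have "\<bar>(r - 1) * F (e n) b \<omega>\<bar> \<le> (q n - 1) * \<bar>F (e n) b \<omega>\<bar>"
      unfolding abs_mult using r by (intro mult_right_mono) auto
    moreover have "F \<epsilon> b \<omega> - b * m1 = (F \<epsilon> b \<omega> - r * F (e n) b \<omega>) + (r - 1) * F (e n) b \<omega> + (F (e n) b \<omega> - b * m1)"
      by (simp add: algebra_simps)
    ultimately show ?thesis using 1 unfolding B_def n_def[symmetric] by linarith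
  qed
  have "(\<lambda>n. 2 * real k * (1 / real n) ^ Suc k) \<longlonglongrightarrow> 2 * real k * 0 ^ Suc k"
    by (intro tendsto_intros lim_1_over_n)
  then have "\<forall>\<^sub>F n in sequentially. 2 * real k * (1 / real n) ^ Suc k < (1 / 2) ^ n0"
    by (intro order_tendstoD) auto
  then have "\<forall>\<^sub>F \<epsilon> in at_right 0. 2 * real k * (1 / real (N \<epsilon>)) ^ Suc k < (1 / 2) ^ n0"
    using N_lim by (rule eventually_compose_filterlim)
  moreover have "\<forall>\<^sub>F \<epsilon> in at_right 0. \<epsilon> \<in> {0<..<1::real}" by (intro eventually_at_right_real) simp
  ultimately have ev: "\<forall>\<^sub>F \<epsilon> in at_right 0. norm (F \<epsilon> b \<omega> - b * m1) \<le> B (N \<epsilon>)"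
  proof eventually_elim
    case (elim \<epsilon>)
    have "\<bar>F \<epsilon> b \<omega> - b * m1\<bar> \<le> B (N \<epsilon>)"
      by (rule main) (use elim in \<open>simp_all only: greaterThanLessThan_iff less_imp_le\<close>)
    then show ?case by (simp only: real_norm_def)
  qed
  have "((\<lambda>\<epsilon>. F \<epsilon> b \<omega> - b * m1) \<longlongrightarrow> 0) (at_right 0)"
    by (rule Lim_null_comparison[OF ev filterlim_compose[OF B0 N_lim]])
  then show ?thesis by (simp add: LIM_zero_iff)
qed

lemma AE_F_tendsto:
  assumes p: "0 < \<rho> 0" and b: "0 \<le> b"
  shows "AE \<omega> in M. ((\<lambda>\<epsilon>. F \<epsilon> b \<omega>) \<longlongrightarrow> b * m1) (at_right 0)"
proof -
  have rate: "0 < rate" using \<alpha> by (simp add: rate_def)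
  obtain k :: nat where k: "2 / rate \<le> real k" using real_arch_simple by blast
  have k2: "2 \<le> real k * rate" using k rate by (simp add: divide_le_eq)
  then have k0: "0 < k" by (cases k) auto
  \<comment> \<open>Between \<open>\<alpha> / 2 * k / (k + 1)\<close>, below which the mesh would be
    too coarse, and \<open>\<alpha> / 2\<close>, the limit of Hoelder regularity.\<close>
  define \<gamma> where "\<gamma> = \<alpha> / 2 * (real k + 1 / 2) / (real k + 1)"
  have \<gamma>: "0 < \<gamma>" "\<gamma> < \<alpha> / 2" 
  proof -
    show "0 < \<gamma>" unfolding \<gamma>_def using \<alpha> by (intro divide_pos_pos mult_pos_pos) auto
    have "\<alpha> / 2 * (real k + 1 / 2) < \<alpha> / 2 * (real k + 1)" using \<alpha> by (intro mult_strict_left_mono) auto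
    then show "\<gamma> < \<alpha> / 2" unfolding \<gamma>_def by (intro iffD2[OF pos_divide_less_eq]) simp
  qed
  obtain T :: nat where T: "b + 2 < real T" using reals_Archimedean2 by blast
  show ?thesis using AE_holder[OF \<gamma>] AE_F_seq[OF p b k2] AE_space
  proof eventually_elim
    case (elim \<omega>)
    from elim(1) obtain n0 C where "\<forall>s t. s \<in> {0..<real T} \<longrightarrow> t \<in> {0..<real T} \<longrightarrow> \<bar>s - t\<bar> \<le> (1 / 2) ^ n0 \<longrightarrow>
      \<bar>X s \<omega> - X t \<omega>\<bar> \<le> C * \<bar>s - t\<bar> powr \<gamma>" by blast
    then show ?case
      by (intro F_tendsto_of_mesh[OF elim(3) b T k0 _ \<gamma>_def elim(2)]) blast
  qed
qed

end

subsection \<open>Weak convergence of densities\<close>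

lemma integral_split_cells:
  fixes f :: "real \<Rightarrow> real"
  assumes f: "continuous_on UNIV f" and d: "0 \<le> d"
  shows "integral {a..a + real n * d} f = (\<Sum>i<n. integral {a + real i * d..a + real (Suc i) * d} f)"
proof (induction n)
  case (Suc n)
  have "integral {a..a + real n * d} f + integral {a + real n * d..a + real (Suc n) * d} f = integral {a..a + real (Suc n) * d} f"
    using d by (intro Henstock_Kurzweil_Integration.integral_combine integrable_continuous_real continuous_on_subset[OF f])
      (auto simp: algebra_simps)
  then show ?case using Suc.IH by simp
qed simp

text \<open>The weights \<open>g\<close> need not converge pointwise. On cells so short that
  \<open>h\<close> is almost constant, only the masses of \<open>g\<close> matter, and these
  converge by assumption.\<close>

lemma integral_weak_tendsto:
  fixes g \<phi> :: "real \<Rightarrow> real \<Rightarrow> real" and h :: "real \<Rightarrow> real"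
  assumes ab: "a \<le> b"
    and gc: "\<And>\<epsilon>. continuous_on UNIV (g \<epsilon>)" and g0: "\<And>\<epsilon> t. 0 \<le> g \<epsilon> t"
    and phc: "\<And>\<epsilon>. 0 < \<epsilon> \<Longrightarrow> continuous_on UNIV (\<phi> \<epsilon>)" and h: "continuous_on UNIV h"
    and lim: "\<And>c d. a \<le> c \<Longrightarrow> c \<le> d \<Longrightarrow> d \<le> b \<Longrightarrow> ((\<lambda>\<epsilon>. integral {c..d} (g \<epsilon>)) \<longlongrightarrow> m * (d - c)) (at_right 0)"
    and m: "0 \<le> m"
    and unif: "\<And>\<eta>. 0 < \<eta> \<Longrightarrow> \<forall>\<^sub>F \<epsilon> in at_right 0. \<forall>t\<in>{a..b}. \<bar>\<phi> \<epsilon> t - h t\<bar> \<le> \<eta>"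
  shows "((\<lambda>\<epsilon>. integral {a..b} (\<lambda>t. \<phi> \<epsilon> t * g \<epsilon> t)) \<longlongrightarrow> m * integral {a..b} h) (at_right 0)"
proof (rule tendstoI)
  fix r :: real assume r: "0 < r"
  define Z where "Z = m * (b - a)"
  have Z0: "0 \<le> Z" using m ab by (simp add: Z_def)
  \<comment> \<open>The errors add up to \<open>2 * \<eta> * (Z + 1)\<close> for the integrands on
    the cells, \<open>\<eta>\<close> for the cell masses and \<open>\<eta> * Z\<close> for the
    Riemann sum of \<open>h\<close>; the denominator exceeds the total factor by one to make the
    bound strict.\<close>
  define \<eta> where "\<eta> = r / (2 * (Z + 1) + Z + 2)"
  have \<eta>: "0 < \<eta>" using r Z0 by (simp add: \<eta>_def)
  have \<eta>r: "2 * \<eta> * (Z + 1) + \<eta> + \<eta> * Z < r"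
  proof -
    have "2 * \<eta> * (Z + 1) + \<eta> + \<eta> * Z < \<eta> * (2 * (Z + 1) + Z + 2)" using \<eta> by (simp add: algebra_simps)
    also have "\<dots> = r" using Z0 by (simp add: \<eta>_def)
    finally show ?thesis .
  qed
  have "uniformly_continuous_on {a..b} h"
    by (intro compact_uniformly_continuous continuous_on_subset[OF h]) auto
  then obtain d0 where d0: "0 < d0" "\<And>s t. s \<in> {a..b} \<Longrightarrow> t \<in> {a..b} \<Longrightarrow> \<bar>s - t\<bar> < d0 \<Longrightarrow> \<bar>h s - h t\<bar> < \<eta>"
    unfolding uniformly_continuous_on_def dist_real_def using \<eta> by metis
  obtain n0 :: nat where n0: "(b - a) / d0 < real n0" using reals_Archimedean2 by blast
  define n where "n = Suc n0"
  define d where "d = (b - a) / real n"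
  have n: "0 < n" by (simp add: n_def)
  have d: "0 \<le> d" "d < d0" "real n * d = b - a"
  proof -
    show "0 \<le> d" "real n * d = b - a" using ab n by (auto simp: d_def)
    have "(b - a) / d0 < real n" using n0 by (simp add: n_def)
    then show "d < d0" using d0(1) n by (simp add: d_def field_simps)
  qed
  define s where "s i = a + real i * d" for i
  have sS: "s (Suc i) = s i + d" for i by (simp add: s_def algebra_simps)
  have s_mono: "s i \<le> s (Suc i)" for i using d by (simp add: sS)
  have sb: "a \<le> s i" "s i \<le> b" if "i \<le> n" for i
  proof -
    show "a \<le> s i" using d by (simp add: s_def)
    have "real i * d \<le> real n * d" using that d by (intro mult_right_mono) auto
    then show "s i \<le> b" using d by (simp add: s_def)
  qed
  have ends: "s 0 = a" "s n = b" using d by (auto simp: s_def)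
  have cells: "integral {a..b} f = (\<Sum>i<n. integral {s i..s (Suc i)} f)" if fc: "continuous_on UNIV f" for f :: "real \<Rightarrow> real"
    using integral_split_cells[OF fc d(1), of a n] d(3) by (simp add: s_def)
  define q where "q \<epsilon> i = integral {s i..s (Suc i)} (g \<epsilon>)" for \<epsilon> i
  \<comment> \<open>Used twice: with the weight \<open>g\<close>, and with the constant weight
    \<open>1\<close> for the Riemann sum of \<open>h\<close>.\<close>
  have loc: "\<bar>integral {s i..s (Suc i)} (\<lambda>t. f t * w t) - h (s i) * integral {s i..s (Suc i)} w\<bar> \<le> K * integral {s i..s (Suc i)} w"
    if i: "i < n" and f: "continuous_on UNIV f" and w: "continuous_on UNIV w" "\<And>t. 0 \<le> w t"
      and K: "\<And>t. t \<in> {s i..s (Suc i)} \<Longrightarrow> \<bar>f t - h (s i)\<bar> \<le> K" for i f w K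
  proof -
    have iw: "w integrable_on {s i..s (Suc i)}" "(\<lambda>t. f t * w t) integrable_on {s i..s (Suc i)}"
      by (intro integrable_continuous_real continuous_intros continuous_on_subset[OF f] continuous_on_subset[OF w(1)]; simp)+
    have iwc: "(\<lambda>t. c * w t) integrable_on {s i..s (Suc i)}" for c
      by (intro integrable_continuous_real continuous_on_mult continuous_on_const continuous_on_subset[OF w(1)]) simp
    have "integral {s i..s (Suc i)} (\<lambda>t. f t * w t) - h (s i) * integral {s i..s (Suc i)} w =
      integral {s i..s (Suc i)} (\<lambda>t. f t * w t - h (s i) * w t)"
      using iw iwc by (subst Henstock_Kurzweil_Integration.integral_diff) auto
    also have "norm \<dots> \<le> integral {s i..s (Suc i)} (\<lambda>t. K * w t)"
    proof (rule integral_norm_bound_integral)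
      show "(\<lambda>t. f t * w t - h (s i) * w t) integrable_on {s i..s (Suc i)}"
        using iw iwc by (intro integrable_diff) auto
      show "(\<lambda>t. K * w t) integrable_on {s i..s (Suc i)}" by (rule iwc)
      fix t assume "t \<in> {s i..s (Suc i)}"
      then have "\<bar>f t - h (s i)\<bar> * w t \<le> K * w t" by (intro mult_right_mono K w)
      then show "norm (f t * w t - h (s i) * w t) \<le> K * w t"
        using w(2)[of t] by (simp add: abs_mult flip: left_diff_distrib)
    qed
    finally show ?thesis by simp
  qed
  have hi: "\<bar>h t - h (s i)\<bar> \<le> \<eta>" if "i < n" "t \<in> {s i..s (Suc i)}" for i t
    using d0(2)[of t "s i"] sb[of i] sb[of "Suc i"] that d sS[of i] by (auto simp: less_imp_le)
  have qlim: "((\<lambda>\<epsilon>. q \<epsilon> i) \<longlongrightarrow> m * d) (at_right 0)" if "i < n" for i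
    unfolding q_def using lim[of "s i" "s (Suc i)"] sb[of i] sb[of "Suc i"] that s_mono[of i] sS[of i] by simp
  have Slim: "((\<lambda>\<epsilon>. \<Sum>i<n. h (s i) * q \<epsilon> i) \<longlongrightarrow> (\<Sum>i<n. h (s i) * (m * d))) (at_right 0)"
    by (intro tendsto_sum tendsto_mult_left qlim) simp
  have Qlim: "((\<lambda>\<epsilon>. integral {a..b} (g \<epsilon>)) \<longlongrightarrow> Z) (at_right 0)"
    unfolding Z_def by (rule lim) (use ab in auto)
  have h_part: "\<bar>m * integral {a..b} h - (\<Sum>i<n. h (s i) * (m * d))\<bar> \<le> \<eta> * Z"
  proof -
    have "\<bar>integral {a..b} h - (\<Sum>i<n. h (s i) * d)\<bar> \<le> (\<Sum>i<n. \<eta> * d)"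
      unfolding cells[OF h] sum_subtractf[symmetric]
    proof (intro order_trans[OF sum_abs] sum_mono)
      fix i assume "i \<in> {..<n}"
      then have "\<bar>integral {s i..s (Suc i)} (\<lambda>t. h t * 1) - h (s i) * integral {s i..s (Suc i)} (\<lambda>t. 1)\<bar>
        \<le> \<eta> * integral {s i..s (Suc i)} (\<lambda>t. 1)"
        using hi by (intro loc h continuous_on_const) auto
      then show "\<bar>integral {s i..s (Suc i)} h - h (s i) * d\<bar> \<le> \<eta> * d"
        using d by (simp add: sS)
    qed
    also have "\<dots> = \<eta> * (b - a)" using d(3) by (simp add: mult.left_commute)
    finally have *: "\<bar>integral {a..b} h - (\<Sum>i<n. h (s i) * d)\<bar> \<le> \<eta> * (b - a)" .
    have "m * integral {a..b} h - (\<Sum>i<n. h (s i) * (m * d)) = m * (integral {a..b} h - (\<Sum>i<n. h (s i) * d))"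
      by (simp add: right_diff_distrib sum_distrib_left mult.left_commute)
    then have "\<bar>m * integral {a..b} h - (\<Sum>i<n. h (s i) * (m * d))\<bar> = m * \<bar>integral {a..b} h - (\<Sum>i<n. h (s i) * d)\<bar>"
      using m by (simp add: abs_mult)
    also have "\<dots> \<le> m * (\<eta> * (b - a))" using * m by (rule mult_left_mono)
    finally show ?thesis by (simp add: Z_def mult_ac)
  qed
  have "\<forall>\<^sub>F \<epsilon> in at_right 0. dist (\<Sum>i<n. h (s i) * q \<epsilon> i) (\<Sum>i<n. h (s i) * (m * d)) < \<eta>"
    by (rule tendstoD[OF Slim \<eta>])
  moreover have "\<forall>\<^sub>F \<epsilon> in at_right 0. integral {a..b} (g \<epsilon>) < Z + 1"
    by (rule order_tendstoD[OF Qlim]) simp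
  moreover note unif[OF \<eta>] eventually_at_right_less[of "0::real"]
  ultimately show "\<forall>\<^sub>F \<epsilon> in at_right 0. dist (integral {a..b} (\<lambda>t. \<phi> \<epsilon> t * g \<epsilon> t)) (m * integral {a..b} h) < r"
  proof eventually_elim
    case (elim \<epsilon>)
    have fc: "continuous_on UNIV (\<lambda>t. \<phi> \<epsilon> t * g \<epsilon> t)" by (intro continuous_on_mult phc gc elim)
    have "\<bar>integral {a..b} (\<lambda>t. \<phi> \<epsilon> t * g \<epsilon> t) - (\<Sum>i<n. h (s i) * q \<epsilon> i)\<bar> \<le> (\<Sum>i<n. (2 * \<eta>) * q \<epsilon> i)"
      unfolding cells[OF fc] sum_subtractf[symmetric]
    proof (intro order_trans[OF sum_abs] sum_mono)
      fix i assume i: "i \<in> {..<n}"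
      show "\<bar>integral {s i..s (Suc i)} (\<lambda>t. \<phi> \<epsilon> t * g \<epsilon> t) - h (s i) * q \<epsilon> i\<bar> \<le> (2 * \<eta>) * q \<epsilon> i"
        unfolding q_def
      proof (intro loc phc gc elim g0)
        fix t assume t: "t \<in> {s i..s (Suc i)}"
        then have "t \<in> {a..b}" using sb[of i] sb[of "Suc i"] i by auto
        then have "\<bar>\<phi> \<epsilon> t - h t\<bar> \<le> \<eta>" using elim by blast
        moreover have "\<bar>h t - h (s i)\<bar> \<le> \<eta>" using hi t i by auto
        ultimately show "\<bar>\<phi> \<epsilon> t - h (s i)\<bar> \<le> 2 * \<eta>" by linarith
      qed (use i in auto)
    qed
    also have "\<dots> = 2 * \<eta> * integral {a..b} (g \<epsilon>)"
      unfolding cells[OF gc] q_def by (simp add: sum_distrib_left)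
    also have "\<dots> \<le> 2 * \<eta> * (Z + 1)" using elim \<eta> by (intro mult_left_mono) auto
    finally show ?case using elim h_part \<eta>r unfolding dist_real_def by linarith
  qed
qed

section \<open>Speed of the regularized path and its weak limit\<close>

locale regularization = fbm_stieltjes M X \<alpha> P N for M :: "'a measure" and X \<alpha> P N +
  fixes \<psi> :: "real \<Rightarrow> real"
  assumes \<psi>_cdf: "AE u in lborel. \<psi> u = measure P {..u} - measure N {..u}"
    and \<psi>_borel [measurable]: "\<psi> \<in> borel_measurable borel"
    and \<psi>_support: "u \<notin> {-1..1} \<Longrightarrow> \<psi> u = 0"
    and \<psi>_integral: "(\<integral>u. \<psi> u \<partial>lborel) = 1"
begin

definition smoothed :: "real \<Rightarrow> 'a \<Rightarrow> real \<Rightarrow> real" where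
  "smoothed \<epsilon> \<omega> t = (\<integral>u. \<psi> u * path \<omega> (t - \<epsilon> * u) \<partial>lborel)"

definition dsmoothed :: "real \<Rightarrow> 'a \<Rightarrow> real \<Rightarrow> real" where
  "dsmoothed \<epsilon> \<omega> t = S (\<lambda>v. path \<omega> (t - \<epsilon> * v)) / \<epsilon>"

text \<open>The integral of a function that is not integrable is \<open>0\<close> by convention, so
  the value \<open>1\<close> implies integrability.\<close>

lemma \<psi>_integrable: "integrable lborel \<psi>"
  using \<psi>_integral not_integrable_integral_eq by fastforce

lemma smoothed_deriv: "\<omega> \<in> space M \<Longrightarrow> 0 < \<epsilon> \<Longrightarrow> (smoothed \<epsilon> \<omega> has_real_derivative dsmoothed \<epsilon> \<omega> t) (at t)"
  unfolding smoothed_def[abs_def] dsmoothed_def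
  by (rule convolution_has_derivative[OF \<psi>_cdf \<psi>_borel]) (auto intro: \<psi>_support path_cont)

lemma dsmoothed_cont: "\<omega> \<in> space M \<Longrightarrow> continuous_on UNIV (dsmoothed \<epsilon> \<omega>)"
  unfolding dsmoothed_def[abs_def] divide_inverse
  by (intro continuous_on_mult_right continuous_S_shift path_cont)

lemma dsmoothed_G: "0 < \<epsilon> \<Longrightarrow> dsmoothed \<epsilon> \<omega> t = \<epsilon> powr (\<alpha> / 2 - 1) * G \<epsilon> (t - \<epsilon>) \<omega>"
  unfolding dsmoothed_def G_def
  by (simp add: algebra_simps powr_diff powr_minus_divide)

lemma smoothed_unif:
  assumes \<omega>: "\<omega> \<in> space M" and \<eta>: "0 < \<eta>"
  shows "\<forall>\<^sub>F \<epsilon> in at_right 0. \<forall>t\<in>{a..b}. \<bar>smoothed \<epsilon> \<omega> t - path \<omega> t\<bar> \<le> \<eta>"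
proof -
  define J where "J = (\<integral>u. \<bar>\<psi> u\<bar> \<partial>lborel)"
  have J0: "0 \<le> J" by (simp add: J_def)
  define \<eta>' where "\<eta>' = \<eta> / (J + 1)"
  have \<eta>': "0 < \<eta>'" using \<eta> J0 by (simp add: \<eta>'_def)
  have "uniformly_continuous_on {a - 1..b + 1} (path \<omega>)"
    by (intro compact_uniformly_continuous continuous_on_subset[OF path_cont[OF \<omega>]]) auto
  then obtain d where d: "0 < d" "\<And>s t. s \<in> {a - 1..b + 1} \<Longrightarrow> t \<in> {a - 1..b + 1} \<Longrightarrow> \<bar>s - t\<bar> < d \<Longrightarrow> \<bar>path \<omega> s - path \<omega> t\<bar> < \<eta>'"
    unfolding uniformly_continuous_on_def dist_real_def using \<eta>' by metis
  have "\<forall>\<^sub>F \<epsilon> in at_right 0. \<epsilon> \<in> {0<..<min 1 d}" using d(1) by (intro eventually_at_right_real) simp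
  then show ?thesis
  proof eventually_elim
    case (elim \<epsilon>)
    show ?case
    proof
      fix t assume t: "t \<in> {a..b}"
      have "\<bar>smoothed \<epsilon> \<omega> t - path \<omega> t\<bar> \<le> \<eta>' * J"
        unfolding smoothed_def J_def
      proof (rule regularized_close[OF \<psi>_integrable \<psi>_integral \<psi>_support path_cont[OF \<omega>]])
        fix u :: real assume u: "u \<in> {-1..1}"
        have "\<bar>\<epsilon> * u\<bar> \<le> \<epsilon> * 1" unfolding abs_mult using u elim by (intro mult_mono) auto
        then have "\<bar>\<epsilon> * u\<bar> < 1" "\<bar>\<epsilon> * u\<bar> < d" using elim by auto
        then show "\<bar>path \<omega> (t - \<epsilon> * u) - path \<omega> t\<bar> \<le> \<eta>'" using t by (intro less_imp_le d(2)) auto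
      qed
      also have "\<eta>' * J \<le> \<eta>' * (J + 1)" using \<eta>' by (intro mult_left_mono) auto
      also have "\<dots> = \<eta>" using J0 by (simp add: \<eta>'_def)
      finally show "\<bar>smoothed \<epsilon> \<omega> t - path \<omega> t\<bar> \<le> \<eta>" .
    qed
  qed
qed

lemma F_eq_integral:
  assumes "\<omega> \<in> space M" shows "F \<epsilon> b \<omega> = integral {0..b} (\<lambda>t. \<bar>G \<epsilon> t \<omega>\<bar>)"
  unfolding F_def
  by (intro set_borel_integral_eq_integral(2) borel_integrable_atLeastAtMost' continuous_on_rabs
      continuous_on_subset[OF G_cont[OF assms]]) simp

text \<open>If \<open>\<rho> 0\<close> vanished, every regularized path would be constant, and hence so would be the
  path itself.\<close>

lemma \<rho>_0_pos: "0 < \<rho> 0"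
proof (rule ccontr)
  assume "\<not> 0 < \<rho> 0"
  then have r0: "\<rho> 0 = 0" using \<rho>_0_nonneg by simp
  \<comment> \<open>The mean of this nonnegative variable is \<open>2 * m1\<close>, which vanishes
    with \<open>\<rho> 0\<close>; a sequence of parameters keeps the exceptional sets countable in
    number.\<close>
  have "AE \<omega> in M. F (1 / real (Suc n)) 2 \<omega> = 0" for n
  proof -
    have "(\<integral>\<^sup>+\<omega>. ennreal (F (1 / real (Suc n)) 2 \<omega>) \<partial>M) = 0"
      using F_mean[of "1 / real (Suc n)" 2] by (simp add: m1_def r0)
    then have "AE \<omega> in M. ennreal (F (1 / real (Suc n)) 2 \<omega>) = 0"
      by (subst (asm) nn_integral_0_iff_AE) auto
    with AE_space show ?thesis
    proof eventually_elim
      case (elim \<omega>)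
      then show ?case using F_nn(2)[of \<omega>] by (auto simp: ennreal_eq_0_iff intro: antisym)
    qed
  qed
  then have "AE \<omega> in M. \<forall>n. F (1 / real (Suc n)) 2 \<omega> = 0" unfolding AE_all_countable by (rule allI)
  then have "AE \<omega> in M. X 2 \<omega> - X 1 \<omega> = 0"
    using AE_space
  proof eventually_elim
    case (elim \<omega>)
    have "smoothed (1 / real (Suc n)) \<omega> 2 = smoothed (1 / real (Suc n)) \<omega> 1" for n
    proof -
      define \<epsilon> where "\<epsilon> = 1 / real (Suc n)"
      have \<epsilon>: "0 < \<epsilon>" "\<epsilon> \<le> 1" by (auto simp: \<epsilon>_def)
      have Gc: "continuous_on {0..2} (\<lambda>t. \<bar>G \<epsilon> t \<omega>\<bar>)"
        by (intro continuous_on_rabs continuous_on_subset[OF G_cont[OF elim(2)]]) simp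
      have "((\<lambda>t. \<bar>G \<epsilon> t \<omega>\<bar>) has_integral 0) {0..2}"
        using F_eq_integral[OF elim(2), of \<epsilon> 2] elim(1) integrable_integral[OF integrable_continuous_real[OF Gc]]
        by (simp add: \<epsilon>_def)
      then have G0: "\<bar>G \<epsilon> t \<omega>\<bar> = 0" if "t \<in> {0..2}" for t
        using has_integral_0_cbox_imp_0[of 0 2 "\<lambda>t. \<bar>G \<epsilon> t \<omega>\<bar>" t] Gc that by simp
      \<comment> \<open>The times \<open>1\<close> and \<open>2\<close> leave room for the shift: as
        \<epsilon> is at most \<open>1\<close>, \<open>z - \<epsilon>\<close> stays in
        \<open>{0..2}\<close>.\<close>
      obtain z where z: "1 < z" "z < 2" "smoothed \<epsilon> \<omega> 2 - smoothed \<epsilon> \<omega> 1 = (2 - 1) * dsmoothed \<epsilon> \<omega> z"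
        using MVT2[of 1 2 "smoothed \<epsilon> \<omega>" "dsmoothed \<epsilon> \<omega>"] smoothed_deriv[OF elim(2) \<epsilon>(1)] by auto
      have "dsmoothed \<epsilon> \<omega> z = 0" using G0[of "z - \<epsilon>"] z \<epsilon> by (simp add: dsmoothed_G)
      then show ?thesis using z(3) by (simp add: \<epsilon>_def)
    qed
    note eq = this
    have lim: "(\<lambda>n. smoothed (1 / real (Suc n)) \<omega> t) \<longlonglongrightarrow> path \<omega> t" for t
    proof -
      have "((\<lambda>\<epsilon>. smoothed \<epsilon> \<omega> t) \<longlongrightarrow> path \<omega> t) (at_right 0)"
      proof (rule tendstoI)
        fix e :: real assume "0 < e"
        then have "\<forall>\<^sub>F \<epsilon> in at_right 0. \<forall>s\<in>{t..t}. \<bar>smoothed \<epsilon> \<omega> s - path \<omega> s\<bar> \<le> e / 2" by (intro smoothed_unif elim) simp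
        then show "\<forall>\<^sub>F \<epsilon> in at_right 0. dist (smoothed \<epsilon> \<omega> t) (path \<omega> t) < e"
          by eventually_elim (use \<open>0 < e\<close> in \<open>auto simp: dist_real_def\<close>)
      qed
      moreover have "filterlim (\<lambda>n. 1 / real (Suc n)) (at_right 0) sequentially"
        by (rule tendsto_imp_filterlim_at_right[OF LIMSEQ_Suc[OF lim_1_over_n]]) simp
      ultimately show ?thesis by (rule filterlim_compose)
    qed
    have "path \<omega> 2 = path \<omega> 1"
      using lim[of 2] lim[of 1] unfolding eq by (rule LIMSEQ_unique)
    then show ?case by (simp add: path_def)
  qed
  then have "(\<integral>\<omega>. (X 2 \<omega> - X 1 \<omega>)\<^sup>2 \<partial>M) = (\<integral>\<omega>. 0 \<partial>M)"
    by (intro integral_cong_AE) (auto elim!: eventually_mono)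
  then show False using increment(3)[of 1 2] by simp
qed

text \<open>The shift by \<epsilon> brings in negative times, where stationarity fails. The crude
  bound of order \<open>\<epsilon> powr (- \<alpha> / 2)\<close> on an interval of length \<epsilon>
  is enough since \<open>\<alpha> < 2\<close>.\<close>

lemma boundary_tendsto:
  assumes \<omega>: "\<omega> \<in> space M"
  shows "((\<lambda>\<epsilon>. integral {- \<epsilon>..0} (\<lambda>t. \<bar>G \<epsilon> t \<omega>\<bar>)) \<longlongrightarrow> 0) (at_right 0)"
proof -
  obtain K where K: "0 \<le> K" "\<And>t. t \<in> {-1..2} \<Longrightarrow> \<bar>path \<omega> t\<bar> \<le> K"
    using continuous_bounded_Icc[OF path_cont[OF \<omega>]] by blast
  have ev: "\<forall>\<^sub>F \<epsilon> in at_right 0. norm (integral {- \<epsilon>..0} (\<lambda>t. \<bar>G \<epsilon> t \<omega>\<bar>)) \<le> K * mass * \<epsilon> powr (1 - \<alpha> / 2)"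
    using eventually_at_right_real[of 0 1, OF zero_less_one]
  proof eventually_elim
    case (elim \<epsilon>)
    have le: "\<bar>G \<epsilon> t \<omega>\<bar> \<le> \<epsilon> powr (- \<alpha> / 2) * (K * mass)" if t: "t \<in> {- \<epsilon>..0}" for t
    proof -
      have "\<bar>S (\<lambda>u. path \<omega> (t + \<epsilon> * (1 - u)))\<bar> \<le> K * mass"
      proof (rule S_bound)
        show "(\<lambda>u. path \<omega> (t + \<epsilon> * (1 - u))) \<in> borel_measurable borel"
          by (intro borel_measurable_continuous_onI continuous_on_compose2[OF path_cont[OF \<omega>]] continuous_intros) auto
        fix u :: real assume u: "u \<in> {-1..1}"
        have "0 \<le> \<epsilon> * (1 - u)" "\<epsilon> * (1 - u) \<le> 1 * 2" using u elim by (intro mult_nonneg_nonneg mult_mono; simp)+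
        then show "\<bar>path \<omega> (t + \<epsilon> * (1 - u))\<bar> \<le> K" using t elim by (intro K(2)) auto
      qed
      then show ?thesis by (simp add: G_def abs_mult mult_left_mono)
    qed
    have "norm (integral {- \<epsilon>..0} (\<lambda>t. \<bar>G \<epsilon> t \<omega>\<bar>)) \<le> (\<epsilon> powr (- \<alpha> / 2) * (K * mass)) * (0 - (- \<epsilon>))"
      using elim le by (intro integral_bound continuous_on_rabs continuous_on_subset[OF G_cont[OF \<omega>]]) auto
    also have "\<dots> = K * mass * \<epsilon> powr (1 - \<alpha> / 2)"
      using elim by (simp add: powr_diff powr_minus_divide)
    finally show ?case .
  qed
  have "((\<lambda>\<epsilon>. K * mass * \<epsilon> powr (1 - \<alpha> / 2)) \<longlongrightarrow> K * mass * 0 powr (1 - \<alpha> / 2)) (at_right 0)"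
    using \<alpha> eventually_mono[OF eventually_at_right_less[of "0::real"] less_imp_le]
    by (intro tendsto_intros tendsto_powr') auto
  then have "((\<lambda>\<epsilon>. K * mass * \<epsilon> powr (1 - \<alpha> / 2)) \<longlongrightarrow> 0) (at_right 0)" by simp
  then show ?thesis by (rule Lim_null_comparison[OF ev])
qed

text \<open>Almost sure convergence is at hand for countably many endpoints; monotonicity in the
  endpoint extends it to all reals, and the same squeeze absorbs the shift from \<open>b\<close> to
  \<open>b - \<epsilon>\<close>.\<close>

lemma speed_tendsto:
  assumes \<omega>: "\<omega> \<in> space M"
    and lim: "\<And>q. 0 \<le> q \<Longrightarrow> ((\<lambda>\<epsilon>. F \<epsilon> (real_of_rat q) \<omega>) \<longlongrightarrow> real_of_rat q * m1) (at_right 0)"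
    and b: "0 \<le> b"
  shows "((\<lambda>\<epsilon>. integral {0..b} (\<lambda>t. \<bar>G \<epsilon> (t - \<epsilon>) \<omega>\<bar>)) \<longlongrightarrow> b * m1) (at_right 0)"
proof (cases "b = 0")
  case False
  then have b0: "0 < b" using b by simp
  have m1: "0 < m1" using \<rho>_0_pos by (simp add: m1_def)
  have Gi: "(\<lambda>t. \<bar>G \<epsilon> t \<omega>\<bar>) integrable_on {c..d}" for \<epsilon> c d
    by (intro integrable_continuous_real continuous_on_rabs continuous_on_subset[OF G_cont[OF \<omega>]]) simp
  show ?thesis
  proof (rule tendstoI)
    fix r :: real assume r: "0 < r"
    \<comment> \<open>Moving the endpoint by \<open>\<delta>\<close> changes the limit by
      \<open>r / 4\<close>; this divides by \<open>m1\<close>, which is positive by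
      \<open>\<rho>_0_pos\<close>.\<close>
    define \<delta> where "\<delta> = r / (4 * m1)"
    have \<delta>: "0 < \<delta>" "\<delta> * m1 = r / 4" using r m1 by (auto simp: \<delta>_def)
    obtain q where q: "b < real_of_rat q" "real_of_rat q < b + \<delta>" using of_rat_dense[of b "b + \<delta>"] \<delta>(1) by auto
    obtain p where p: "max 0 (b - \<delta>) < real_of_rat p" "real_of_rat p < b"
      using of_rat_dense[of "max 0 (b - \<delta>)" b] \<delta>(1) b0 by auto
    have p0: "0 < real_of_rat p" using p(1) by (rule le_less_trans[OF max.cobounded1])
    have pq0: "0 \<le> p" "0 \<le> q" 
    proof -
      have "0 < real_of_rat q" using b0 q(1) by (rule less_trans)
      with p0 show "0 \<le> p" "0 \<le> q" by simp_all
    qed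
    have qm: "real_of_rat q * m1 < b * m1 + r / 4"
    proof -
      have "real_of_rat q * m1 < (b + \<delta>) * m1" using q m1 by (intro mult_strict_right_mono)
      then show ?thesis using \<delta>(2) by (simp add: distrib_right)
    qed
    have pm: "b * m1 - r / 4 < real_of_rat p * m1"
    proof -
      have "(b - \<delta>) * m1 < real_of_rat p * m1" using p m1 by (intro mult_strict_right_mono) auto
      then show ?thesis using \<delta>(2) by (simp add: left_diff_distrib)
    qed
    have r4: "0 < r / 4" using r by simp
    note tendstoD[OF lim[OF pq0(1)] r4] tendstoD[OF lim[OF pq0(2)] r4] tendstoD[OF boundary_tendsto[OF \<omega>] r4]
    moreover have "\<forall>\<^sub>F \<epsilon> in at_right 0. \<epsilon> \<in> {0<..<b - real_of_rat p}"
      using p by (intro eventually_at_right_real) simp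
    ultimately show "\<forall>\<^sub>F \<epsilon> in at_right 0. dist (integral {0..b} (\<lambda>t. \<bar>G \<epsilon> (t - \<epsilon>) \<omega>\<bar>)) (b * m1) < r"
    proof eventually_elim
      case (elim \<epsilon>)
      have \<epsilon>: "0 \<le> \<epsilon>" "\<epsilon> \<le> b" "real_of_rat p \<le> b - \<epsilon>"
        using elim(4) p0 unfolding greaterThanLessThan_iff by linarith+
      have "integral {0..b} (\<lambda>t. \<bar>G \<epsilon> (t - \<epsilon>) \<omega>\<bar>) = integral {- \<epsilon>..b - \<epsilon>} (\<lambda>t. \<bar>G \<epsilon> t \<omega>\<bar>)"
        using integral_shift_Icc_real[of 0 b "\<lambda>t. \<bar>G \<epsilon> t \<omega>\<bar>" "- \<epsilon>"] by (simp add: o_def)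
      also have "\<dots> = integral {- \<epsilon>..0} (\<lambda>t. \<bar>G \<epsilon> t \<omega>\<bar>) + F \<epsilon> (b - \<epsilon>) \<omega>"
        unfolding F_eq_integral[OF \<omega>] using \<epsilon>
        by (intro Henstock_Kurzweil_Integration.integral_combine[symmetric] Gi) auto
      finally have eq: "integral {0..b} (\<lambda>t. \<bar>G \<epsilon> (t - \<epsilon>) \<omega>\<bar>) = integral {- \<epsilon>..0} (\<lambda>t. \<bar>G \<epsilon> t \<omega>\<bar>) + F \<epsilon> (b - \<epsilon>) \<omega>" .
      have "F \<epsilon> (real_of_rat p) \<omega> \<le> F \<epsilon> (b - \<epsilon>) \<omega>" "F \<epsilon> (b - \<epsilon>) \<omega> \<le> F \<epsilon> (real_of_rat q) \<omega>"
        unfolding F_eq_integral[OF \<omega>] using \<epsilon> q by (intro integral_subset_le Gi; simp)+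
      then show ?case using elim qm pm unfolding eq dist_real_def by linarith
    qed
  qed
qed simp

text \<open>The factor \<open>c\<close> stands for \<open>sqrt (Y \<omega>)\<close>, constant along
  a path. It enters the limit through the composition with \<open>f\<close> and once more, as an
  absolute value, through the speed.\<close>

lemma weighted_speed_tendsto:
  assumes \<omega>: "\<omega> \<in> space M"
    and lim: "\<And>q. 0 \<le> q \<Longrightarrow> ((\<lambda>\<epsilon>. F \<epsilon> (real_of_rat q) \<omega>) \<longlongrightarrow> real_of_rat q * m1) (at_right 0)"
    and ab: "0 \<le> a" "a \<le> b" and f: "continuous_on UNIV f"
  shows "((\<lambda>\<epsilon>. \<epsilon> powr (1 - \<alpha> / 2) * integral {a..b} (\<lambda>t. f (c * smoothed \<epsilon> \<omega> t) * \<bar>c * dsmoothed \<epsilon> \<omega> t\<bar>)) \<longlongrightarrow>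
    \<bar>c\<bar> * m1 * integral {a..b} (\<lambda>t. f (c * path \<omega> t))) (at_right 0)"
proof -
  have m1: "0 \<le> m1" using \<rho>_0_nonneg by (simp add: m1_def)
  have Gc: "continuous_on UNIV (\<lambda>t. \<bar>G \<epsilon> (t - \<epsilon>) \<omega>\<bar>)" for \<epsilon>
    by (intro continuous_on_rabs continuous_on_compose2[OF G_cont[OF \<omega>]] continuous_intros) auto
  have Gi: "(\<lambda>t. \<bar>G \<epsilon> (t - \<epsilon>) \<omega>\<bar>) integrable_on {u..v}" for \<epsilon> u v
    by (intro integrable_continuous_real continuous_on_subset[OF Gc]) simp
  have yc: "continuous_on UNIV (smoothed \<epsilon> \<omega>)" if "0 < \<epsilon>" for \<epsilon>
    using smoothed_deriv[OF \<omega> that] by (meson DERIV_isCont continuous_at_imp_continuous_on)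
  have pc: "continuous_on UNIV (\<lambda>t. f (c * path \<omega> t))"
    by (rule continuous_on_compose2[OF f continuous_on_mult_left[OF path_cont[OF \<omega>]]]) auto
  have "((\<lambda>\<epsilon>. integral {a..b} (\<lambda>t. f (c * smoothed \<epsilon> \<omega> t) * \<bar>G \<epsilon> (t - \<epsilon>) \<omega>\<bar>)) \<longlongrightarrow>
    m1 * integral {a..b} (\<lambda>t. f (c * path \<omega> t))) (at_right 0)"
  proof (rule integral_weak_tendsto[OF ab(2) Gc _ _ pc _ m1])
    show "continuous_on UNIV (\<lambda>t. f (c * smoothed \<epsilon> \<omega> t))" if "0 < \<epsilon>" for \<epsilon>
      by (rule continuous_on_compose2[OF f continuous_on_mult_left[OF yc[OF that]]]) auto
  next
    fix u v assume uv: "a \<le> u" "u \<le> v" "v \<le> b"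
    have "((\<lambda>\<epsilon>. integral {0..v} (\<lambda>t. \<bar>G \<epsilon> (t - \<epsilon>) \<omega>\<bar>) - integral {0..u} (\<lambda>t. \<bar>G \<epsilon> (t - \<epsilon>) \<omega>\<bar>)) \<longlongrightarrow> v * m1 - u * m1) (at_right 0)"
      using uv ab by (intro tendsto_diff speed_tendsto[OF \<omega> lim]) auto
    moreover have "integral {0..v} (\<lambda>t. \<bar>G \<epsilon> (t - \<epsilon>) \<omega>\<bar>) - integral {0..u} (\<lambda>t. \<bar>G \<epsilon> (t - \<epsilon>) \<omega>\<bar>) = integral {u..v} (\<lambda>t. \<bar>G \<epsilon> (t - \<epsilon>) \<omega>\<bar>)" for \<epsilon>
      using Henstock_Kurzweil_Integration.integral_combine[OF _ uv(2) Gi, of 0 \<epsilon>] uv ab by simp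
    ultimately show "((\<lambda>\<epsilon>. integral {u..v} (\<lambda>t. \<bar>G \<epsilon> (t - \<epsilon>) \<omega>\<bar>)) \<longlongrightarrow> m1 * (v - u)) (at_right 0)"
      by (simp add: algebra_simps)
  next
    fix \<eta> :: real assume \<eta>: "0 < \<eta>"
    obtain K where K: "0 \<le> K" "\<And>t. t \<in> {a..b} \<Longrightarrow> \<bar>path \<omega> t\<bar> \<le> K"
      using continuous_bounded_Icc[OF path_cont[OF \<omega>]] by blast
    \<comment> \<open>Bounds the scaled path and its regularizations once they differ from the path
      by at most \<open>1\<close>; on this compact range \<open>f\<close> is uniformly
      continuous.\<close>
    define L where "L = \<bar>c\<bar> * (K + 1)"
    have "uniformly_continuous_on {- L..L} f"
      by (intro compact_uniformly_continuous continuous_on_subset[OF f]) auto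
    then obtain d where d: "0 < d" "\<And>s t. s \<in> {- L..L} \<Longrightarrow> t \<in> {- L..L} \<Longrightarrow> \<bar>s - t\<bar> < d \<Longrightarrow> \<bar>f s - f t\<bar> < \<eta>"
      unfolding uniformly_continuous_on_def dist_real_def using \<eta> by metis
    define e where "e = min 1 (d / (2 * (\<bar>c\<bar> + 1)))"
    have e: "0 < e" "e \<le> 1" using d(1) by (auto simp: e_def)
    have ce: "\<bar>c\<bar> * e < d"
    proof -
      have "\<bar>c\<bar> * e \<le> (\<bar>c\<bar> + 1) * (d / (2 * (\<bar>c\<bar> + 1)))" using e by (intro mult_mono) (auto simp: e_def)
      also have "\<dots> = d / 2" by (simp add: field_simps)
      finally show ?thesis using d(1) by linarith
    qed
    from smoothed_unif[OF \<omega> e(1), of a b]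
    show "\<forall>\<^sub>F \<epsilon> in at_right 0. \<forall>t\<in>{a..b}. \<bar>f (c * smoothed \<epsilon> \<omega> t) - f (c * path \<omega> t)\<bar> \<le> \<eta>"
    proof eventually_elim
      case (elim \<epsilon>)
      show ?case
      proof
        fix t assume t: "t \<in> {a..b}"
        have 1: "\<bar>smoothed \<epsilon> \<omega> t - path \<omega> t\<bar> \<le> e" using elim t by blast
        have "\<bar>c * smoothed \<epsilon> \<omega> t\<bar> \<le> L" "\<bar>c * path \<omega> t\<bar> \<le> L"
          unfolding L_def abs_mult using 1 K(2)[OF t] e by (intro mult_left_mono; simp)+
        moreover have "\<bar>c * smoothed \<epsilon> \<omega> t - c * path \<omega> t\<bar> < d"
        proof -
          have "\<bar>c * smoothed \<epsilon> \<omega> t - c * path \<omega> t\<bar> = \<bar>c\<bar> * \<bar>smoothed \<epsilon> \<omega> t - path \<omega> t\<bar>"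
            by (simp add: abs_mult flip: right_diff_distrib)
          also have "\<dots> \<le> \<bar>c\<bar> * e" using 1 by (intro mult_left_mono) auto
          finally show ?thesis using ce by linarith
        qed
        ultimately show "\<bar>f (c * smoothed \<epsilon> \<omega> t) - f (c * path \<omega> t)\<bar> \<le> \<eta>"
          by (intro less_imp_le d(2)) (auto simp: abs_le_iff minus_le_iff)
      qed
    qed
  qed auto
  then have "((\<lambda>\<epsilon>. \<bar>c\<bar> * integral {a..b} (\<lambda>t. f (c * smoothed \<epsilon> \<omega> t) * \<bar>G \<epsilon> (t - \<epsilon>) \<omega>\<bar>)) \<longlongrightarrow>
    \<bar>c\<bar> * (m1 * integral {a..b} (\<lambda>t. f (c * path \<omega> t)))) (at_right 0)"
    by (rule tendsto_mult_left)
  moreover have "\<forall>\<^sub>F \<epsilon> in at_right 0. \<bar>c\<bar> * integral {a..b} (\<lambda>t. f (c * smoothed \<epsilon> \<omega> t) * \<bar>G \<epsilon> (t - \<epsilon>) \<omega>\<bar>) =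
    \<epsilon> powr (1 - \<alpha> / 2) * integral {a..b} (\<lambda>t. f (c * smoothed \<epsilon> \<omega> t) * \<bar>c * dsmoothed \<epsilon> \<omega> t\<bar>)"
    using eventually_at_right_less[of "0::real"]
  proof eventually_elim
    case (elim \<epsilon>)
    have "\<epsilon> powr (1 - \<alpha> / 2) * \<epsilon> powr (\<alpha> / 2 - 1) = 1" using elim by (simp flip: powr_add)
    then have "\<bar>c\<bar> * (f (c * smoothed \<epsilon> \<omega> t) * \<bar>G \<epsilon> (t - \<epsilon>) \<omega>\<bar>) = \<epsilon> powr (1 - \<alpha> / 2) * (f (c * smoothed \<epsilon> \<omega> t) * \<bar>c * dsmoothed \<epsilon> \<omega> t\<bar>)" for t
      using elim by (simp add: dsmoothed_G abs_mult mult_ac) 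
    then show ?case by (simp only: Henstock_Kurzweil_Integration.integral_mult_right[symmetric])
  qed
  ultimately show ?thesis by (auto simp: mult.assoc elim: Lim_transform_eventually)
qed

end

subsection \<open>Local time\<close>

text \<open>Absolute continuity makes the Radon-Nikodym derivative a true density of the occupation
  measure; the formula is then the image measure theorem.\<close>

lemma integral_local_time:
  fixes x f :: "real \<Rightarrow> real"
  assumes x [measurable]: "x \<in> borel_measurable borel" and I [measurable]: "I \<in> sets borel"
    and fin: "emeasure lborel I < \<infinity>" and f [measurable]: "f \<in> borel_measurable borel"
    and ac: "absolutely_continuous lborel (occupation_measure x I)"
  shows "(\<integral>z. f z * enn2real (local_time x I z) \<partial>lborel) = (LINT t:I|lborel. f (x t))"
proof -
  let ?\<mu> = "occupation_measure x I"
  have xr: "x \<in> borel_measurable (restrict_space lborel I)" by (intro measurable_restrict_space1) simp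
  have sets: "sets ?\<mu> = sets lborel" by (simp add: occupation_measure_def)
  have "finite_measure (restrict_space lborel I)"
    using fin by (intro finite_measureI) (simp add: space_restrict_space emeasure_restrict_space less_top)
  then have "finite_measure ?\<mu>"
    unfolding occupation_measure_def by (rule finite_measure.finite_measure_distr) (rule xr)
  then interpret \<mu>: finite_measure ?\<mu> .
  have "(\<integral>z. f z * enn2real (local_time x I z) \<partial>lborel) = (\<integral>z. enn2real (RN_deriv lborel ?\<mu> z) * f z \<partial>lborel)"
    by (simp add: local_time_def mult.commute)
  also have "\<dots> = (\<integral>z. f z \<partial>?\<mu>)"
    using sigma_finite_measure.RN_deriv_integral[OF lborel.sigma_finite_measure_axioms \<mu>.sigma_finite_measure_axioms ac sets] by simp
  also have "\<dots> = (\<integral>t. f (x t) \<partial>restrict_space lborel I)"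
    unfolding occupation_measure_def by (rule integral_distr[OF xr]) simp
  also have "\<dots> = (LINT t:I|lborel. f (x t))"
    unfolding set_lebesgue_integral_def by (rule integral_restrict_space) simp
  finally show ?thesis .
qed

text \<open>Open and half-open intervals differ from \<open>{a..b}\<close> by a null set. That
  \<open>a\<close> lies in the closure lets it inherit nonnegativity from \<open>I\<close>.\<close>

lemma set_integral_interval_eq:
  fixes I :: "real set"
  assumes I: "is_interval I" "bounded I" "I \<noteq> {}"
  obtains a b where "a \<le> b" "a \<in> closure I"
    "\<And>h :: real \<Rightarrow> real. continuous_on UNIV h \<Longrightarrow> (LINT t:I|lborel. h t) = integral {a..b} h"
proof -
  have bdd: "bdd_above I" "bdd_below I" using I(2) by (auto intro: bounded_imp_bdd_above bounded_imp_bdd_below)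
  define a where "a = Inf I"
  define b where "b = Sup I"
  have sub: "I \<subseteq> {a..b}" using bdd by (auto simp: a_def b_def intro: cInf_lower cSup_upper)
  have sup: "{a<..<b} \<subseteq> I"
  proof
    fix t assume t: "t \<in> {a<..<b}"
    obtain u where u: "u \<in> I" "u < t" using t cInf_less_iff[OF I(3) bdd(2)] by (auto simp: a_def)
    obtain v where v: "v \<in> I" "t < v" using t less_cSup_iff[OF I(3) bdd(1)] by (auto simp: b_def)
    show "t \<in> I" using I(1) u v unfolding is_interval_1 by (meson less_imp_le)
  qed
  have ab: "a \<le> b" using sub I(3) by force
  have a: "a \<in> closure I" unfolding a_def by (rule closure_contains_Inf[OF I(3) bdd(2)])
  show ?thesis
  proof (rule that[OF ab a])
    fix h :: "real \<Rightarrow> real" assume h: "continuous_on UNIV h"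
    note [measurable] = borel_measurable_continuous_onI[OF h] real_interval_borel_measurable[OF I(1)]
    have "(LINT t:I|lborel. h t) = (LINT t:{a..b}|lborel. h t)"
      unfolding set_lebesgue_integral_def
    proof (rule integral_cong_AE)
      show "AE t in lborel. indicator I t *\<^sub>R h t = indicator {a..b} t *\<^sub>R h t"
        using AE_lborel_singleton[of a] AE_lborel_singleton[of b]
      proof eventually_elim
        case (elim t)
        then have "t \<in> I \<longleftrightarrow> t \<in> {a..b}" using sub sup by auto
        then show ?case by (simp add: indicator_def)
      qed
    qed measurable
    also have "\<dots> = integral {a..b} h"
      by (intro set_borel_integral_eq_integral(2) borel_integrable_atLeastAtMost' continuous_on_subset[OF h]) simp
    finally show "(LINT t:I|lborel. h t) = integral {a..b} h" .
  qed
qed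

theorem theorem14:
  fixes M :: "'a measure" and Y :: "'a \<Rightarrow> real" and B\<^sub>H :: "real \<Rightarrow> 'a \<Rightarrow> real"
    and \<alpha> \<beta> :: real and \<psi> f :: "real \<Rightarrow> real" and I :: "real set"
  assumes "prob_space M"
    and "0 < \<alpha>" "\<alpha> < 2" "0 < \<beta>" "\<beta> \<le> 1"
    and "Y \<in> borel_measurable M" "\<forall>\<omega>\<in>space M. Y \<omega> \<ge> 0"
    and "\<forall>s\<ge>0. (\<integral>\<omega>. exp (- s * Y \<omega>) \<partial>M) = mittag_leffler \<beta> (- s)"
    and "fractional_brownian_motion M (\<alpha> / 2) B\<^sub>H"
    and "prob_space.indep_set M
           (sets (vimage_algebra (space M) Y borel))
           (sets (vimage_algebra (space M) (\<lambda>\<omega>. \<lambda>t\<in>{0..}. B\<^sub>H t \<omega>)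
                    (PiM {0..} (\<lambda>_. borel))))"
    and "bounded_variation_on \<psi> UNIV" "\<forall>t. t \<notin> {-1..1} \<longrightarrow> \<psi> t = 0"
    and "(\<integral>t. \<psi> t \<partial>lborel) = 1"
    and "continuous_on UNIV f" "bounded (range f)"
    and "is_interval I" "bounded I" "I \<subseteq> {0..}"
  defines "B \<equiv> \<lambda>\<omega> t. grey_brownian_motion Y B\<^sub>H t \<omega>"
  shows "AE \<omega> in M.
    (\<forall>\<epsilon>>0. (AE x in lborel. crossings (regularized_path \<psi> \<epsilon> (B \<omega>)) x I < \<infinity>) \<and>
       integrable lborel (\<lambda>x. f x * enn2real (crossings (regularized_path \<psi> \<epsilon> (B \<omega>)) x I))) \<and>
    ((\<lambda>\<epsilon>. \<epsilon> powr (1 - \<alpha> / 2) * sqrt (pi / 2) * inverse (C_psi \<alpha> \<psi>) *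
        (\<integral>x. f x * enn2real (crossings (regularized_path \<psi> \<epsilon> (B \<omega>)) x I) \<partial>lborel))
      \<longlongrightarrow> sqrt (Y \<omega>) * (\<integral>x. f x * enn2real (local_time (B \<omega>) I x) \<partial>lborel)) (at_right 0)"
proof -
  interpret prob_space M by fact
  from bounded_variation_stieltjes_pair[OF assms(11,12)] obtain P N where
    pair: "stieltjes_pair P N" and cdf: "AE u in lborel. \<psi> u = measure P {..u} - measure N {..u}"
    and st: "\<And>h. h \<in> borel_measurable borel \<Longrightarrow>
       stieltjes_integral \<psi> {-1..1} h = (\<integral>u. h u \<partial>P) - (\<integral>u. h u \<partial>N)"
    and \<psi>m: "\<psi> \<in> borel_measurable borel"
    by metis
  interpret stieltjes_pair P N by (rule pair)
  interpret regularization M B\<^sub>H \<alpha> P N \<psi>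
    by unfold_locales (use assms(2,3,9,12,13) cdf \<psi>m in auto)
  have C: "C_psi \<alpha> \<psi> = sqrt (\<rho> 0)"
  proof -
    have c: "continuous_on UNIV (\<lambda>u. \<bar>u - v\<bar> powr \<alpha>)" for v
      by (intro continuous_abs_powr continuous_intros)
    have c2: "continuous_on UNIV (\<lambda>v. S (\<lambda>u. \<bar>u - v\<bar> powr \<alpha>))"
      by (rule riemann_tendsto2(2)) (unfold case_prod_beta, intro continuous_abs_powr continuous_intros)
    have stS: "stieltjes_integral \<psi> {-1..1} h = S h" if "continuous_on UNIV h" for h
      using st[OF borel_measurable_continuous_onI[OF that]] by (simp add: S_def)
    show ?thesis
      unfolding C_psi_def \<rho>_def stS[OF c] stS[OF c2] by (simp add: abs_minus_commute)
  qed
  have Ib: "I \<in> sets borel" by (rule real_interval_borel_measurable[OF assms(16)])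
  obtain b where b: "I \<subseteq> {0..b}"
  proof -
    obtain a where "I \<subseteq> cbox (- a) a" using assms(17) bounded_subset_cbox_symmetric by metis
    then show ?thesis using assms(18) by (intro that[of a]) force
  qed
  obtain K where fK: "\<And>x. \<bar>f x\<bar> \<le> K" using assms(15) by (auto simp: bounded_iff)
  have fm: "f \<in> borel_measurable borel" by (rule borel_measurable_continuous_onI[OF assms(14)])
  \<comment> \<open>Rational lengths allow a single exceptional null set for all
    subintervals.\<close>
  have "AE \<omega> in M. \<forall>q. 0 \<le> q \<longrightarrow> ((\<lambda>\<epsilon>. F \<epsilon> (real_of_rat q) \<omega>) \<longlongrightarrow> real_of_rat q * m1) (at_right 0)"
    unfolding AE_all_countable
  proof
    fix q :: rat
    show "AE \<omega> in M. 0 \<le> q \<longrightarrow> ((\<lambda>\<epsilon>. F \<epsilon> (real_of_rat q) \<omega>) \<longlongrightarrow> real_of_rat q * m1) (at_right 0)"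
      using AE_F_tendsto[OF \<rho>_0_pos, of "real_of_rat q"] by (cases "0 \<le> q") auto
  qed
  with AE_space AE_X_0 AE_occupation_absolutely_continuous[OF Ib b] show ?thesis
  proof eventually_elim
    case (elim \<omega>)
    define c where "c = sqrt (Y \<omega>)"
    have c0: "0 \<le> c" using elim(1) assms(7) by (simp add: c_def)
    have lim: "((\<lambda>\<epsilon>. F \<epsilon> (real_of_rat q) \<omega>) \<longlongrightarrow> real_of_rat q * m1) (at_right 0)" if "0 \<le> q" for q
      using elim(4) that by blast
    have B_eq: "B \<omega> t = c * path \<omega> t" if "0 \<le> t" for t
      using that by (simp add: B_def grey_brownian_motion_def c_def path_def)
    \<comment> \<open>The continuation by zero in the convolution and the continuation of
      \<open>path\<close> by its initial value coincide, because this \<open>\<omega>\<close>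
      satisfies \<open>B\<^sub>H 0 \<omega> = 0\<close>.\<close>
    have ext: "zero_ext (B \<omega>) s = c * path \<omega> s" for s
      using elim(2) by (auto simp: zero_ext_def B_eq path_def max_def)
    have reg: "regularized_path \<psi> \<epsilon> (B \<omega>) = (\<lambda>t. c * smoothed \<epsilon> \<omega> t)" if "0 < \<epsilon>" for \<epsilon>
      unfolding regularized_path_eq[OF that] ext smoothed_def
      by (simp add: mult.left_commute fun_eq_iff flip: integral_mult_right_zero)
    have D: "((\<lambda>t. c * smoothed \<epsilon> \<omega> t) has_real_derivative c * dsmoothed \<epsilon> \<omega> t) (at t)"
      "continuous_on UNIV (\<lambda>t. c * dsmoothed \<epsilon> \<omega> t)" if "0 < \<epsilon>" for \<epsilon> t
      by (intro DERIV_cmult smoothed_deriv elim(1) that continuous_on_mult_left dsmoothed_cont)+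
    note BI = banach_indicatrix[OF D assms(16,17) fm fK]
    have pm: "path \<omega> \<in> borel_measurable borel" by (rule borel_measurable_continuous_onI[OF path_cont[OF elim(1)]])
    show ?case
    proof (intro conjI allI impI)
      fix \<epsilon> :: real assume \<epsilon>: "0 < \<epsilon>"
      show "AE x in lborel. crossings (regularized_path \<psi> \<epsilon> (B \<omega>)) x I < \<infinity>"
        "integrable lborel (\<lambda>x. f x * enn2real (crossings (regularized_path \<psi> \<epsilon> (B \<omega>)) x I))"
        unfolding reg[OF \<epsilon>] by (rule BI(1,2)[OF \<epsilon> \<epsilon>])+
    next
      \<comment> \<open>For \<open>c = 0\<close> the path is constant and the occupation measure
        need not have a density, but the prefactor makes both sides zero.\<close>
      have R: "sqrt (Y \<omega>) * (\<integral>x. f x * enn2real (local_time (B \<omega>) I x) \<partial>lborel) = c * (LINT t:I|lborel. f (c * path \<omega> t))"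
      proof (cases "c = 0")
        case False
        then have c: "0 < c" using c0 by simp
        have "occupation_measure (B \<omega>) I = occupation_measure (\<lambda>t. c * path \<omega> t) I"
          unfolding occupation_measure_def using assms(18) B_eq
          by (intro distr_cong) (auto simp: space_restrict_space)
        then have "local_time (B \<omega>) I = local_time (\<lambda>t. c * path \<omega> t) I" by (simp add: local_time_def)
        moreover have "emeasure lborel I < \<infinity>" using assms(17) by (rule emeasure_bounded_finite)
        moreover have "absolutely_continuous lborel (occupation_measure (\<lambda>t. c * path \<omega> t) I)"
          by (rule occupation_measure_scale[OF pm Ib c elim(3)])
        ultimately show ?thesis
          using integral_local_time[of "\<lambda>t. c * path \<omega> t" I f] pm Ib fm by (simp add: c_def)
      qed (simp add: c_def)
      have "((\<lambda>\<epsilon>. \<epsilon> powr (1 - \<alpha> / 2) * (LINT t:I|lborel. f (c * smoothed \<epsilon> \<omega> t) * \<bar>c * dsmoothed \<epsilon> \<omega> t\<bar>)) \<longlongrightarrow>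
        \<bar>c\<bar> * m1 * (LINT t:I|lborel. f (c * path \<omega> t))) (at_right 0)"
      proof (cases "I = {}")
        case False
        obtain a d where ad: "a \<le> d" "a \<in> closure I"
          and ie: "\<And>h :: real \<Rightarrow> real. continuous_on UNIV h \<Longrightarrow> (LINT t:I|lborel. h t) = integral {a..d} h"
          using set_integral_interval_eq[OF assms(16,17) False] by blast
        have a0: "0 \<le> a" using ad(2) closure_mono[OF assms(18)] by auto
        have pc: "continuous_on UNIV (\<lambda>t. f (c * path \<omega> t))"
          by (rule continuous_on_compose2[OF assms(14) continuous_on_mult_left[OF path_cont[OF elim(1)]]]) auto
        have yc: "continuous_on UNIV (\<lambda>t. f (c * smoothed \<epsilon> \<omega> t) * \<bar>c * dsmoothed \<epsilon> \<omega> t\<bar>)" if "0 < \<epsilon>" for \<epsilon>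
        proof -
          have "continuous_on UNIV (\<lambda>t. c * smoothed \<epsilon> \<omega> t)"
            using D(1)[OF that] by (meson DERIV_isCont continuous_at_imp_continuous_on)
          from continuous_on_compose2[OF assms(14) this] D(2)[OF that] show ?thesis
            by (intro continuous_on_mult[OF _ continuous_on_rabs]) auto
        qed
        have ev: "\<forall>\<^sub>F \<epsilon> in at_right 0. \<epsilon> powr (1 - \<alpha> / 2) * integral {a..d} (\<lambda>t. f (c * smoothed \<epsilon> \<omega> t) * \<bar>c * dsmoothed \<epsilon> \<omega> t\<bar>) =
          \<epsilon> powr (1 - \<alpha> / 2) * (LINT t:I|lborel. f (c * smoothed \<epsilon> \<omega> t) * \<bar>c * dsmoothed \<epsilon> \<omega> t\<bar>)"
          using eventually_at_right_less[of "0::real"] by eventually_elim (simp only: ie yc)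
        show ?thesis unfolding ie[OF pc]
          by (rule Lim_transform_eventually[OF weighted_speed_tendsto[OF elim(1) lim a0 ad(1) assms(14)] ev])
      qed (simp add: set_lebesgue_integral_def)
      from tendsto_mult_left[OF this, of "sqrt (pi / 2) * inverse (C_psi \<alpha> \<psi>)"]
      have "((\<lambda>\<epsilon>. sqrt (pi / 2) * inverse (C_psi \<alpha> \<psi>) * (\<epsilon> powr (1 - \<alpha> / 2) * (LINT t:I|lborel. f (c * smoothed \<epsilon> \<omega> t) * \<bar>c * dsmoothed \<epsilon> \<omega> t\<bar>))) \<longlongrightarrow>
        sqrt (pi / 2) * inverse (C_psi \<alpha> \<psi>) * (\<bar>c\<bar> * m1 * (LINT t:I|lborel. f (c * path \<omega> t)))) (at_right 0)" .
      \<comment> \<open>The normalization is the reciprocal of \<open>m1\<close>: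
        \<open>sqrt (pi / 2)\<close> cancels the Gaussian absolute moment and
        \<open>C_psi \<alpha> \<psi>\<close> cancels the standard deviation
        \<open>sqrt (\<rho> 0)\<close>.\<close>
      moreover have "sqrt (pi / 2) * inverse (C_psi \<alpha> \<psi>) * (\<bar>c\<bar> * m1 * (LINT t:I|lborel. f (c * path \<omega> t))) =
        sqrt (Y \<omega>) * (\<integral>x. f x * enn2real (local_time (B \<omega>) I x) \<partial>lborel)"
      proof -
        have "sqrt (pi / 2) * sqrt (2 / pi) = 1" by (simp flip: real_sqrt_mult)
        moreover have "inverse (C_psi \<alpha> \<psi>) * sqrt (\<rho> 0) = 1" using \<rho>_0_pos by (simp add: C)
        ultimately have "(sqrt (pi / 2) * sqrt (2 / pi)) * (inverse (C_psi \<alpha> \<psi>) * sqrt (\<rho> 0)) = 1" by simp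
        then have "sqrt (pi / 2) * inverse (C_psi \<alpha> \<psi>) * m1 = 1" unfolding m1_def by (simp only: mult_ac)
        then have "(sqrt (pi / 2) * inverse (C_psi \<alpha> \<psi>) * m1) * (\<bar>c\<bar> * (LINT t:I|lborel. f (c * path \<omega> t))) =
          c * (LINT t:I|lborel. f (c * path \<omega> t))" using c0 by simp
        then show ?thesis unfolding R by (simp only: mult_ac)
      qed
      moreover have "\<forall>\<^sub>F \<epsilon> in at_right 0. sqrt (pi / 2) * inverse (C_psi \<alpha> \<psi>) * (\<epsilon> powr (1 - \<alpha> / 2) * (LINT t:I|lborel. f (c * smoothed \<epsilon> \<omega> t) * \<bar>c * dsmoothed \<epsilon> \<omega> t\<bar>))
        = \<epsilon> powr (1 - \<alpha> / 2) * sqrt (pi / 2) * inverse (C_psi \<alpha> \<psi>) *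
          (\<integral>x. f x * enn2real (crossings (regularized_path \<psi> \<epsilon> (B \<omega>)) x I) \<partial>lborel)"
        using eventually_at_right_less[of "0::real"]
      proof eventually_elim
        case (elim \<epsilon>)
        show ?case unfolding reg[OF elim] BI(3)[OF elim elim] by (simp only: mult_ac)
      qed
      ultimately show "((\<lambda>\<epsilon>. \<epsilon> powr (1 - \<alpha> / 2) * sqrt (pi / 2) * inverse (C_psi \<alpha> \<psi>) *
          (\<integral>x. f x * enn2real (crossings (regularized_path \<psi> \<epsilon> (B \<omega>)) x I) \<partial>lborel))
        \<longlongrightarrow> sqrt (Y \<omega>) * (\<integral>x. f x * enn2real (local_time (B \<omega>) I x) \<partial>lborel)) (at_right 0)"
        by (simp only:) (rule Lim_transform_eventually)
    qed
  qed
qed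

end
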